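(* For every two wavelet sets $W_0$ and $W_1$ there exists a family of wavelet sets $\{W_t\}_{t\in[0,1]}$ connecting them (i.e. whose members at $t=0$ and $t=1$ are the given $W_0$ and $W_1$) such that $d(W_t,W_s)\to0$ as $t\to s$ (for every $s\in[0,1]$), where $$d(W_1,W_2):=\mu(W_1\triangle W_2)^{1/2}+\left(\int_{W_1\triangle W_2}\frac{1}{|x|}\,d\mu(x)\right)^{1/2}$$ for any two wavelet sets $W_1,W_2$.
   Context: $\mu$ is Lebesgue measure on $\mathbb{R}$ and $W_1\triangle W_2=(W_1\setminus W_2)\cup(W_2\setminus W_1)$. An orthonormal wavelet is $w\in L^2(\mathbb{R})$ such that $\{2^{j/2}w(2^j\cdot-k)\}_{j,k\in\mathbb{Z}}$ is an orthonormal basis of $L^2(\mathbb{R})$. With $\hat f(x)=\frac1{\sqrt{2\pi}}\int_{\mathbb{R}}e^{-itx}f(t)\,d\mu(t)$ (extended to $L^2(\mathbb{R})$), a measurable set $W\subset\mathbb{R}$ is a wavelet set if $\frac1{\sqrt{\mu(W)}}\chi_W=\hat w$ for some orthonormal wavelet $w$. Equivalently (a known fact), there is a set $W'$ equal to $W$ a.e. such that $\{W'+2k\pi\}_{k\in\mathbb{Z}}$ is a partition of $\mathbb{R}$ and $\{2^kW'\}_{k\in\mathbb{Z}}$ is a partition of $\mathbb{R}\setminus\{0\}$. Wavelet sets that agree up to a null set are identified. *)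

theory Defs
  imports "HOL-Analysis.Analysis"
begin

text \<open>Square-integrable functions are represented by functions rather than by equivalence
  classes; every notion below is invariant under changes on a null set.\<close>

definition L2 :: "(real \<Rightarrow> complex) set" where
  "L2 = {f. f \<in> borel_measurable lebesgue \<and> integrable lebesgue (\<lambda>t. (cmod (f t))\<^sup>2)}"

definition L2_inner :: "(real \<Rightarrow> complex) \<Rightarrow> (real \<Rightarrow> complex) \<Rightarrow> complex" where
  "L2_inner f g = (LINT t|lebesgue. f t * cnj (g t))"

definition L2_norm :: "(real \<Rightarrow> complex) \<Rightarrow> real" where
  "L2_norm f = sqrt (LINT t|lebesgue. (cmod (f t))\<^sup>2)"

text \<open>An orthonormal basis is a maximal orthonormal family: nothing but the zero vector of
  the Hilbert space is orthogonal to all of its members.\<close>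

definition orthonormal_basis_L2 :: "('i \<Rightarrow> real \<Rightarrow> complex) \<Rightarrow> bool" where
  "orthonormal_basis_L2 \<psi> \<longleftrightarrow>
     (\<forall>i. \<psi> i \<in> L2) \<and>
     (\<forall>i i'. L2_inner (\<psi> i) (\<psi> i') = (if i = i' then 1 else 0)) \<and>
     (\<forall>f\<in>L2. (\<forall>i. L2_inner f (\<psi> i) = 0) \<longrightarrow> (AE t in lebesgue. f t = 0))"

definition dyadic_system :: "(real \<Rightarrow> complex) \<Rightarrow> int \<times> int \<Rightarrow> real \<Rightarrow> complex" where
  "dyadic_system w = (\<lambda>(j, k) t.
     complex_of_real (2 powr (of_int j / 2)) * w (2 powi j * t - of_int k))"

definition orthonormal_wavelet :: "(real \<Rightarrow> complex) \<Rightarrow> bool" where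
  "orthonormal_wavelet w \<longleftrightarrow> w \<in> L2 \<and> orthonormal_basis_L2 (dyadic_system w)"

definition fourier_L1 :: "(real \<Rightarrow> complex) \<Rightarrow> real \<Rightarrow> complex" where
  "fourier_L1 f x =
     complex_of_real (1 / sqrt (2 * pi)) * (LINT t|lebesgue. exp (- \<i> * of_real t * of_real x) * f t)"

text \<open>The extension of the integral transform from integrable square-integrable functions
  to all square-integrable functions by continuity. It is stated as a relation because the
  transform \<open>g\<close> of \<open>f\<close> is determined only up to a null set. By Plancherel's theorem the
  requirement \<open>fourier_L1 (u n) \<in> L2\<close> holds automatically; it makes explicit that the norm of
  the difference is the integral of an integrable function.\<close>

definition is_fourier_L2 :: "(real \<Rightarrow> complex) \<Rightarrow> (real \<Rightarrow> complex) \<Rightarrow> bool" where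
  "is_fourier_L2 f g \<longleftrightarrow> f \<in> L2 \<and> g \<in> L2 \<and>
     (\<exists>u. (\<forall>n::nat. u n \<in> L2 \<and> integrable lebesgue (u n) \<and> fourier_L1 (u n) \<in> L2) \<and>
          (\<lambda>n. L2_norm (\<lambda>t. u n t - f t)) \<longlonglongrightarrow> 0 \<and>
          (\<lambda>n. L2_norm (\<lambda>x. fourier_L1 (u n) x - g x)) \<longlonglongrightarrow> 0)"

text \<open>If \<open>W\<close> is null or of infinite measure, the function below is zero (almost
  everywhere), which is not the transform of a wavelet, so such \<open>W\<close> are excluded.\<close>

definition wavelet_set :: "real set \<Rightarrow> bool" where
  "wavelet_set W \<longleftrightarrow> W \<in> sets lebesgue \<and>
     (\<exists>w. orthonormal_wavelet w \<and>
          is_fourier_L2 w (\<lambda>x. complex_of_real (1 / sqrt (measure lebesgue W) * indicator W x)))"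

text \<open>Both terms are genuine finite quantities for wavelet sets: a wavelet set \<open>W\<close> has measure
  \<open>2 * pi\<close>, and \<open>1 / \<bar>x\<bar>\<close> is integrable over \<open>W\<close> with integral \<open>2 * ln 2\<close>.\<close>

definition wavelet_set_dist :: "real set \<Rightarrow> real set \<Rightarrow> real" where
  "wavelet_set_dist V W =
     sqrt (measure lebesgue (sym_diff V W)) + sqrt (LINT x:sym_diff V W|lebesgue. 1 / \<bar>x\<bar>)"

end

theory Submission
  imports Defs "HOL-Probability.Probability"
begin

text \<open>
  A wavelet set is, up to a null set, a set that tiles the line under the translations by
  \<open>2 * pi * k\<close> and under the dilations by \<open>2 ^ j\<close>. Regard each \<open>x\<close> as an edge joining its
  translation class to its dilation class: such a set is a perfect matching between the two kinds
  of classes. Lebesgue measure is invariant under translations and \<open>dx / \<bar>x\<bar>\<close> is invariant under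
  dilations, so the first measures translation classes, the second measures dilation classes, and
  the two terms of the distance measure how much two matchings differ on either side.

  Given a tile \<open>W\<close> and \<open>0 < u \<le> 4\<close>, take the far window \<open>F = {32 / u..<32 / u + 2 * pi}\<close>, which
  meets every translation class exactly once and no dilation class twice, and the near shell
  \<open>G = {x. u / 8 \<le> \<bar>x\<bar> < u / 4}\<close>, which meets every dilation class except that of \<open>0\<close>
  exactly once and no translation class twice. Remove from \<open>W\<close> all points whose translation class meets \<open>(- u, u)\<close> or
  whose dilation class meets \<open>F\<close>. The rest \<open>A\<close> is a partial matching whose free translation
  classes include those of \<open>G\<close> and whose free dilation classes include those of \<open>F\<close>. As in the
  Schroeder-Bernstein theorem, \<open>A\<close> extends to a perfect matching by a part \<open>F'\<close> of \<open>F\<close> and a part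
  \<open>G'\<close> of \<open>G\<close> (\<open>far_part_fixpoint\<close>, \<open>completion_tile\<close>).

  The completion depends continuously on \<open>A\<close>, \<open>F\<close> and \<open>G\<close>. A change of \<open>G'\<close> alters \<open>F'\<close> by at most
  the same amount and vice versa, but \<open>F\<close> lies in \<open>\<bar>x\<bar> \<ge> 2\<close>, where \<open>dx / \<bar>x\<bar>\<close> is at most half of
  Lebesgue measure, and \<open>G\<close> lies in \<open>\<bar>x\<bar> \<le> 1\<close>, where Lebesgue measure is at most \<open>dx / \<bar>x\<bar>\<close>. One
  turn around the loop is therefore a contraction by a factor of two
  (\<open>completion_set_sym_diff_le\<close>). As \<open>u\<close> tends to \<open>0\<close> the removed part of \<open>W\<close> becomes small, so the
  completions converge to \<open>W\<close> (\<open>completion_set_sym_diff_base_le\<close>). For \<open>u = 4\<close> every translation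
  class meets \<open>(- 4, 4)\<close>, hence \<open>A\<close> is empty and the completion does not depend on \<open>W\<close>. Every tile
  is thus joined by a path to one and the same tile, and two such paths together join \<open>W0\<close> to \<open>W1\<close>.

  The description of wavelet sets as tiles (\<open>wavelet_set_of_tile\<close>, \<open>tile_of_wavelet_set\<close>) rests on
  two analytic facts. The first is Plancherel's theorem, obtained by damping a transform with a
  Gaussian factor, which turns its inverse into an average against a normal density; it transports
  orthonormality and completeness of the dyadic system to the Fourier side. The second is that an
  integrable function on the circle is determined by its Fourier coefficients
  (\<open>vanishing_coefficients_periodic_set\<close>), obtained from the Stone-Weierstrass theorem. On the
  Fourier side the wavelet is a multiple of the indicator of \<open>W\<close>: orthogonality of different scales
  and completeness say that the dilates of \<open>W\<close> tile, and the trigonometric system is an orthogonal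
  basis on \<open>W\<close> exactly if its translates tile.
\<close>

section \<open>Square-integrable functions\<close>

lemma L2_measurable: "f \<in> L2 \<Longrightarrow> f \<in> borel_measurable lebesgue"
  by (simp add: L2_def)

lemma L2_square_integrable: "f \<in> L2 \<Longrightarrow> integrable lebesgue (\<lambda>t. (cmod (f t))\<^sup>2)"
  by (simp add: L2_def)

lemma L2_dominated:
  assumes "f \<in> borel_measurable lebesgue" "integrable lebesgue h"
    and "\<And>x. (cmod (f x))\<^sup>2 \<le> h x"
  shows "f \<in> L2"
proof -
  have "integrable lebesgue (\<lambda>t. (cmod (f t))\<^sup>2)"
    by (rule Bochner_Integration.integrable_bound[OF assms(2)])
       (use assms in \<open>auto intro!: AE_I2 order_trans[OF _ abs_ge_self]\<close>)
  then show ?thesis using assms(1) by (simp add: L2_def)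
qed

lemma cmod_add_square_le: "(cmod (a + b))\<^sup>2 \<le> 2 * (cmod a)\<^sup>2 + 2 * (cmod b)\<^sup>2"
proof -
  have "(cmod (a + b))\<^sup>2 \<le> (cmod a + cmod b)\<^sup>2"
    by (intro power_mono norm_triangle_ineq) auto
  also have "\<dots> \<le> 2 * (cmod a)\<^sup>2 + 2 * (cmod b)\<^sup>2"
    using sum_squares_bound[of "cmod a" "cmod b"] by (simp add: power2_sum)
  finally show ?thesis .
qed

lemma L2_add: "f \<in> L2 \<Longrightarrow> g \<in> L2 \<Longrightarrow> (\<lambda>x. f x + g x) \<in> L2"
  by (rule L2_dominated[where h = "\<lambda>x. 2 * (cmod (f x))\<^sup>2 + 2 * (cmod (g x))\<^sup>2"])
     (auto simp: L2_def cmod_add_square_le)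

lemma L2_cmult: "f \<in> L2 \<Longrightarrow> (\<lambda>x. c * f x) \<in> L2"
  by (auto simp: L2_def norm_mult power_mult_distrib)

lemma L2_diff: "f \<in> L2 \<Longrightarrow> g \<in> L2 \<Longrightarrow> (\<lambda>x. f x - g x) \<in> L2"
  using L2_add[of f "\<lambda>x. - 1 * g x"] L2_cmult[of g "-1"] by simp

lemma L2_bounded_mult:
  assumes "f \<in> L2" "\<phi> \<in> borel_measurable lebesgue" "\<And>x. cmod (\<phi> x) \<le> 1"
  shows "(\<lambda>x. \<phi> x * f x) \<in> L2"
proof (rule L2_dominated[where h = "\<lambda>x. (cmod (f x))\<^sup>2"])
  show "(cmod (\<phi> x * f x))\<^sup>2 \<le> (cmod (f x))\<^sup>2" for x
    using assms(3)[of x] by (auto simp: norm_mult intro!: power_mono mult_left_le_one_le)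
qed (use assms in \<open>auto simp: L2_def\<close>)

lemma L2_cnj: "f \<in> L2 \<Longrightarrow> (\<lambda>x. cnj (f x)) \<in> L2"
  unfolding L2_def
  by (auto intro!: measurable_compose[OF _ borel_measurable_continuous_onI[of cnj]] continuous_intros)

lemma L2_norm_nonneg [simp]: "0 \<le> L2_norm f"
  by (simp add: L2_norm_def)

lemma L2_norm_square: "(L2_norm f)\<^sup>2 = (LINT t|lebesgue. (cmod (f t))\<^sup>2)"
  by (simp add: L2_norm_def)

lemma L2_inner_self: "L2_inner f f = complex_of_real ((L2_norm f)\<^sup>2)"
  unfolding L2_norm_square L2_inner_def
  by (simp add: complex_norm_square[symmetric] del: of_real_power)

lemma L2_mult_integrable:
  assumes "f \<in> L2" "g \<in> L2"
  shows "integrable lebesgue (\<lambda>x. f x * g x)"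
proof (rule Bochner_Integration.integrable_bound)
  show "integrable lebesgue (\<lambda>x. (cmod (f x))\<^sup>2 + (cmod (g x))\<^sup>2)"
    using assms by (simp add: L2_def)
  have "cmod (f x * g x) \<le> (cmod (f x))\<^sup>2 + (cmod (g x))\<^sup>2" for x
    using sum_squares_bound[of "cmod (f x)" "cmod (g x)"]
      mult_nonneg_nonneg[of "cmod (f x)" "cmod (g x)", OF norm_ge_zero norm_ge_zero]
    unfolding norm_mult by linarith
  then show "AE x in lebesgue. norm (f x * g x) \<le> norm ((cmod (f x))\<^sup>2 + (cmod (g x))\<^sup>2)"
    by (auto intro!: AE_I2 order_trans[OF _ abs_ge_self])
qed (use assms L2_measurable in auto)

lemma L2_inner_integrable:
  "f \<in> L2 \<Longrightarrow> g \<in> L2 \<Longrightarrow> integrable lebesgue (\<lambda>x. f x * cnj (g x))"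
  using L2_mult_integrable L2_cnj by blast

lemma L2_inner_diff_left:
  "f \<in> L2 \<Longrightarrow> g \<in> L2 \<Longrightarrow> h \<in> L2 \<Longrightarrow>
    L2_inner (\<lambda>x. f x - g x) h = L2_inner f h - L2_inner g h"
  unfolding L2_inner_def by (simp add: left_diff_distrib L2_inner_integrable)

lemma L2_inner_diff_right:
  "f \<in> L2 \<Longrightarrow> g \<in> L2 \<Longrightarrow> h \<in> L2 \<Longrightarrow>
    L2_inner f (\<lambda>x. g x - h x) = L2_inner f g - L2_inner f h"
  unfolding L2_inner_def by (simp add: right_diff_distrib L2_inner_integrable)

text \<open>The optimal choice \<open>c = sqrt B / sqrt A\<close> degenerates if a root vanishes; adding \<open>e > 0\<close> to both
  roots avoids the case distinction, and then \<open>e\<close> tends to \<open>0\<close>.\<close>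

lemma le_sqrt_mult_sqrt:
  fixes A B P :: real
  assumes "A \<ge> 0" "B \<ge> 0" and P: "\<And>c. c > 0 \<Longrightarrow> 2 * P \<le> c * A + B / c"
  shows "P \<le> sqrt A * sqrt B"
proof -
  have bound: "2 * P \<le> 2 * (sqrt A * sqrt B) + e * (sqrt A + sqrt B)" if "e > 0" for e
  proof -
    define a b where "a = sqrt A" and "b = sqrt B"
    have ab: "a \<ge> 0" "b \<ge> 0" "A = a * a" "B = b * b"
      using assms by (auto simp: a_def b_def)
    have pos: "a + e > 0" "b + e > 0" using ab \<open>e > 0\<close> by auto
    have "2 * P \<le> (b + e) / (a + e) * A + B / ((b + e) / (a + e))"
      using P[of "(b + e) / (a + e)"] pos by (simp add: mult.commute)
    also have "\<dots> = (b + e) * a * (a / (a + e)) + (a + e) * b * (b / (b + e))"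
      using pos by (simp add: ab field_simps)
    also have "\<dots> \<le> (b + e) * a * 1 + (a + e) * b * 1"
      using ab pos \<open>e > 0\<close> by (intro add_mono mult_left_mono) (auto simp: field_simps)
    finally show ?thesis by (simp add: a_def b_def algebra_simps)
  qed
  have "((\<lambda>e. 2 * (sqrt A * sqrt B) + e * (sqrt A + sqrt B)) \<longlongrightarrow>
      2 * (sqrt A * sqrt B) + 0 * (sqrt A + sqrt B)) (at_right 0)"
    by (intro tendsto_intros)
  moreover have "\<forall>\<^sub>F e in at_right 0. 2 * P \<le> 2 * (sqrt A * sqrt B) + e * (sqrt A + sqrt B)"
    using bound by (auto simp: eventually_at_right_field intro!: exI[of _ 1])
  ultimately have "2 * P \<le> 2 * (sqrt A * sqrt B) + 0 * (sqrt A + sqrt B)"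
    by (rule tendsto_lowerbound) simp
  then show ?thesis by simp
qed

text \<open>Integration of \<open>2 * a * b \<le> c * a\<^sup>2 + b\<^sup>2 / c\<close>, followed by optimisation over \<open>c\<close>.\<close>

lemma L2_norm_product_bound:
  assumes f: "f \<in> L2" and g: "g \<in> L2"
  shows "(LINT x|lebesgue. cmod (f x) * cmod (g x)) \<le> L2_norm f * L2_norm g"
  unfolding L2_norm_def
proof (rule le_sqrt_mult_sqrt)
  have [simp]: "integrable lebesgue (\<lambda>x. cmod (f x) * cmod (g x))"
    using integrable_norm[OF L2_mult_integrable[OF f g]] by (simp add: norm_mult)
  fix c :: real assume "c > 0"
  have int: "integrable lebesgue (\<lambda>x. (cmod (f x))\<^sup>2)" "integrable lebesgue (\<lambda>x. (cmod (g x))\<^sup>2)"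
    using f g by (auto simp: L2_def)
  have "2 * (LINT x|lebesgue. cmod (f x) * cmod (g x)) =
      (LINT x|lebesgue. 2 * (cmod (f x) * cmod (g x)))" by simp
  also have "\<dots> \<le> (LINT x|lebesgue. c * (cmod (f x))\<^sup>2 + (cmod (g x))\<^sup>2 / c)"
  proof (rule integral_mono)
    fix x
    have "0 \<le> (sqrt c * cmod (f x) - cmod (g x) / sqrt c)\<^sup>2" by simp
    then show "2 * (cmod (f x) * cmod (g x)) \<le> c * (cmod (f x))\<^sup>2 + (cmod (g x))\<^sup>2 / c"
      using \<open>c > 0\<close> by (simp add: power2_diff power_mult_distrib power_divide)
  qed (use int in auto)
  also have "\<dots> = c * (LINT x|lebesgue. (cmod (f x))\<^sup>2) + (LINT x|lebesgue. (cmod (g x))\<^sup>2) / c"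
    using int by simp
  finally show "2 * (LINT x|lebesgue. cmod (f x) * cmod (g x)) \<le> \<dots>" .
qed auto

lemma L2_Cauchy_Schwarz:
  assumes f: "f \<in> L2" and g: "g \<in> L2"
  shows "cmod (L2_inner f g) \<le> L2_norm f * L2_norm g"
proof -
  have "cmod (L2_inner f g) \<le> (LINT x|lebesgue. cmod (f x * cnj (g x)))"
    unfolding L2_inner_def by (rule integral_norm_bound)
  also have "\<dots> \<le> L2_norm f * L2_norm g"
    using L2_norm_product_bound[OF f g] by (simp add: norm_mult)
  finally show ?thesis .
qed

lemma L2_triangle:
  assumes f: "f \<in> L2" and g: "g \<in> L2"
  shows "L2_norm (\<lambda>x. f x + g x) \<le> L2_norm f + L2_norm g"
proof (rule power2_le_imp_le)
  have [simp]: "integrable lebesgue (\<lambda>x. cmod (f x) * cmod (g x))"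
    using integrable_norm[OF L2_mult_integrable[OF f g]] by (simp add: norm_mult)
  have int [simp]: "integrable lebesgue (\<lambda>x. (cmod (f x))\<^sup>2)" "integrable lebesgue (\<lambda>x. (cmod (g x))\<^sup>2)"
    using f g by (auto simp: L2_def)
  have "(L2_norm (\<lambda>x. f x + g x))\<^sup>2 \<le>
      (LINT x|lebesgue. (cmod (f x))\<^sup>2 + (cmod (g x))\<^sup>2 + 2 * (cmod (f x) * cmod (g x)))"
    unfolding L2_norm_square
  proof (rule integral_mono)
    fix x
    have "(cmod (f x + g x))\<^sup>2 \<le> (cmod (f x) + cmod (g x))\<^sup>2"
      by (intro power_mono norm_triangle_ineq) auto
    then show "(cmod (f x + g x))\<^sup>2 \<le>
        (cmod (f x))\<^sup>2 + (cmod (g x))\<^sup>2 + 2 * (cmod (f x) * cmod (g x))"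
      by (simp add: power2_sum)
  qed (use L2_add[OF f g] in \<open>auto simp: L2_def\<close>)
  also have "\<dots> = (L2_norm f)\<^sup>2 + (L2_norm g)\<^sup>2 + 2 * (LINT x|lebesgue. cmod (f x) * cmod (g x))"
    by (simp add: L2_norm_square)
  also have "\<dots> \<le> (L2_norm f + L2_norm g)\<^sup>2"
    using L2_norm_product_bound[OF f g] by (simp add: power2_sum)
  finally show "(L2_norm (\<lambda>x. f x + g x))\<^sup>2 \<le> (L2_norm f + L2_norm g)\<^sup>2" .
qed simp

lemma L2_norm_minus_commute: "L2_norm (\<lambda>x. f x - g x) = L2_norm (\<lambda>x. g x - f x)"
  by (simp add: L2_norm_def norm_minus_commute)

lemma L2_norm_triangle_diff:
  assumes "f \<in> L2" "g \<in> L2" "h \<in> L2"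
  shows "L2_norm (\<lambda>x. f x - h x) \<le> L2_norm (\<lambda>x. f x - g x) + L2_norm (\<lambda>x. g x - h x)"
  using L2_triangle[OF L2_diff[OF assms(1,2)] L2_diff[OF assms(2,3)]] by simp

lemma L2_norm_eq_0_iff:
  assumes "f \<in> L2"
  shows "L2_norm f = 0 \<longleftrightarrow> (AE x in lebesgue. f x = 0)"
  using integral_nonneg_eq_0_iff_AE[OF L2_square_integrable[OF assms]]
  by (simp add: L2_norm_def)

lemma L2_inner_tendsto:
  assumes L2: "\<And>n. u n \<in> L2" "\<And>n. v n \<in> L2" "f \<in> L2" "g \<in> L2"
    and u: "(\<lambda>n. L2_norm (\<lambda>x. u n x - f x)) \<longlonglongrightarrow> 0"
    and v: "(\<lambda>n. L2_norm (\<lambda>x. v n x - g x)) \<longlonglongrightarrow> 0"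
  shows "(\<lambda>n. L2_inner (u n) (v n)) \<longlonglongrightarrow> L2_inner f g"
proof (rule LIM_zero_cancel, rule tendsto_norm_zero_cancel, rule tendsto_sandwich[OF _ _ tendsto_const])
  let ?U = "\<lambda>n x. u n x - f x" and ?V = "\<lambda>n x. v n x - g x"
  have U: "?U n \<in> L2" and V: "?V n \<in> L2" for n using L2 by (auto intro: L2_diff)
  have eq: "L2_inner (u n) (v n) - L2_inner f g =
      L2_inner (?U n) (?V n) + L2_inner (?U n) g + L2_inner f (?V n)" for n
    by (simp add: L2_inner_diff_left L2_inner_diff_right L2 L2_diff)
  have "cmod (L2_inner (u n) (v n) - L2_inner f g) \<le>
      L2_norm (?U n) * L2_norm (?V n) + L2_norm (?U n) * L2_norm g + L2_norm f * L2_norm (?V n)" for n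
    unfolding eq
    by (intro norm_triangle_mono L2_Cauchy_Schwarz U V L2)
  then show "\<forall>\<^sub>F n in sequentially. norm (L2_inner (u n) (v n) - L2_inner f g) \<le>
      L2_norm (?U n) * L2_norm (?V n) + L2_norm (?U n) * L2_norm g + L2_norm f * L2_norm (?V n)"
    by simp
  have "(\<lambda>n. L2_norm (?U n) * L2_norm (?V n) + L2_norm (?U n) * L2_norm g + L2_norm f * L2_norm (?V n))
      \<longlonglongrightarrow> 0 * 0 + 0 * L2_norm g + L2_norm f * 0"
    using u v by (intro tendsto_intros)
  then show "(\<lambda>n. L2_norm (?U n) * L2_norm (?V n) + L2_norm (?U n) * L2_norm g + L2_norm f * L2_norm (?V n))
      \<longlonglongrightarrow> 0" by simp
qed auto

section \<open>Mean continuity of translation\<close>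

lemma lborel_integral_translate:
  fixes f :: "real \<Rightarrow> 'a::{banach, second_countable_topology}"
  shows "(LINT x|lborel. f (x + r)) = integral\<^sup>L lborel f"
  using lborel_integral_real_affine[of 1 f r] by (simp add: add.commute)

lemma lborel_integrable_translate:
  fixes f :: "real \<Rightarrow> 'a::{banach, second_countable_topology}"
  shows "integrable lborel (\<lambda>x. f (x + r)) \<longleftrightarrow> integrable lborel f"
  using lborel_integrable_real_affine_iff[of 1 f r] by (simp add: add.commute)

text \<open>The limit is taken along sequences because it is reached through dominated convergence.\<close>

definition L1_translation_continuous :: "(real \<Rightarrow> real) \<Rightarrow> bool" where
  "L1_translation_continuous f \<longleftrightarrow>
    (\<forall>r. r \<longlonglongrightarrow> 0 \<longrightarrow> (\<lambda>n. LINT x|lborel. \<bar>f (x + r n) - f x\<bar>) \<longlonglongrightarrow> 0)"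

text \<open>Integrals are translation invariant, so replacing \<open>f\<close> by \<open>g\<close> costs twice the distance of the
  two, whatever the translation is.\<close>

lemma L1_translation_continuous_limit:
  assumes f: "integrable lborel f"
    and approx: "\<And>e. e > 0 \<Longrightarrow> \<exists>g. integrable lborel g \<and> L1_translation_continuous g \<and>
      (LINT x|lborel. \<bar>f x - g x\<bar>) < e"
  shows "L1_translation_continuous f"
  unfolding L1_translation_continuous_def
proof (intro allI impI LIMSEQ_I)
  fix r :: "nat \<Rightarrow> real" and e :: real assume r: "r \<longlonglongrightarrow> 0" and "e > 0"
  then obtain g where g: "integrable lborel g" "L1_translation_continuous g"
      and fg: "(LINT x|lborel. \<bar>f x - g x\<bar>) < e / 3"
    using approx[of "e/3"] by auto
  have "(\<lambda>n. LINT x|lborel. \<bar>g (x + r n) - g x\<bar>) \<longlonglongrightarrow> 0"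
    using g r by (auto simp: L1_translation_continuous_def)
  then obtain N where N: "(LINT x|lborel. \<bar>g (x + r n) - g x\<bar>) < e / 3" if "n \<ge> N" for n
    using LIMSEQ_D[of _ 0 "e/3"] \<open>e > 0\<close> by fastforce
  have "norm ((LINT x|lborel. \<bar>f (x + r n) - f x\<bar>) - 0) < e" if "n \<ge> N" for n
  proof -
    note [simp] = f g lborel_integrable_translate[THEN iffD2]
    have "(LINT x|lborel. \<bar>f (x + r n) - f x\<bar>) \<le>
        (LINT x|lborel. \<bar>f (x + r n) - g (x + r n)\<bar> + \<bar>g (x + r n) - g x\<bar> + \<bar>f x - g x\<bar>)"
      by (intro integral_mono) auto
    also have "\<dots> = (LINT x|lborel. \<bar>f (x + r n) - g (x + r n)\<bar>) +
        (LINT x|lborel. \<bar>g (x + r n) - g x\<bar>) + (LINT x|lborel. \<bar>f x - g x\<bar>)"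
      by simp
    also have "(LINT x|lborel. \<bar>f (x + r n) - g (x + r n)\<bar>) = (LINT x|lborel. \<bar>f x - g x\<bar>)"
      by (rule lborel_integral_translate)
    finally show ?thesis using fg N[OF that] by simp
  qed
  then show "\<exists>N. \<forall>n\<ge>N. norm ((LINT x|lborel. \<bar>f (x + r n) - f x\<bar>) - 0) < e" by blast
qed

text \<open>For \<open>x \<in> U\<close> the translates \<open>x + r n\<close> are eventually in \<open>U\<close>, hence the integral of the product of
  the two indicators tends to the measure of \<open>U\<close>.\<close>

lemma L1_translation_continuous_open:
  fixes U :: "real set"
  assumes U: "open U" "emeasure lborel U < \<infinity>"
  shows "L1_translation_continuous (indicator U)"
  unfolding L1_translation_continuous_def
proof (intro allI impI)
  fix r :: "nat \<Rightarrow> real" assume r: "r \<longlonglongrightarrow> 0"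
  have int [simp]: "integrable lborel (indicator U :: real \<Rightarrow> real)"
    using U by (simp add: integrable_indicator_iff)
  have [measurable]: "U \<in> sets borel" using U by simp
  have intr [simp]: "integrable lborel (\<lambda>x. indicator U (x + a) :: real)" for a
    by (simp add: lborel_integrable_translate)
  have prod [simp]: "integrable lborel (\<lambda>x. indicator U x * indicator U (x + a) :: real)" for a
    by (rule Bochner_Integration.integrable_bound[OF int]) (auto simp: indicator_def)
  have eq: "(LINT x|lborel. \<bar>indicator U (x + r n) - indicator U x\<bar>) =
      2 * (LINT x|lborel. indicator U x) - 2 * (LINT x|lborel. indicator U x * indicator U (x + r n) :: real)"
    for n
  proof -
    have "(LINT x|lborel. \<bar>indicator U (x + r n) - indicator U x\<bar>) =
       (LINT x|lborel. indicator U (x + r n) + indicator U x - 2 * (indicator U x * indicator U (x + r n) :: real))"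
      by (intro Bochner_Integration.integral_cong) (auto simp: indicator_def)
    also have "\<dots> = (LINT x|lborel. indicator U (x + r n)) + (LINT x|lborel. indicator U x)
        - 2 * (LINT x|lborel. indicator U x * indicator U (x + r n) :: real)"
      using int intr[of "r n"] prod[of "r n"] by (simp del: integral_indicator)
    finally show ?thesis using lborel_integral_translate[of "indicator U :: real \<Rightarrow> real" "r n"] by simp
  qed
  have "(\<lambda>n. LINT x|lborel. indicator U x * indicator U (x + r n) :: real) \<longlonglongrightarrow>
      (LINT x|lborel. indicator U x)"
  proof (rule integral_dominated_convergence[where w="indicator U"])
    have "(\<lambda>n. indicator U x * indicator U (x + r n) :: real) \<longlonglongrightarrow> indicator U x" for x
    proof (cases "x \<in> U")
      case True
      have "(\<lambda>n. x + r n) \<longlonglongrightarrow> x" using tendsto_add[OF tendsto_const[of x] r] by simp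
      then have "\<forall>\<^sub>F n in sequentially. x + r n \<in> U"
        using topological_tendstoD[OF _ U(1) True] by blast
      then have "\<forall>\<^sub>F n in sequentially. indicator U x * indicator U (x + r n) = (indicator U x :: real)"
        by eventually_elim (simp add: True)
      then show ?thesis by (rule tendsto_eventually)
    qed simp
    then show "AE x in lborel. (\<lambda>n. indicator U x * indicator U (x + r n) :: real) \<longlonglongrightarrow> indicator U x"
      by simp
  qed (auto simp: indicator_def)
  then have "(\<lambda>n. 2 * (LINT x|lborel. indicator U x) -
      2 * (LINT x|lborel. indicator U x * indicator U (x + r n) :: real)) \<longlonglongrightarrow>
      2 * (LINT x|lborel. indicator U x) - 2 * (LINT x|lborel. indicator U x)"
    by (intro tendsto_intros)
  then show "(\<lambda>n. LINT x|lborel. \<bar>indicator U (x + r n) - indicator U x\<bar> :: real) \<longlonglongrightarrow> 0"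
    unfolding eq by simp
qed

lemma L1_translation_continuous_cmult:
  assumes "L1_translation_continuous f"
  shows "L1_translation_continuous (\<lambda>x. f x * c)"
proof -
  have "\<bar>f (x + a) * c - f x * c\<bar> = \<bar>f (x + a) - f x\<bar> * \<bar>c\<bar>" for x a
    by (simp add: abs_mult left_diff_distrib[symmetric])
  then show ?thesis
    using assms by (auto simp: L1_translation_continuous_def intro!: tendsto_mult_left_zero)
qed

text \<open>Indicators of Borel sets are approximated by those of open sets through outer regularity; sums
  and limits then reach every integrable function.\<close>

lemma integrable_L1_translation_continuous:
  assumes "integrable lborel f"
  shows "L1_translation_continuous f"
  using assms
proof (induction rule: integrable_induct)
  case (base A c)
  then have [measurable]: "A \<in> sets borel" by simp
  have A: "L1_translation_continuous (indicator A)"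
  proof (rule L1_translation_continuous_limit)
    show "integrable lborel (indicator A :: real \<Rightarrow> real)"
      using base by (simp add: integrable_indicator_iff)
    fix e :: real assume "e > 0"
    then obtain U where U: "open U" "A \<subseteq> U" "emeasure lborel (U - A) < e"
      using outer_regular_lborel[of A e] base by auto
    have [measurable]: "U \<in> sets borel" using U by simp
    have "emeasure lborel U \<le> emeasure lborel A + emeasure lborel (U - A)"
      using emeasure_subadditive[of A lborel "U - A"] U(2) by (simp add: Un_absorb1)
    also have "\<dots> < \<infinity>" using base U(3) by (auto simp: less_top[symmetric] order.strict_implies_not_eq)
    finally have fin: "emeasure lborel U < \<infinity>" .
    have "(LINT x|lborel. \<bar>indicator A x - indicator U x\<bar> :: real) = (LINT x|lborel. indicator (U - A) x)"
      using U(2) by (intro Bochner_Integration.integral_cong) (auto simp: indicator_def)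
    also have "\<dots> < e"
      using U(3) \<open>e > 0\<close>
      by (cases "emeasure lborel (U - A)") (auto simp: measure_def ennreal_less_iff)
    finally show "\<exists>g. integrable lborel g \<and> L1_translation_continuous g \<and>
        (LINT x|lborel. \<bar>indicator A x - g x\<bar>) < e"
      using L1_translation_continuous_open[OF U(1) fin] fin
      by (intro exI[of _ "indicator U"]) (simp add: integrable_indicator_iff)
  qed
  show ?case using L1_translation_continuous_cmult[OF A] by simp
next
  case (add f g)
  show ?case
    unfolding L1_translation_continuous_def
  proof (intro allI impI)
    fix r :: "nat \<Rightarrow> real" assume r: "r \<longlonglongrightarrow> 0"
    note [simp] = add lborel_integrable_translate[THEN iffD2]
    show "(\<lambda>n. LINT x|lborel. \<bar>f (x + r n) + g (x + r n) - (f x + g x)\<bar>) \<longlonglongrightarrow> 0"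
    proof (rule tendsto_sandwich[OF _ _ tendsto_const])
      show "\<forall>\<^sub>F n in sequentially. (LINT x|lborel. \<bar>f (x + r n) + g (x + r n) - (f x + g x)\<bar>) \<le>
          (LINT x|lborel. \<bar>f (x + r n) - f x\<bar>) + (LINT x|lborel. \<bar>g (x + r n) - g x\<bar>)"
      proof (intro always_eventually allI)
        fix n
        have "(LINT x|lborel. \<bar>f (x + r n) + g (x + r n) - (f x + g x)\<bar>) \<le>
            (LINT x|lborel. \<bar>f (x + r n) - f x\<bar> + \<bar>g (x + r n) - g x\<bar>)"
          by (intro integral_mono) auto
        then show "(LINT x|lborel. \<bar>f (x + r n) + g (x + r n) - (f x + g x)\<bar>) \<le>
            (LINT x|lborel. \<bar>f (x + r n) - f x\<bar>) + (LINT x|lborel. \<bar>g (x + r n) - g x\<bar>)"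
          by simp
      qed
      show "(\<lambda>n. (LINT x|lborel. \<bar>f (x + r n) - f x\<bar>) + (LINT x|lborel. \<bar>g (x + r n) - g x\<bar>)) \<longlonglongrightarrow> 0"
        using add r by (auto simp: L1_translation_continuous_def intro!: tendsto_add_zero)
    qed auto
  qed
next
  case (lim f s)
  show ?case
  proof (rule L1_translation_continuous_limit[OF \<open>integrable lborel f\<close>])
    fix e :: real assume "e > 0"
    have "(\<lambda>n. LINT x|lborel. \<bar>f x - s n x\<bar>) \<longlonglongrightarrow> (LINT (x::real)|lborel. (0::real))"
    proof (rule integral_dominated_convergence[where w="\<lambda>x. 3 * \<bar>f x\<bar>" and
          s="\<lambda>n x. \<bar>f x - s n x\<bar>" and f="\<lambda>x. 0"])
      show "AE x in lborel. (\<lambda>n. \<bar>f x - s n x\<bar>) \<longlonglongrightarrow> 0"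
      proof (rule AE_I2)
        fix x show "(\<lambda>n. \<bar>f x - s n x\<bar>) \<longlonglongrightarrow> 0"
          using tendsto_diff[OF tendsto_const lim(2), of x "f x"] by (auto intro!: tendsto_rabs_zero)
      qed
      show "AE x in lborel. norm \<bar>f x - s n x\<bar> \<le> 3 * \<bar>f x\<bar>" for n
      proof (rule AE_I2)
        fix x show "norm \<bar>f x - s n x\<bar> \<le> 3 * \<bar>f x\<bar>" using lim(3)[of x n] by simp
      qed
    qed (use lim in auto)
    then obtain n where "(LINT x|lborel. \<bar>f x - s n x\<bar>) < e"
      using LIMSEQ_D[of _ 0 e] \<open>e > 0\<close> by fastforce
    then show "\<exists>g. integrable lborel g \<and> L1_translation_continuous g \<and> (LINT x|lborel. \<bar>f x - g x\<bar>) < e"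
      using lim by blast
  qed
qed

text \<open>The inequality \<open>\<bar>a - b\<bar>\<^sup>2 \<le> \<bar>a\<^sup>2 - b\<^sup>2\<bar>\<close> for nonnegative numbers reduces the quadratic mean to the
  mean of the integrable function \<open>h\<^sup>2\<close>.\<close>

lemma nonneg_L2_translation_continuous:
  fixes h :: "real \<Rightarrow> real"
  assumes h: "\<And>x. h x \<ge> 0" "h \<in> borel_measurable borel" "integrable lborel (\<lambda>x. (h x)\<^sup>2)" and r: "r \<longlonglongrightarrow> 0"
  shows "integrable lborel (\<lambda>x. (h (x + a) - h x)\<^sup>2)"
    and "(\<lambda>n. LINT x|lborel. (h (x + r n) - h x)\<^sup>2) \<longlonglongrightarrow> 0"
proof -
  have le: "(h (x + a) - h x)\<^sup>2 \<le> \<bar>(h (x + a))\<^sup>2 - (h x)\<^sup>2\<bar>" for x a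
  proof -
    have "(h (x + a) - h x)\<^sup>2 = \<bar>h (x + a) - h x\<bar> * \<bar>h (x + a) - h x\<bar>"
      by (simp add: power2_eq_square)
    also have "\<dots> \<le> \<bar>h (x + a) - h x\<bar> * (h (x + a) + h x)"
      using h(1)[of x] h(1)[of "x + a"] by (intro mult_left_mono) auto
    also have "\<dots> = \<bar>(h (x + a))\<^sup>2 - (h x)\<^sup>2\<bar>"
      using h(1)[of x] h(1)[of "x + a"] by (simp add: power2_eq_square square_diff_square_factored abs_mult)
    finally show ?thesis .
  qed
  have [measurable]: "h \<in> borel_measurable borel" by fact
  have int: "integrable lborel (\<lambda>x. \<bar>(h (x + a))\<^sup>2 - (h x)\<^sup>2\<bar>)" for a
    using h(3) lborel_integrable_translate[of "\<lambda>x. (h x)\<^sup>2" a] by simp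
  show int': "integrable lborel (\<lambda>x. (h (x + a) - h x)\<^sup>2)" for a
    by (rule Bochner_Integration.integrable_bound[OF int[of a]]) (use le in auto)
  show "(\<lambda>n. LINT x|lborel. (h (x + r n) - h x)\<^sup>2) \<longlonglongrightarrow> 0"
  proof (rule tendsto_sandwich[OF _ _ tendsto_const])
    show "(\<lambda>n. LINT x|lborel. \<bar>(h (x + r n))\<^sup>2 - (h x)\<^sup>2\<bar>) \<longlonglongrightarrow> 0"
      using integrable_L1_translation_continuous[OF h(3)] r by (simp add: L1_translation_continuous_def)
    show "\<forall>\<^sub>F n in sequentially. (LINT x|lborel. (h (x + r n) - h x)\<^sup>2) \<le>
        (LINT x|lborel. \<bar>(h (x + r n))\<^sup>2 - (h x)\<^sup>2\<bar>)"
      by (intro always_eventually allI integral_mono int int' le)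
  qed auto
qed

text \<open>A complex function is a combination of four nonnegative ones.\<close>

lemma L2_translation_continuous:
  fixes g :: "real \<Rightarrow> complex"
  assumes g [measurable]: "g \<in> borel_measurable borel" and "g \<in> L2" and r: "r \<longlonglongrightarrow> 0"
  shows "(\<lambda>n. LINT x|lborel. (cmod (g (x + r n) - g x))\<^sup>2) \<longlonglongrightarrow> 0"
proof -
  have int: "integrable lborel (\<lambda>x. (cmod (g x))\<^sup>2)"
    using L2_square_integrable[OF \<open>g \<in> L2\<close>] by (simp add: integrable_completion)
  \<comment> \<open>The positive and negative parts of the real and of the imaginary part.\<close>
  define p where "p = (\<lambda>i::nat. \<lambda>x. if i = 0 then max (Re (g x)) 0 else if i = 1 then max (- Re (g x)) 0
     else if i = 2 then max (Im (g x)) 0 else max (- Im (g x)) 0)"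
  have [measurable]: "p i \<in> borel_measurable borel" for i unfolding p_def by measurable
  have p0: "p i x \<ge> 0" for i x by (simp add: p_def)
  have ple: "p i x \<le> cmod (g x)" for i x
    using abs_Re_le_cmod[of "g x"] abs_Im_le_cmod[of "g x"] by (auto simp: p_def)
  have pint: "integrable lborel (\<lambda>x. (p i x)\<^sup>2)" for i
    by (rule Bochner_Integration.integrable_bound[OF int]) (auto intro!: power_mono p0 ple)
  have p: "integrable lborel (\<lambda>x. (p i (x + a) - p i x)\<^sup>2)"
    "(\<lambda>n. LINT x|lborel. (p i (x + r n) - p i x)\<^sup>2) \<longlonglongrightarrow> 0" for i a
    by (rule nonneg_L2_translation_continuous[OF p0 _ pint r], simp)+
  have sq: "(x - y)\<^sup>2 \<le> 2 * x\<^sup>2 + 2 * y\<^sup>2" for x y :: real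
    using sum_squares_bound[of x "- y"] by (simp add: power2_diff)
  have le: "(cmod (g (x + a) - g x))\<^sup>2 \<le> (\<Sum>i<4. 2 * (p i (x + a) - p i x)\<^sup>2)" for x a
  proof -
    have "Re (g y) = p 0 y - p 1 y" "Im (g y) = p 2 y - p 3 y" for y by (auto simp: p_def)
    then have "Re (g (x + a) - g x) = (p 0 (x + a) - p 0 x) - (p 1 (x + a) - p 1 x)"
      "Im (g (x + a) - g x) = (p 2 (x + a) - p 2 x) - (p 3 (x + a) - p 3 x)"
      by simp_all
    then have "(cmod (g (x + a) - g x))\<^sup>2 =
        ((p 0 (x + a) - p 0 x) - (p 1 (x + a) - p 1 x))\<^sup>2 + ((p 2 (x + a) - p 2 x) - (p 3 (x + a) - p 3 x))\<^sup>2"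
      by (simp only: cmod_power2)
    also have "\<dots> \<le> (2 * (p 0 (x + a) - p 0 x)\<^sup>2 + 2 * (p 1 (x + a) - p 1 x)\<^sup>2) +
        (2 * (p 2 (x + a) - p 2 x)\<^sup>2 + 2 * (p 3 (x + a) - p 3 x)\<^sup>2)"
      by (intro add_mono sq)
    finally show ?thesis by (simp add: eval_nat_numeral)
  qed
  have intr: "integrable lborel (\<lambda>x. (cmod (g (x + a) - g x))\<^sup>2)" for a
    by (rule Bochner_Integration.integrable_bound[of _ "\<lambda>x. \<Sum>i<4. 2 * (p i (x + a) - p i x)\<^sup>2"])
       (use p(1) le in \<open>auto simp: sum_nonneg\<close>)
  show ?thesis
  proof (rule tendsto_sandwich[OF _ _ tendsto_const])
    show "\<forall>\<^sub>F n in sequentially. (LINT x|lborel. (cmod (g (x + r n) - g x))\<^sup>2) \<le>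
        (\<Sum>i<4. 2 * (LINT x|lborel. (p i (x + r n) - p i x)\<^sup>2))"
    proof (intro always_eventually allI)
      fix n
      have "(LINT x|lborel. (cmod (g (x + r n) - g x))\<^sup>2) \<le>
        (LINT x|lborel. (\<Sum>i<4. 2 * (p i (x + r n) - p i x)\<^sup>2))"
        using p(1) by (intro integral_mono le intr) auto
      also have "\<dots> = (\<Sum>i<4. 2 * (LINT x|lborel. (p i (x + r n) - p i x)\<^sup>2))"
        using p(1) by simp
      finally show "(LINT x|lborel. (cmod (g (x + r n) - g x))\<^sup>2) \<le> \<dots>" .
    qed
    show "(\<lambda>n. \<Sum>i<4. 2 * (LINT x|lborel. (p i (x + r n) - p i x)\<^sup>2)) \<longlonglongrightarrow> 0"
      using p(2) by (intro tendsto_null_sum tendsto_mult_right_zero)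
  qed auto
qed

section \<open>The Fourier transform and Gaussian summation\<close>

text \<open>All kernels below are unimodular exponentials, so the product of two integrable functions
  dominates the integrand.\<close>

lemma lborel_kernel_Fubini:
  fixes f g :: "real \<Rightarrow> complex" and k :: "real \<Rightarrow> real \<Rightarrow> complex"
  assumes f: "integrable lborel f" and g: "integrable lborel g"
    and k [measurable]: "case_prod k \<in> borel_measurable (lborel \<Otimes>\<^sub>M lborel)"
    and bound: "\<And>x y. cmod (k x y) \<le> 1"
  shows "(LINT y|lborel. LINT x|lborel. k x y * f x * g y) = (LINT x|lborel. LINT y|lborel. k x y * f x * g y)"
proof (rule lborel_pair.Fubini_integral)
  have [measurable]: "f \<in> borel_measurable borel" "g \<in> borel_measurable borel" using f g by auto
  have le: "cmod (k x y * f x * g y) \<le> cmod (f x) * cmod (g y)" for x y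
    using bound[of x y] by (auto simp: norm_mult mult.assoc intro!: mult_left_le_one_le)
  have mk [measurable]: "(\<lambda>y. k x y) \<in> borel_measurable borel" for x
    using measurable_compose[OF measurable_Pair1'[of x lborel lborel] k] by simp
  have inner: "integrable lborel (\<lambda>y. k x y * f x * g y)" for x
    by (rule Bochner_Integration.integrable_bound[of _ "\<lambda>y. cmod (f x) * cmod (g y)"])
      (use g le in \<open>auto intro!: AE_I2\<close>)
  have "integrable (lborel \<Otimes>\<^sub>M lborel) (\<lambda>p. case p of (x, y) \<Rightarrow> k x y * f x * g y)"
  proof (rule lborel_pair.Fubini_integrable)
    show "integrable lborel (\<lambda>x. LINT y|lborel. norm (case (x, y) of (x, y) \<Rightarrow> k x y * f x * g y))"
    proof (rule Bochner_Integration.integrable_bound[of _ "\<lambda>x. cmod (f x) * (LINT y|lborel. cmod (g y))"])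
      have "(LINT y|lborel. norm (k x y * f x * g y)) \<le> (LINT y|lborel. cmod (f x) * cmod (g y))" for x
        using g inner le by (intro integral_mono) auto
      then show "AE x in lborel. norm (LINT y|lborel. norm (case (x, y) of (x, y) \<Rightarrow> k x y * f x * g y)) \<le>
          norm (cmod (f x) * (LINT y|lborel. cmod (g y)))"
        by (auto intro!: AE_I2)
    qed (use f in auto)
  qed (use inner in auto)
  then show "integrable (lborel \<Otimes>\<^sub>M lborel) (\<lambda>(x, y). k x y * f x * g y)" .
qed

lemma fourier_L1_lborel:
  assumes [measurable]: "f \<in> borel_measurable borel"
  shows "fourier_L1 f x =
    complex_of_real (1 / sqrt (2 * pi)) * (LINT t|lborel. exp (- \<i> * of_real t * of_real x) * f t)"
  unfolding fourier_L1_def by (subst integral_completion) auto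

lemma borel_measurable_fourier_L1:
  assumes [measurable]: "f \<in> borel_measurable borel"
  shows "fourier_L1 f \<in> borel_measurable borel"
proof -
  have "(\<lambda>x. complex_of_real (1 / sqrt (2 * pi)) * (LINT t|lborel. exp (- \<i> * of_real t * of_real x) * f t))
      \<in> borel_measurable borel"
    by measurable
  then show ?thesis using fourier_L1_lborel[OF assms] by (metis (no_types, lifting) measurable_cong)
qed

lemma cmod_fourier_L1_le: "cmod (fourier_L1 f x) \<le> 1 / sqrt (2 * pi) * (LINT t|lebesgue. cmod (f t))"
proof -
  have "cmod (LINT t|lebesgue. exp (- \<i> * of_real t * of_real x) * f t) \<le>
      (LINT t|lebesgue. cmod (exp (- \<i> * of_real t * of_real x) * f t))"
    by (rule integral_norm_bound)
  also have "\<dots> = (LINT t|lebesgue. cmod (f t))"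
    by (simp add: norm_mult norm_exp_eq_Re)
  finally show ?thesis
    unfolding fourier_L1_def norm_mult by (intro mult_mono) (auto simp: norm_divide)
qed

lemma fourier_L1_cong_AE:
  assumes "f \<in> borel_measurable lebesgue" "g \<in> borel_measurable lebesgue" "AE x in lebesgue. f x = g x"
  shows "fourier_L1 f = fourier_L1 g"
proof
  fix x
  have [measurable]: "(\<lambda>t. exp (- (\<i> * complex_of_real t * of_real x))) \<in> borel_measurable lebesgue"
    by (rule measurable_completion) measurable
  show "fourier_L1 f x = fourier_L1 g x"
    unfolding fourier_L1_def using assms
    by (auto intro!: arg_cong2[where f="(*)"] integral_cong_AE elim!: AE_mp)
qed

text \<open>Both sides are the same double integral with kernel \<open>exp (- \<i> * x * y)\<close>.\<close>

lemma fourier_L1_multiplication: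
  assumes f: "integrable lborel f" and g: "integrable lborel g"
  shows "(LINT x|lborel. f x * fourier_L1 g x) = (LINT y|lborel. fourier_L1 f y * g y)"
proof -
  have [measurable]: "f \<in> borel_measurable borel" "g \<in> borel_measurable borel" using f g by auto
  let ?c = "complex_of_real (1 / sqrt (2 * pi))"
  let ?k = "\<lambda>x y. exp (- \<i> * of_real x * of_real y) :: complex"
  have eq1: "f x * fourier_L1 g x = ?c * (LINT y|lborel. ?k x y * f x * g y)" for x
  proof -
    have "f x * (LINT y|lborel. ?k y x * g y) = (LINT y|lborel. f x * (?k y x * g y))"
      by (rule integral_mult_right_zero[symmetric])
    also have "\<dots> = (LINT y|lborel. ?k x y * f x * g y)" by (simp add: mult_ac)
    finally show ?thesis unfolding fourier_L1_lborel[OF \<open>g \<in> borel_measurable borel\<close>]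
      by (simp add: mult_ac)
  qed
  have eq2: "fourier_L1 f y * g y = ?c * (LINT x|lborel. ?k x y * f x * g y)" for y
    unfolding fourier_L1_lborel[OF \<open>f \<in> borel_measurable borel\<close>]
    by (simp add: integral_mult_left_zero[symmetric] mult.assoc del: integral_mult_left_zero)
  have "(LINT x|lborel. LINT y|lborel. ?k x y * f x * g y) = (LINT y|lborel. LINT x|lborel. ?k x y * f x * g y)"
    by (rule lborel_kernel_Fubini[symmetric, OF f g]) (auto simp: norm_exp_eq_Re)
  then show ?thesis unfolding eq1 eq2 by simp
qed

text \<open>The convolution of \<open>g\<close> with the centred normal density of standard deviation \<open>e\<close>, rescaled to a
  fixed density.\<close>

definition gauss_mean :: "real \<Rightarrow> (real \<Rightarrow> complex) \<Rightarrow> real \<Rightarrow> complex" where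
  "gauss_mean e g x = (LINT v|lborel. of_real (std_normal_density v) * g (x - e * v))"

text \<open>Up to normalisation, the Fourier transform of the normal density of standard deviation \<open>e\<close>.\<close>

definition gauss_factor :: "real \<Rightarrow> real \<Rightarrow> complex" where
  "gauss_factor e t = of_real (exp (- (e * t)\<^sup>2 / 2))"

lemma gauss_factor_measurable [measurable]: "gauss_factor e \<in> borel_measurable borel"
  unfolding gauss_factor_def by measurable

lemma gauss_factor_bound: "cmod (gauss_factor e t) \<le> 1"
  by (simp add: gauss_factor_def)

lemma integrable_gauss_factor:
  assumes "e > 0" shows "integrable lborel (gauss_factor e)"
proof -
  have "integrable lborel (\<lambda>t. complex_of_real (sqrt (2 * pi) * std_normal_density (0 + e * t)))"
    using lborel_integrable_real_affine[OF integrable_std_normal_moment[of 0], of e 0] assms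
    by (intro integrable_of_real integrable_mult_right) simp
  moreover have "complex_of_real (sqrt (2 * pi) * std_normal_density (0 + e * t)) = gauss_factor e t" for t
    by (simp add: std_normal_density_def gauss_factor_def)
  ultimately show ?thesis by simp
qed

lemma std_normal_fourier:
  "(LINT v|lborel. exp (\<i> * of_real (s * v)) * of_real (std_normal_density v)) = of_real (exp (- s\<^sup>2 / 2))"
proof -
  have "(LINT v|lborel. exp (\<i> * of_real (s * v)) * of_real (std_normal_density v)) =
      (LINT v|lborel. std_normal_density v *\<^sub>R exp (\<i> * of_real (s * v)))"
    by (simp add: scaleR_conv_of_real mult.commute)
  also have "\<dots> = char std_normal_distribution s"
    unfolding char_def by (subst integral_density) (auto simp: normal_density_nonneg)
  finally show ?thesis by (simp add: char_std_normal_distribution)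
qed

lemma gauss_factor_fourier:
  assumes "e > 0"
  shows "(LINT t|lborel. gauss_factor e t * exp (\<i> * of_real t * of_real z)) =
      of_real (2 * pi / e) * of_real (std_normal_density (z / e))"
proof -
  have "(LINT t|lborel. gauss_factor e t * exp (\<i> * of_real t * of_real z)) =
      of_real (1 / e) * (LINT v|lborel. gauss_factor e (v / e) * exp (\<i> * of_real (v / e) * of_real z))"
    using lborel_integral_real_affine[of "1 / e" "\<lambda>t. gauss_factor e t * exp (\<i> * of_real t * of_real z)" 0] assms
    by (simp add: scaleR_conv_of_real)
  also have "(LINT v|lborel. gauss_factor e (v / e) * exp (\<i> * of_real (v / e) * of_real z)) =
      (LINT v|lborel. of_real (sqrt (2 * pi)) * (exp (\<i> * of_real (z / e * v)) * of_real (std_normal_density v)))"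
    using assms by (intro Bochner_Integration.integral_cong)
      (auto simp: gauss_factor_def std_normal_density_def field_simps)
  also have "\<dots> = of_real (sqrt (2 * pi)) * of_real (exp (- (z / e)\<^sup>2 / 2))"
    by (simp only: integral_mult_right_zero std_normal_fourier)
  also have "\<dots> = of_real (2 * pi) * of_real (std_normal_density (z / e))"
    unfolding of_real_mult[symmetric] std_normal_density_def
    by (rule arg_cong[where f=of_real]) (simp add: real_div_sqrt field_simps flip: real_sqrt_mult)
  finally show ?thesis by simp
qed

text \<open>Damping makes the inversion formula absolutely convergent: exchanging the integrals leaves the
  transform of a Gaussian, which is a Gaussian, as the convolution kernel.\<close>

lemma fourier_gauss_summation:
  assumes g: "integrable lborel g" and "e > 0"
  shows "fourier_L1 (\<lambda>t. gauss_factor e t * fourier_L1 g (- t)) x = gauss_mean e g x"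
proof -
  have [measurable]: "g \<in> borel_measurable borel" using g by auto
  have [measurable]: "fourier_L1 g \<in> borel_measurable borel"
    by (rule borel_measurable_fourier_L1) simp
  let ?c = "complex_of_real (1 / sqrt (2 * pi))"
  let ?k = "\<lambda>y t. exp (\<i> * of_real t * of_real (y - x)) :: complex"
  have eq: "exp (- \<i> * of_real t * of_real x) * (gauss_factor e t * fourier_L1 g (- t)) =
      ?c * (LINT y|lborel. ?k y t * g y * gauss_factor e t)" for t
  proof -
    have "exp (- \<i> * of_real t * of_real x) * gauss_factor e t * (LINT y|lborel. exp (- \<i> * of_real y * of_real (- t)) * g y)
      = (LINT y|lborel. exp (- \<i> * of_real t * of_real x) * gauss_factor e t * (exp (- \<i> * of_real y * of_real (- t)) * g y))"
      by (rule integral_mult_right_zero[symmetric])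
    also have "\<dots> = (LINT y|lborel. ?k y t * g y * gauss_factor e t)"
      by (intro Bochner_Integration.integral_cong) (auto simp: exp_diff exp_minus field_simps)
    finally show ?thesis unfolding fourier_L1_lborel[OF \<open>g \<in> borel_measurable borel\<close>]
      by (simp add: mult_ac)
  qed
  have inner: "(LINT t|lborel. ?k y t * g y * gauss_factor e t) =
      of_real (2 * pi) * (of_real (1 / e) * of_real (std_normal_density ((y - x) / e)) * g y)" for y
  proof -
    have "(LINT t|lborel. ?k y t * g y * gauss_factor e t) =
      (LINT t|lborel. g y * (gauss_factor e t * exp (\<i> * of_real t * of_real (y - x))))"
      by (simp add: mult_ac)
    also have "\<dots> = g y * (of_real (2 * pi / e) * of_real (std_normal_density ((y - x) / e)))"
      using gauss_factor_fourier[OF \<open>e > 0\<close>, of "y - x"] by (simp del: of_real_diff)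
    finally show ?thesis by (simp add: mult_ac)
  qed
  have "fourier_L1 (\<lambda>t. gauss_factor e t * fourier_L1 g (- t)) x =
      ?c * ?c * (LINT t|lborel. LINT y|lborel. ?k y t * g y * gauss_factor e t)"
    by (subst fourier_L1_lborel[of "\<lambda>t. gauss_factor e t * fourier_L1 g (- t)"], measurable)
       (simp only: eq integral_mult_right_zero, simp only: mult.assoc)
  also have "(LINT t|lborel. LINT y|lborel. ?k y t * g y * gauss_factor e t) =
      (LINT y|lborel. LINT t|lborel. ?k y t * g y * gauss_factor e t)"
    by (rule lborel_kernel_Fubini[OF g integrable_gauss_factor[OF \<open>e > 0\<close>]]) (auto simp: norm_exp_eq_Re)
  also have "(LINT y|lborel. LINT t|lborel. ?k y t * g y * gauss_factor e t) = of_real (2 * pi) * gauss_mean e g x"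
  proof -
    have "(LINT y|lborel. of_real (1 / e) * of_real (std_normal_density ((y - x) / e)) * g y) =
        of_real e * (LINT v|lborel. of_real (1 / e) * of_real (std_normal_density (- v)) * g (x - e * v))"
      using lborel_integral_real_affine[of "- e" "\<lambda>y. of_real (1 / e) * of_real (std_normal_density ((y - x) / e)) * g y" x] \<open>e > 0\<close>
      by (simp add: scaleR_conv_of_real)
    also have "\<dots> = gauss_mean e g x"
      using \<open>e > 0\<close> unfolding gauss_mean_def
      by (simp add: normal_density_def mult.assoc)
    finally show ?thesis unfolding inner by (simp only: integral_mult_right_zero)
  qed
  also have "?c * ?c * (of_real (2 * pi) * gauss_mean e g x) = gauss_mean e g x"
    by (simp add: field_simps flip: of_real_mult)
  finally show ?thesis .
qed

section \<open>Convergence of Gaussian means\<close>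

text \<open>The Cauchy-Schwarz inequality for \<open>sqrt N * \<psi>\<close> and \<open>sqrt N\<close>, where \<open>N\<close> is the density.\<close>

lemma std_normal_Jensen:
  fixes \<psi> :: "real \<Rightarrow> complex"
  assumes [measurable]: "\<psi> \<in> borel_measurable borel"
  shows "ennreal ((cmod (LINT v|lborel. of_real (std_normal_density v) * \<psi> v))\<^sup>2) \<le>
    (\<integral>\<^sup>+v. ennreal (std_normal_density v * (cmod (\<psi> v))\<^sup>2) \<partial>lborel)"
proof (cases "(\<integral>\<^sup>+v. ennreal (std_normal_density v * (cmod (\<psi> v))\<^sup>2) \<partial>lborel) = \<infinity>")
  case False
  let ?N = std_normal_density
  define a where "a = (\<lambda>v. complex_of_real (sqrt (?N v)) * \<psi> v)"
  define b where "b = (\<lambda>v. complex_of_real (sqrt (?N v)))"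
  have [measurable]: "a \<in> borel_measurable borel" "b \<in> borel_measurable borel"
    unfolding a_def b_def by measurable
  have sq: "(cmod (a v))\<^sup>2 = ?N v * (cmod (\<psi> v))\<^sup>2" "(cmod (b v))\<^sup>2 = ?N v"
    "a v * cnj (b v) = of_real (?N v) * \<psi> v" for v
    by (auto simp: a_def b_def norm_mult power_mult_distrib normal_density_nonneg simp flip: of_real_mult)
  have int: "integrable lborel (\<lambda>v. ?N v * (cmod (\<psi> v))\<^sup>2)"
    using False by (intro integrableI_nonneg) (auto simp: less_top normal_density_nonneg)
  have "a \<in> L2" "b \<in> L2"
    using int by (auto simp: L2_def sq integrable_completion measurable_completion)
  from L2_Cauchy_Schwarz[OF this]
  have "cmod (LINT v|lborel. of_real (?N v) * \<psi> v) \<le> sqrt (LINT v|lborel. ?N v * (cmod (\<psi> v))\<^sup>2)"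
    by (simp add: L2_inner_def L2_norm_def sq integral_completion)
  then have "(cmod (LINT v|lborel. of_real (?N v) * \<psi> v))\<^sup>2 \<le> (sqrt (LINT v|lborel. ?N v * (cmod (\<psi> v))\<^sup>2))\<^sup>2"
    by (intro power_mono) auto
  also have "\<dots> = (LINT v|lborel. ?N v * (cmod (\<psi> v))\<^sup>2)"
    by (intro real_sqrt_pow2 Bochner_Integration.integral_nonneg) (simp add: normal_density_nonneg)
  finally show ?thesis
    using int by (subst nn_integral_eq_integral) (auto simp: normal_density_nonneg intro!: ennreal_leI)
qed simp

lemma L2_affine:
  assumes "g \<in> L2" "c \<noteq> 0"
  shows "(\<lambda>x. g (t + c * x)) \<in> L2"
  using assms lebesgue_integrable_real_affine[of "\<lambda>x. (cmod (g x))\<^sup>2" c t]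
    borel_measurable_affine[of g c t] by (auto simp: L2_def)

text \<open>The squared distance of \<open>gauss_mean e g\<close> from \<open>g\<close> is at most the average of the squared distances
  of \<open>g\<close> from its translates by \<open>e * v\<close>. These are bounded and tend to \<open>0\<close> with \<open>e\<close>.\<close>

lemma gauss_mean_L2_tendsto:
  assumes [measurable]: "g \<in> borel_measurable borel" and g: "g \<in> L2"
    and e: "e \<longlonglongrightarrow> 0" "\<And>n. e n > 0"
  shows "gauss_mean (e n) g \<in> L2" and "(\<lambda>n. L2_norm (\<lambda>x. gauss_mean (e n) g x - g x)) \<longlonglongrightarrow> 0"
proof -
  let ?N = std_normal_density
  \<comment> \<open>The squared distance of \<open>g\<close> from its translate.\<close>
  define \<Omega> where "\<Omega> = (\<lambda>r. LINT x|lborel. (cmod (g (x + r) - g x))\<^sup>2)"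
  have [measurable]: "\<Omega> \<in> borel_measurable borel" unfolding \<Omega>_def by measurable
  have gm [measurable]: "gauss_mean e g \<in> borel_measurable borel" for e
    unfolding gauss_mean_def by measurable
  have gint: "integrable lborel (\<lambda>x. (cmod (g x))\<^sup>2)"
    using L2_square_integrable[OF g] by (simp add: integrable_completion)
  have gint': "integrable lborel (\<lambda>x. (cmod (g (x + r)))\<^sup>2)" for r
    using lborel_integrable_translate[of "\<lambda>x. (cmod (g x))\<^sup>2" r] gint by simp
  have le4: "(cmod (g (x + r) - g x))\<^sup>2 \<le> 2 * (cmod (g (x + r)))\<^sup>2 + 2 * (cmod (g x))\<^sup>2" for x r
    using cmod_add_square_le[of "g (x + r)" "- g x"] by simp
  have dint: "integrable lborel (\<lambda>x. (cmod (g (x + r) - g x))\<^sup>2)" for r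
    by (rule Bochner_Integration.integrable_bound[of _ "\<lambda>x. 2 * (cmod (g (x + r)))\<^sup>2 + 2 * (cmod (g x))\<^sup>2"])
      (use gint gint' le4 in auto)
  have \<Omega>nn: "\<Omega> r \<ge> 0" for r unfolding \<Omega>_def by (intro Bochner_Integration.integral_nonneg) simp
  have \<Omega>le: "\<Omega> r \<le> 4 * (L2_norm g)\<^sup>2" for r
  proof -
    have "\<Omega> r \<le> (LINT x|lborel. 2 * (cmod (g (x + r)))\<^sup>2 + 2 * (cmod (g x))\<^sup>2)"
      unfolding \<Omega>_def using gint gint' by (intro integral_mono dint le4) auto
    also have "\<dots> = 2 * (LINT x|lborel. (cmod (g (x + r)))\<^sup>2) + 2 * (LINT x|lborel. (cmod (g x))\<^sup>2)"
      using gint gint'[of r] by simp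
    also have "(LINT x|lborel. (cmod (g (x + r)))\<^sup>2) = (LINT x|lborel. (cmod (g x))\<^sup>2)"
      by (rule lborel_integral_translate)
    finally show ?thesis by (simp add: L2_norm_square integral_completion)
  qed
  have Nint: "integrable lborel ?N" using integrable_std_normal_moment[of 0] by simp
  have NL2: "(\<lambda>v. complex_of_real (?N v)) \<in> L2"
  proof (rule L2_dominated)
    show "integrable lebesgue ?N" using Nint by (simp add: integrable_completion)
    have "?N x \<le> 1" for x
    proof -
      have "1 \<le> sqrt (2 * pi)" using pi_gt3 by (simp add: real_le_rsqrt)
      then show ?thesis by (auto simp: std_normal_density_def divide_le_eq intro!: order_trans[OF _ \<open>1 \<le> sqrt (2 * pi)\<close>])
    qed
    then show "(cmod (of_real (?N x)))\<^sup>2 \<le> ?N x" for x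
      using mult_left_le[of "?N x" "?N x"] by (simp add: power2_eq_square normal_density_nonneg)
  qed (auto intro!: measurable_completion)
  have point: "gauss_mean d g x - g x = (LINT v|lborel. of_real (?N v) * (g (x - d * v) - g x))" if "d > 0" for d x
  proof -
    have "(\<lambda>v. g (x + (- d) * v)) \<in> L2" using g that by (intro L2_affine) auto
    from L2_mult_integrable[OF NL2 this]
    have "integrable lborel (\<lambda>v. of_real (?N v) * g (x - d * v))" by (simp add: integrable_completion)
    moreover have "integrable lborel (\<lambda>v. of_real (?N v) * g x)"
      using Nint by (intro integrable_mult_left integrable_of_real)
    moreover have "(LINT v|lborel. of_real (?N v) * g x) = g x"
      using integral_std_normal_moment_even[of 0] by simp
    ultimately show ?thesis by (simp add: gauss_mean_def right_diff_distrib)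
  qed
  have main: "(\<integral>\<^sup>+x. ennreal ((cmod (gauss_mean d g x - g x))\<^sup>2) \<partial>lborel) \<le> ennreal (LINT v|lborel. ?N v * \<Omega> (- d * v))"
    if d: "d > 0" for d
  proof -
    have "(\<integral>\<^sup>+x. ennreal ((cmod (gauss_mean d g x - g x))\<^sup>2) \<partial>lborel) \<le>
       (\<integral>\<^sup>+x. \<integral>\<^sup>+v. ennreal (?N v * (cmod (g (x - d * v) - g x))\<^sup>2) \<partial>lborel \<partial>lborel)"
      unfolding point[OF d] by (intro nn_integral_mono std_normal_Jensen) measurable
    also have "\<dots> = (\<integral>\<^sup>+v. \<integral>\<^sup>+x. ennreal (?N v * (cmod (g (x - d * v) - g x))\<^sup>2) \<partial>lborel \<partial>lborel)"
      by (rule lborel_pair.Fubini') measurable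
    also have "\<dots> = (\<integral>\<^sup>+v. ennreal (?N v * \<Omega> (- d * v)) \<partial>lborel)"
    proof (rule nn_integral_cong)
      fix v
      have "(\<integral>\<^sup>+x. ennreal (?N v * (cmod (g (x + (- d * v)) - g x))\<^sup>2) \<partial>lborel) =
          ennreal (LINT x|lborel. ?N v * (cmod (g (x + (- d * v)) - g x))\<^sup>2)"
        by (rule nn_integral_eq_integral[OF integrable_mult_right[OF dint]]) (simp add: normal_density_nonneg)
      then show "(\<integral>\<^sup>+x. ennreal (?N v * (cmod (g (x - d * v) - g x))\<^sup>2) \<partial>lborel) = ennreal (?N v * \<Omega> (- d * v))"
        by (simp add: \<Omega>_def)
    qed
    also have "\<dots> = ennreal (LINT v|lborel. ?N v * \<Omega> (- d * v))"
    proof (rule nn_integral_eq_integral)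
      show "integrable lborel (\<lambda>v. ?N v * \<Omega> (- d * v))"
        by (rule Bochner_Integration.integrable_bound[of _ "\<lambda>v. ?N v * (4 * (L2_norm g)\<^sup>2)"])
          (use Nint \<Omega>le \<Omega>nn in \<open>auto intro!: AE_I2 mult_left_mono simp: normal_density_nonneg abs_mult\<close>)
    qed (use \<Omega>nn in \<open>simp add: normal_density_nonneg\<close>)
    finally show ?thesis .
  qed
  have diffL2: "(\<lambda>x. gauss_mean d g x - g x) \<in> L2" if "d > 0" for d
  proof -
    have "integrable lborel (\<lambda>x. (cmod (gauss_mean d g x - g x))\<^sup>2)"
      using main[OF that] by (intro integrableI_nonneg) (auto simp: less_top[symmetric] top_unique)
    then show ?thesis by (simp add: L2_def integrable_completion measurable_completion)
  qed
  show "gauss_mean (e n) g \<in> L2"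
    using L2_add[OF diffL2[OF e(2)[of n]] g] by simp
  have lim: "(\<lambda>n. LINT v|lborel. ?N v * \<Omega> (- e n * v)) \<longlonglongrightarrow> (LINT (v::real)|lborel. (0::real))"
  proof (rule integral_dominated_convergence[where w="\<lambda>v. ?N v * (4 * (L2_norm g)\<^sup>2)"])
    show "AE v in lborel. norm (?N v * \<Omega> (- e n * v)) \<le> ?N v * (4 * (L2_norm g)\<^sup>2)" for n
      using \<Omega>le \<Omega>nn by (auto intro!: AE_I2 mult_left_mono simp: normal_density_nonneg abs_mult)
    show "AE v in lborel. (\<lambda>n. ?N v * \<Omega> (- e n * v)) \<longlonglongrightarrow> 0"
    proof (rule AE_I2)
      fix v
      have "(\<lambda>n. - e n * v) \<longlonglongrightarrow> - 0 * v" by (intro tendsto_intros e)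
      then have "(\<lambda>n. \<Omega> (- e n * v)) \<longlonglongrightarrow> 0"
        unfolding \<Omega>_def using L2_translation_continuous[OF _ g, of "\<lambda>n. - e n * v"] by simp
      then show "(\<lambda>n. ?N v * \<Omega> (- e n * v)) \<longlonglongrightarrow> 0" by (rule tendsto_mult_right_zero)
    qed
  qed (use Nint in auto)
  show "(\<lambda>n. L2_norm (\<lambda>x. gauss_mean (e n) g x - g x)) \<longlonglongrightarrow> 0"
  proof (rule tendsto_sandwich[OF _ _ tendsto_const])
    show "(\<lambda>n. sqrt (LINT v|lborel. ?N v * \<Omega> (- e n * v))) \<longlonglongrightarrow> 0"
      using tendsto_real_sqrt[OF lim] by simp
    show "\<forall>\<^sub>F n in sequentially. L2_norm (\<lambda>x. gauss_mean (e n) g x - g x) \<le>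
        sqrt (LINT v|lborel. ?N v * \<Omega> (- e n * v))"
    proof (intro always_eventually allI)
      fix n
      have nn: "0 \<le> (LINT v|lborel. ?N v * \<Omega> (- e n * v))"
        using \<Omega>nn by (intro Bochner_Integration.integral_nonneg) (simp add: normal_density_nonneg)
      have "(LINT x|lborel. (cmod (gauss_mean (e n) g x - g x))\<^sup>2) \<le> (LINT v|lborel. ?N v * \<Omega> (- e n * v))"
        using main[OF e(2)[of n]] nn
        by (subst integral_eq_nn_integral) (auto intro!: enn2real_leI)
      then show "L2_norm (\<lambda>x. gauss_mean (e n) g x - g x) \<le> sqrt (LINT v|lborel. ?N v * \<Omega> (- e n * v))"
        by (simp add: L2_norm_def integral_completion)
    qed
  qed auto
qed

lemma complex_borel_representative:
  fixes f :: "real \<Rightarrow> complex"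
  assumes "f \<in> borel_measurable lebesgue"
  obtains f' where "f' \<in> borel_measurable borel" "AE x in lebesgue. f x = f' x"
proof -
  have "(\<lambda>x. Re (f x)) \<in> borel_measurable lebesgue" "(\<lambda>x. Im (f x)) \<in> borel_measurable lebesgue"
    using assms by (auto intro: borel_measurable_Re borel_measurable_Im)
  from this[THEN completion_ex_borel_measurable_real]
  obtain a b where ab: "a \<in> borel_measurable lborel" "AE x in lborel. Re (f x) = a x"
    "b \<in> borel_measurable lborel" "AE x in lborel. Im (f x) = b x" by auto
  have "AE x in lebesgue. f x = Complex (a x) (b x)"
    using ab by (intro AE_completion) (auto simp: complex_eq_iff)
  moreover have "(\<lambda>x. Complex (a x) (b x)) \<in> borel_measurable borel"
    using ab unfolding Complex_eq by simp
  ultimately show thesis by (rule that[rotated])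
qed

lemma L2_cong_AE:
  assumes "f \<in> L2" "f' \<in> borel_measurable lebesgue" "AE x in lebesgue. f x = f' x"
  shows "f' \<in> L2"
proof -
  have "integrable lebesgue (\<lambda>t. (cmod (f' t))\<^sup>2)"
    by (rule integrable_cong_AE_imp[OF L2_square_integrable[OF assms(1)]])
      (use assms in \<open>auto elim: AE_mp\<close>)
  then show ?thesis using assms by (simp add: L2_def)
qed

lemma L2_norm_cong_AE:
  assumes "f \<in> L2" "f' \<in> L2" "AE x in lebesgue. f x = f' x"
  shows "L2_norm f = L2_norm f'"
  unfolding L2_norm_def using assms L2_measurable
  by (intro arg_cong[where f=sqrt] integral_cong_AE) (auto elim: AE_mp)

section \<open>Plancherel's theorem\<close>

lemma gauss_mean_cnj: "gauss_mean e (\<lambda>x. cnj (g x)) x = cnj (gauss_mean e g x)"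
  unfolding gauss_mean_def by (subst Bochner_Integration.integral_cnj[symmetric]) simp

lemma fourier_L1_cnj:
  "fourier_L1 (\<lambda>x. cnj (f x)) (- x) = cnj (fourier_L1 f x)"
  unfolding fourier_L1_def complex_cnj_mult by (subst Bochner_Integration.integral_cnj[symmetric]) (simp add: exp_cnj)

lemma gauss_factor_fourier_integrable:
  assumes [measurable]: "f \<in> borel_measurable borel" and "e > 0"
  shows "integrable lborel (\<lambda>t. gauss_factor e t * fourier_L1 f (- t))"
proof (rule Bochner_Integration.integrable_bound)
  define C where "C = 1 / sqrt (2 * pi) * (LINT t|lebesgue. cmod (f t))"
  have [measurable]: "fourier_L1 f \<in> borel_measurable borel"
    by (rule borel_measurable_fourier_L1) simp
  show "integrable lborel (\<lambda>t. of_real C * gauss_factor e t)"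
    using integrable_gauss_factor[OF \<open>e > 0\<close>] by simp
  have "cmod (fourier_L1 f (- t)) \<le> \<bar>C\<bar>" for t
    using cmod_fourier_L1_le[of f "- t"] by (simp add: C_def)
  then show "AE t in lborel. norm (gauss_factor e t * fourier_L1 f (- t)) \<le> norm (of_real C * gauss_factor e t)"
    by (auto simp: norm_mult mult.commute[of "cmod (gauss_factor e _)"] intro!: AE_I2 mult_right_mono)
qed (use borel_measurable_fourier_L1[OF assms(1)] in measurable)

text \<open>By the multiplication formula, the integral of \<open>\<bar>fourier_L1 f\<bar>\<^sup>2\<close> against a Gaussian factor is the
  inner product of \<open>f\<close> with its Gaussian mean. As the factor increases to \<open>1\<close>, the former increases
  to the squared norm of the transform and the latter tends to that of \<open>f\<close>.\<close>

lemma Plancherel_borel: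
  assumes [measurable]: "f \<in> borel_measurable borel" and f1: "integrable lborel f" and f: "f \<in> L2"
  shows "fourier_L1 f \<in> L2" and "L2_norm (fourier_L1 f) = L2_norm f"
proof -
  define e where "e n = inverse (real (Suc n))" for n
  have e0: "e n > 0" for n by (simp add: e_def)
  have e: "e \<longlonglongrightarrow> 0" unfolding e_def by (rule LIMSEQ_inverse_real_of_nat)
  have [measurable]: "fourier_L1 f \<in> borel_measurable borel"
    by (rule borel_measurable_fourier_L1) simp
  have gm: "gauss_mean (e n) f \<in> L2" for n
    by (rule gauss_mean_L2_tendsto(1)[OF _ f e e0]) simp
  define q where "q n x = exp (- (e n * x)\<^sup>2 / 2) * (cmod (fourier_L1 f x))\<^sup>2" for n x
  have q0: "q n x \<ge> 0" for n x by (simp add: q_def)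
  have [measurable]: "q n \<in> borel_measurable borel" for n unfolding q_def by measurable
  have qeq: "fourier_L1 f x * (gauss_factor (e n) x * fourier_L1 (\<lambda>x. cnj (f x)) (- x)) = of_real (q n x)" for n x
    by (simp add: q_def gauss_factor_def fourier_L1_cnj mult_ac complex_norm_square[symmetric] flip: of_real_power)
  have fc: "integrable lborel (\<lambda>x. cnj (f x))" using f1 by simp
  have cm [measurable]: "(\<lambda>x. cnj (f x)) \<in> borel_measurable borel" using borel_measurable_integrable[OF fc] by simp
  have qint: "integrable lborel (q n)" for n
  proof -
    have "integrable lborel (\<lambda>x. (1 / sqrt (2 * pi) * (LINT t|lebesgue. cmod (f t)))\<^sup>2 * cmod (gauss_factor (e n) x))"
      using integrable_gauss_factor[OF e0] by simp
    moreover have "\<bar>q n x\<bar> \<le> (1 / sqrt (2 * pi) * (LINT t|lebesgue. cmod (f t)))\<^sup>2 * cmod (gauss_factor (e n) x)" for x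
      using mult_left_mono[OF power_mono[OF cmod_fourier_L1_le[of f x], of 2], of "exp (- (e n * x)\<^sup>2 / 2)"]
      by (simp add: q_def gauss_factor_def mult.commute)
    ultimately show ?thesis
      by (elim Bochner_Integration.integrable_bound) (auto intro!: AE_I2 order_trans[OF _ abs_ge_self])
  qed
  have qL2: "of_real (LINT x|lborel. q n x) = L2_inner f (gauss_mean (e n) f)" for n
  proof -
    have "of_real (LINT x|lborel. q n x) =
        (LINT x|lborel. fourier_L1 f x * (gauss_factor (e n) x * fourier_L1 (\<lambda>x. cnj (f x)) (- x)))"
      unfolding qeq by simp
    also have "\<dots> = (LINT x|lborel. (gauss_factor (e n) x * fourier_L1 (\<lambda>x. cnj (f x)) (- x)) * fourier_L1 f x)"
      by (simp add: mult_ac)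
    also have "\<dots> = (LINT y|lborel. fourier_L1 (\<lambda>x. gauss_factor (e n) x * fourier_L1 (\<lambda>x. cnj (f x)) (- x)) y * f y)"
      by (rule fourier_L1_multiplication[OF gauss_factor_fourier_integrable[OF cm e0] f1])
    also have "\<dots> = (LINT y|lborel. f y * cnj (gauss_mean (e n) f y))"
      by (simp add: fourier_gauss_summation[OF fc e0] gauss_mean_cnj mult.commute)
    also have "\<dots> = L2_inner f (gauss_mean (e n) f)"
      unfolding L2_inner_def
    proof (rule integral_completion[symmetric])
      have [measurable]: "gauss_mean (e n) f \<in> borel_measurable borel" unfolding gauss_mean_def by measurable
      have "(\<lambda>x. cnj (gauss_mean (e n) f x)) \<in> borel_measurable borel"
        by (auto intro!: measurable_compose[OF _ borel_measurable_continuous_onI[of cnj]] continuous_intros)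
      then show "(\<lambda>x. f x * cnj (gauss_mean (e n) f x)) \<in> borel_measurable lborel" by simp
    qed
    finally show ?thesis .
  qed
  have "(\<lambda>n. L2_inner f (gauss_mean (e n) f)) \<longlonglongrightarrow> L2_inner f f"
    by (rule L2_inner_tendsto[OF f gm f f _ gauss_mean_L2_tendsto(2)[OF _ f e e0]]) (auto simp: L2_norm_def)
  then have "(\<lambda>n. complex_of_real (LINT x|lborel. q n x)) \<longlonglongrightarrow> of_real ((L2_norm f)\<^sup>2)"
    by (simp only: qL2 L2_inner_self)
  then have lim1: "(\<lambda>n. ennreal (LINT x|lborel. q n x)) \<longlonglongrightarrow> ennreal ((L2_norm f)\<^sup>2)"
    by (intro tendsto_ennrealI) (simp only: tendsto_of_real_iff)
  have "(\<lambda>n. \<integral>\<^sup>+x. ennreal (q n x) \<partial>lborel) \<longlonglongrightarrow> (\<integral>\<^sup>+x. ennreal ((cmod (fourier_L1 f x))\<^sup>2) \<partial>lborel)"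
  proof (rule nn_integral_LIMSEQ)
    show "incseq (\<lambda>n x. ennreal (q n x))"
    proof (intro incseq_SucI le_funI ennreal_leI)
      fix n x
      have "(e (Suc n) * x)\<^sup>2 \<le> (e n * x)\<^sup>2"
      proof -
        have "e (Suc n) \<le> e n" by (simp add: e_def field_simps)
        then show ?thesis
          using e0[of "Suc n"] by (auto simp: power_mult_distrib intro!: mult_right_mono power_mono)
      qed
      then show "q n x \<le> q (Suc n) x" unfolding q_def by (intro mult_right_mono) auto
    qed
    fix x
    have "(\<lambda>n. q n x) \<longlonglongrightarrow> exp (- (0 * x)\<^sup>2 / 2) * (cmod (fourier_L1 f x))\<^sup>2"
      unfolding q_def by (intro tendsto_intros e) simp
    then show "(\<lambda>n. ennreal (q n x)) \<longlonglongrightarrow> ennreal ((cmod (fourier_L1 f x))\<^sup>2)"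
      by (intro tendsto_ennrealI) simp
  qed auto
  also have "(\<lambda>n. \<integral>\<^sup>+x. ennreal (q n x) \<partial>lborel) = (\<lambda>n. ennreal (LINT x|lborel. q n x))"
    using nn_integral_eq_integral[OF qint] q0 by auto
  finally have eq: "(\<integral>\<^sup>+x. ennreal ((cmod (fourier_L1 f x))\<^sup>2) \<partial>lborel) = ennreal ((L2_norm f)\<^sup>2)"
    using lim1 by (rule LIMSEQ_unique)
  then have int: "integrable lborel (\<lambda>x. (cmod (fourier_L1 f x))\<^sup>2)"
    by (intro integrableI_nonneg) auto
  then show "fourier_L1 f \<in> L2"
    by (simp add: L2_def integrable_completion measurable_completion)
  have "(LINT x|lborel. (cmod (fourier_L1 f x))\<^sup>2) = (L2_norm f)\<^sup>2"
    by (subst integral_eq_nn_integral) (auto simp: eq)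
  then show "L2_norm (fourier_L1 f) = L2_norm f"
    by (simp add: L2_norm_def[of "fourier_L1 f"] integral_completion)
qed

theorem Plancherel:
  assumes f: "f \<in> L2" "integrable lebesgue f"
  shows "fourier_L1 f \<in> L2" and "L2_norm (fourier_L1 f) = L2_norm f"
proof -
  obtain h where h: "h \<in> borel_measurable borel" "AE x in lebesgue. f x = h x"
    using complex_borel_representative L2_measurable f(1) by blast
  have hm: "h \<in> borel_measurable lebesgue" using h(1) by (simp add: measurable_completion)
  have hL2: "h \<in> L2" by (rule L2_cong_AE[OF f(1) hm h(2)])
  have "integrable lebesgue h"
    by (rule integrable_cong_AE_imp[OF f(2) hm]) (use h(2) in \<open>auto elim: AE_mp\<close>)
  then have "integrable lborel h" using h(1) by (simp add: integrable_completion)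
  from Plancherel_borel[OF h(1) this hL2] fourier_L1_cong_AE[OF L2_measurable[OF f(1)] hm h(2)]
    L2_norm_cong_AE[OF f(1) hL2 h(2)]
  show "fourier_L1 f \<in> L2" "L2_norm (fourier_L1 f) = L2_norm f" by simp_all
qed

lemma fourier_L1_diff:
  assumes "integrable lebesgue f" "integrable lebesgue g"
  shows "fourier_L1 (\<lambda>x. f x - g x) = (\<lambda>x. fourier_L1 f x - fourier_L1 g x)"
proof
  fix x
  have [measurable]: "(\<lambda>t. exp (- (\<i> * complex_of_real t * of_real x))) \<in> borel_measurable lebesgue"
    by (rule measurable_completion) measurable
  have "integrable lebesgue (\<lambda>t. exp (- \<i> * complex_of_real t * of_real x) * h t)"
    if "integrable lebesgue h" for h
    by (rule Bochner_Integration.integrable_bound[OF that])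
      (use that in \<open>auto simp: norm_mult norm_exp_eq_Re\<close>)
  then show "fourier_L1 (\<lambda>x. f x - g x) x = fourier_L1 f x - fourier_L1 g x"
    using assms by (simp add: fourier_L1_def right_diff_distrib)
qed

lemma fourier_L1_cmult: "fourier_L1 (\<lambda>x. c * f x) = (\<lambda>x. c * fourier_L1 f x)"
proof
  fix x
  have "(LINT t|lebesgue. exp (- \<i> * of_real t * of_real x) * (c * f t)) =
    (LINT t|lebesgue. c * (exp (- \<i> * of_real t * of_real x) * f t))" by (simp only: mult.left_commute)
  then show "fourier_L1 (\<lambda>x. c * f x) x = c * fourier_L1 f x"
    by (simp add: fourier_L1_def mult.left_commute)
qed

text \<open>Only norms of functions \<open>f - c * g\<close> occur here, which are the ones that Plancherel's theorem
  controls through linearity of the transform.\<close>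

lemma L2_inner_polarization:
  assumes f: "f \<in> L2" and g: "g \<in> L2"
  shows "L2_inner f g = of_real ((L2_norm f)\<^sup>2 + (L2_norm g)\<^sup>2 - (L2_norm (\<lambda>x. f x - g x))\<^sup>2) / 2 +
    \<i> * of_real ((L2_norm f)\<^sup>2 + (L2_norm g)\<^sup>2 - (L2_norm (\<lambda>x. f x - \<i> * g x))\<^sup>2) / 2"
proof -
  have swap: "L2_inner h k = cnj (L2_inner k h)" for h k
    unfolding L2_inner_def by (subst Bochner_Integration.integral_cnj[symmetric]) (simp add: mult.commute)
  have ig: "(\<lambda>x. \<i> * g x) \<in> L2" using g by (rule L2_cmult)
  have scale: "L2_inner h (\<lambda>x. \<i> * k x) = - \<i> * L2_inner h k" for h k
  proof -
    have "L2_inner h (\<lambda>x. \<i> * k x) = (LINT x|lebesgue. (- \<i>) * (h x * cnj (k x)))"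
      by (simp add: L2_inner_def mult_ac)
    then show ?thesis unfolding L2_inner_def by (simp only: integral_mult_right_zero)
  qed
  have scale': "L2_inner (\<lambda>x. \<i> * k x) h = \<i> * L2_inner k h" for h k
    using scale[of h k] swap[of "\<lambda>x. \<i> * k x" h] swap[of k h] by simp
  have 1: "of_real ((L2_norm (\<lambda>x. f x - g x))\<^sup>2) =
      L2_inner f f - L2_inner f g - (L2_inner g f - L2_inner g g)"
    unfolding L2_inner_self[symmetric]
    by (simp add: L2_inner_diff_left L2_inner_diff_right f g L2_diff)
  have 2: "of_real ((L2_norm (\<lambda>x. f x - \<i> * g x))\<^sup>2) =
      L2_inner f f - L2_inner f (\<lambda>x. \<i> * g x) - (L2_inner (\<lambda>x. \<i> * g x) f - L2_inner (\<lambda>x. \<i> * g x) (\<lambda>x. \<i> * g x))"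
    unfolding L2_inner_self[symmetric]
    by (simp add: L2_inner_diff_left L2_inner_diff_right f ig L2_diff)
  show ?thesis
    unfolding of_real_add of_real_diff 1 2 unfolding L2_inner_self[symmetric] scale scale'
    by (simp add: field_simps)
qed

lemma fourier_L1_inner:
  assumes "f \<in> L2" "integrable lebesgue f" "g \<in> L2" "integrable lebesgue g"
  shows "L2_inner (fourier_L1 f) (fourier_L1 g) = L2_inner f g"
proof -
  have "L2_norm (\<lambda>x. fourier_L1 f x - c * fourier_L1 g x) = L2_norm (\<lambda>x. f x - c * g x)" for c
    using Plancherel(2)[of "\<lambda>x. f x - c * g x"] assms
    by (simp add: L2_diff L2_cmult fourier_L1_diff fourier_L1_cmult)
  from this[of 1] this[of "\<i>"] show ?thesis
    using assms by (simp add: L2_inner_polarization Plancherel)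
qed

lemma is_fourier_L2_inner:
  assumes "is_fourier_L2 f f'" "is_fourier_L2 g g'"
  shows "L2_inner f g = L2_inner f' g'"
proof -
  from assms obtain u v where L2: "f \<in> L2" "f' \<in> L2" "g \<in> L2" "g' \<in> L2"
    and u: "\<And>n::nat. u n \<in> L2" "\<And>n. integrable lebesgue (u n)" "\<And>n. fourier_L1 (u n) \<in> L2"
      "(\<lambda>n. L2_norm (\<lambda>t. u n t - f t)) \<longlonglongrightarrow> 0" "(\<lambda>n. L2_norm (\<lambda>x. fourier_L1 (u n) x - f' x)) \<longlonglongrightarrow> 0"
    and v: "\<And>n::nat. v n \<in> L2" "\<And>n. integrable lebesgue (v n)" "\<And>n. fourier_L1 (v n) \<in> L2"
      "(\<lambda>n. L2_norm (\<lambda>t. v n t - g t)) \<longlonglongrightarrow> 0" "(\<lambda>n. L2_norm (\<lambda>x. fourier_L1 (v n) x - g' x)) \<longlonglongrightarrow> 0"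
    unfolding is_fourier_L2_def by blast
  have "(\<lambda>n. L2_inner (u n) (v n)) \<longlonglongrightarrow> L2_inner f g"
    by (rule L2_inner_tendsto) fact+
  moreover have "(\<lambda>n. L2_inner (fourier_L1 (u n)) (fourier_L1 (v n))) \<longlonglongrightarrow> L2_inner f' g'"
    by (rule L2_inner_tendsto) fact+
  ultimately show ?thesis
    unfolding fourier_L1_inner[OF u(1,2) v(1,2)] by (rule LIMSEQ_unique)
qed

lemma is_fourier_L2_norm:
  assumes "is_fourier_L2 f g"
  shows "L2_norm f = L2_norm g"
proof -
  have "(L2_norm f)\<^sup>2 = (L2_norm g)\<^sup>2"
    using is_fourier_L2_inner[OF assms assms] unfolding L2_inner_self of_real_eq_iff .
  then show ?thesis by (simp add: power2_eq_iff_nonneg)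
qed

section \<open>Completeness of the space of square-integrable functions\<close>

text \<open>The increments decrease so fast that even the sum of \<open>4 ^ n * \<bar>F (Suc n) - F n\<bar>\<^sup>2\<close> is integrable.
  At almost every point the increments are then at most a constant times \<open>2 ^ (- n)\<close>, so the sequence
  converges there, and Fatou's lemma turns this into convergence in norm.\<close>

lemma Riesz_Fischer_subsequence:
  assumes F: "\<And>n. F n \<in> L2"
    and fast: "\<And>n. L2_norm (\<lambda>x. F (Suc n) x - F n x) \<le> (1 / 4) ^ n"
  shows "\<exists>g\<in>L2. (\<lambda>n. L2_norm (\<lambda>x. F n x - g x)) \<longlonglongrightarrow> 0"
proof -
  have [measurable]: "F n \<in> borel_measurable lebesgue" for n using F L2_measurable by blast
  define D where "D n x = F (Suc n) x - F n x" for n x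
  have [measurable]: "D n \<in> borel_measurable lebesgue" for n unfolding D_def by measurable
  have DL2: "D n \<in> L2" for n using L2_diff[OF F F] by (simp add: D_def[abs_def])
  have nnD: "(\<integral>\<^sup>+x. ennreal ((cmod (h x))\<^sup>2) \<partial>lebesgue) = ennreal ((L2_norm h)\<^sup>2)" if "h \<in> L2" for h
    using that by (subst nn_integral_eq_integral) (auto simp: L2_def L2_norm_square)
  \<comment> \<open>Each term has integral at most \<open>4 ^ n * (1 / 16) ^ n\<close>.\<close>
  have "(\<integral>\<^sup>+x. (\<Sum>n. ennreal (4 ^ n * (cmod (D n x))\<^sup>2)) \<partial>lebesgue) =
      (\<Sum>n. \<integral>\<^sup>+x. ennreal (4 ^ n * (cmod (D n x))\<^sup>2) \<partial>lebesgue)"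
    by (rule nn_integral_suminf) measurable
  also have "\<dots> \<le> (\<Sum>n. ennreal ((1 / 4) ^ n))"
  proof (rule suminf_le)
    fix n
    have "(\<integral>\<^sup>+x. ennreal (4 ^ n * (cmod (D n x))\<^sup>2) \<partial>lebesgue) = ennreal (4 ^ n) * ennreal ((L2_norm (D n))\<^sup>2)"
      by (simp add: ennreal_mult nn_integral_cmult nnD[OF DL2])
    also have "\<dots> = ennreal (4 ^ n * (L2_norm (D n))\<^sup>2)" by (simp add: ennreal_mult)
    also have "\<dots> \<le> ennreal (4 ^ n * ((1 / 4) ^ n)\<^sup>2)"
      using fast[of n] by (intro ennreal_leI mult_left_mono power_mono) (auto simp: D_def[abs_def])
    also have "4 ^ n * ((1 / 4) ^ n)\<^sup>2 = ((1 / 4) ^ n :: real)"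
      by (simp add: power2_eq_square power_divide)
    finally show "(\<integral>\<^sup>+x. ennreal (4 ^ n * (cmod (D n x))\<^sup>2) \<partial>lebesgue) \<le> ennreal ((1 / 4) ^ n)" .
  qed auto
  also have "(\<Sum>n. ennreal ((1 / 4) ^ n)) = ennreal (\<Sum>n. (1 / 4) ^ n)"
    by (intro suminf_ennreal2 summable_geometric) auto
  also have "\<dots> < \<infinity>" unfolding infinity_ennreal_def by (rule ennreal_less_top)
  finally have "(\<integral>\<^sup>+x. (\<Sum>n. ennreal (4 ^ n * (cmod (D n x))\<^sup>2)) \<partial>lebesgue) \<noteq> \<infinity>" by simp
  then have "AE x in lebesgue. (\<Sum>n. ennreal (4 ^ n * (cmod (D n x))\<^sup>2)) \<noteq> \<infinity>"
    by (rule nn_integral_PInf_AE[rotated]) measurable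
  then have conv: "AE x in lebesgue. convergent (\<lambda>n. F n x)"
  proof eventually_elim
    case (elim x)
    define S where "S = (\<Sum>n. ennreal (4 ^ n * (cmod (D n x))\<^sup>2))"
    have "S \<noteq> \<top>" using elim unfolding S_def infinity_ennreal_def .
    then obtain C where "S = ennreal C" and C0: "C \<ge> 0" by (cases S) auto
    then have C: "(\<Sum>n. ennreal (4 ^ n * (cmod (D n x))\<^sup>2)) = ennreal C" by (simp only: S_def)
    have bound: "cmod (D n x) \<le> sqrt C * (1 / 2) ^ n" for n
    proof -
      have "ennreal (4 ^ n * (cmod (D n x))\<^sup>2) \<le> ennreal C"
        using sum_le_suminf[OF summableI, of "{n}" "\<lambda>n. ennreal (4 ^ n * (cmod (D n x))\<^sup>2)"] unfolding C by simp
      then have "4 ^ n * (cmod (D n x))\<^sup>2 \<le> C" using C0 by (simp add: ennreal_le_iff)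
      moreover have "(2 ^ n)\<^sup>2 = (4 ^ n :: real)"
        by (simp add: power2_eq_square flip: power_mult_distrib)
      ultimately have "(2 ^ n * cmod (D n x))\<^sup>2 \<le> C" by (simp only: power_mult_distrib)
      then have "2 ^ n * cmod (D n x) \<le> sqrt C" by (rule real_le_rsqrt)
      then show ?thesis by (simp add: field_simps)
    qed
    have "summable (\<lambda>n. D n x)"
    proof (rule summable_comparison_test')
      show "summable (\<lambda>n. sqrt C * (1 / 2) ^ n)"
        by (intro summable_mult summable_geometric) simp
    qed (use bound in auto)
    then have "convergent (\<lambda>n. \<Sum>i<n. D i x)" by (simp add: summable_iff_convergent)
    then have "convergent (\<lambda>n. (\<Sum>i<n. D i x) + F 0 x)"
      by (simp add: convergent_add_const_right_iff)
    then show ?case by (simp add: D_def sum_lessThan_telescope[of "\<lambda>n. F n x"])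
  qed
  define g where "g x = lim (\<lambda>n. F n x)" for x
  have [measurable]: "g \<in> borel_measurable lebesgue" unfolding g_def by measurable
  have gap: "L2_norm (\<lambda>x. F (n + k) x - F n x) \<le> 2 * (1 / 4) ^ n" for n k
  proof -
    have "L2_norm (\<lambda>x. F (n + k) x - F n x) \<le> (\<Sum>i<k. (1 / 4) ^ (n + i))"
    proof (induction k)
      case 0 show ?case by (simp add: L2_norm_def)
    next
      case (Suc k)
      show ?case
        using L2_norm_triangle_diff[of "F (n + Suc k)" "F (n + k)" "F n", OF F F F] Suc fast[of "n + k"] by simp
    qed
    also have "\<dots> = (1 / 4) ^ n * (\<Sum>i<k. (1 / 4) ^ i)"
      by (simp add: power_add sum_distrib_left)
    also have "\<dots> \<le> (1 / 4) ^ n * (\<Sum>i. (1 / 4 :: real) ^ i)"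
      by (intro mult_left_mono sum_le_suminf summable_geometric) auto
    also have "\<dots> \<le> 2 * (1 / 4) ^ n" by (simp add: suminf_geometric)
    finally show ?thesis .
  qed
  have tail: "(\<integral>\<^sup>+x. ennreal ((cmod (F n x - g x))\<^sup>2) \<partial>lebesgue) \<le> ennreal ((2 * (1 / 4) ^ n)\<^sup>2)" for n
  proof -
    have "(\<integral>\<^sup>+x. ennreal ((cmod (F n x - g x))\<^sup>2) \<partial>lebesgue) =
        (\<integral>\<^sup>+x. liminf (\<lambda>k. ennreal ((cmod (F (n + k) x - F n x))\<^sup>2)) \<partial>lebesgue)"
    proof (rule nn_integral_cong_AE, use conv in eventually_elim)
      case (elim x)
      then have "(\<lambda>k. F (n + k) x) \<longlonglongrightarrow> g x"
        unfolding g_def convergent_LIMSEQ_iff by (subst add.commute) (rule LIMSEQ_ignore_initial_segment)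
      then have "(\<lambda>k. ennreal ((cmod (F (n + k) x - F n x))\<^sup>2)) \<longlonglongrightarrow> ennreal ((cmod (g x - F n x))\<^sup>2)"
        by (intro tendsto_ennrealI tendsto_intros)
      from lim_imp_Liminf[OF sequentially_bot this] show ?case
        by (simp only: norm_minus_commute[of "g x" "F n x"])
    qed
    also have "\<dots> \<le> liminf (\<lambda>k. \<integral>\<^sup>+x. ennreal ((cmod (F (n + k) x - F n x))\<^sup>2) \<partial>lebesgue)"
      by (rule nn_integral_liminf) measurable
    also have "\<dots> \<le> liminf (\<lambda>k. ennreal ((2 * (1 / 4) ^ n)\<^sup>2))"
      using gap by (intro Liminf_mono always_eventually allI)
        (simp only: nnD[OF L2_diff[OF F F]], intro ennreal_leI power_mono, simp_all)
    finally show ?thesis by (simp add: Liminf_const)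
  qed
  have diffL2: "(\<lambda>x. F n x - g x) \<in> L2" for n
  proof -
    have "integrable lebesgue (\<lambda>x. (cmod (F n x - g x))\<^sup>2)"
      using tail[of n] by (intro integrableI_nonneg) (auto simp: less_top[symmetric] top_unique)
    then show ?thesis by (simp add: L2_def)
  qed
  have "g \<in> L2" using L2_diff[OF F[of 0] diffL2[of 0]] by simp
  moreover have "(\<lambda>n. L2_norm (\<lambda>x. F n x - g x)) \<longlonglongrightarrow> 0"
  proof (rule tendsto_sandwich[OF _ _ tendsto_const])
    show "\<forall>\<^sub>F n in sequentially. L2_norm (\<lambda>x. F n x - g x) \<le> 2 * (1 / 4) ^ n"
    proof (rule always_eventually, rule allI, rule power2_le_imp_le)
      fix n
      have "ennreal ((L2_norm (\<lambda>x. F n x - g x))\<^sup>2) \<le> ennreal ((2 * (1 / 4) ^ n)\<^sup>2)"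
        using tail[of n] unfolding nnD[OF diffL2] .
      then show "(L2_norm (\<lambda>x. F n x - g x))\<^sup>2 \<le> (2 * (1 / 4) ^ n)\<^sup>2" by simp
    qed auto
    show "(\<lambda>n. 2 * (1 / 4 :: real) ^ n) \<longlonglongrightarrow> 0"
      by (intro tendsto_mult_right_zero LIMSEQ_power_zero) simp
  qed auto
  ultimately show ?thesis by blast
qed

lemma L2_truncation_tendsto:
  assumes f: "f \<in> L2"
  shows "(\<lambda>n. L2_norm (\<lambda>x. indicator {- real n..real n} x * f x - f x)) \<longlonglongrightarrow> 0"
proof -
  have [measurable]: "f \<in> borel_measurable lebesgue" using f by (rule L2_measurable)
  have ind [measurable]: "(indicator {- real n..real n} :: real \<Rightarrow> complex) \<in> borel_measurable lebesgue" for n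
    by (rule borel_measurable_indicator) simp
  have "(\<lambda>n. LINT x|lebesgue. (cmod (indicator {- real n..real n} x * f x - f x))\<^sup>2) \<longlonglongrightarrow>
      (LINT (x::real)|lebesgue. (0::real))"
  proof (rule integral_dominated_convergence[where w="\<lambda>x. (cmod (f x))\<^sup>2"])
    show "AE x in lebesgue. (\<lambda>n. (cmod (indicator {- real n..real n} x * f x - f x))\<^sup>2) \<longlonglongrightarrow> 0"
    proof (rule AE_I2, rule tendsto_eventually)
      fix x :: real
      obtain N where "\<bar>x\<bar> \<le> real N" using real_arch_simple by blast
      then show "\<forall>\<^sub>F n in sequentially. (cmod (indicator {- real n..real n} x * f x - f x))\<^sup>2 = 0"
        by (intro eventually_sequentiallyI[of N]) (auto simp: indicator_def)
    qed
    show "(\<lambda>x. (cmod (indicator {- real n..real n} x * f x - f x))\<^sup>2) \<in> borel_measurable lebesgue" for n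
      by measurable
    show "AE x in lebesgue. norm ((cmod (indicator {- real n..real n} x * f x - f x))\<^sup>2) \<le> (cmod (f x))\<^sup>2" for n
      by (rule AE_I2) (auto simp: indicator_def)
  qed (use L2_square_integrable[OF f] in auto)
  then show ?thesis unfolding L2_norm_def using tendsto_real_sqrt by fastforce
qed

lemma L2_truncation_integrable:
  assumes f: "f \<in> L2"
  shows "(\<lambda>x. indicator {- real n..real n} x * f x) \<in> L2"
    and "integrable lebesgue (\<lambda>x. indicator {- real n..real n} x * f x)"
proof -
  have ind: "(indicator {- real n..real n} :: real \<Rightarrow> complex) \<in> borel_measurable lebesgue"
    by (rule borel_measurable_indicator) simp
  have le: "cmod (indicator {- real n..real n} x) \<le> 1" for x :: real
    by (simp add: indicator_def)
  show "(\<lambda>x. indicator {- real n..real n} x * f x) \<in> L2"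
    by (rule L2_bounded_mult[OF f ind le])
  have "(cmod (indicator {- real n..real n} x))\<^sup>2 \<le> indicator {- real n..real n} x" for x :: real
    by (simp add: indicator_def)
  then have "(indicator {- real n..real n} :: real \<Rightarrow> complex) \<in> L2"
    by (intro L2_dominated[where h="indicator {- real n..real n}"] ind) simp_all
  from L2_mult_integrable[OF this f]
  show "integrable lebesgue (\<lambda>x. indicator {- real n..real n} x * f x)" .
qed

lemma subsequence_fast:
  fixes a :: "nat \<Rightarrow> real"
  assumes a: "a \<longlonglongrightarrow> 0" and e: "\<And>n. e n > 0"
  obtains r where "strict_mono (r :: nat \<Rightarrow> nat)" "\<And>n. a (r n) < e n"
proof -
  have "\<exists>m>k. a m < e n" for n k
  proof -
    have "\<forall>\<^sub>F m in sequentially. a m < e n" using order_tendstoD(2)[OF a e] .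
    then obtain M where "\<And>m. m \<ge> M \<Longrightarrow> a m < e n" by (auto simp: eventually_sequentially)
    then show ?thesis by (intro exI[of _ "max M (Suc k)"]) auto
  qed
  then have "\<exists>r. \<forall>n. a (r n) < e n \<and> r n < r (Suc n)"
    by (intro dependent_nat_choice) metis+
  then show thesis using that by (auto simp: strict_mono_Suc_iff)
qed

section \<open>Existence of transforms and of inverse transforms\<close>

text \<open>The transforms of suitable truncations of \<open>f\<close> form a rapidly convergent sequence, because
  Plancherel's theorem makes them as close to each other as the truncations are.\<close>

theorem is_fourier_L2_exists:
  assumes f: "f \<in> L2"
  shows "\<exists>g. is_fourier_L2 f g"
proof -
  let ?t = "\<lambda>n x. indicator {- real n..real n} x * f x"
  obtain r where r: "strict_mono r" "\<And>n. L2_norm (\<lambda>x. ?t (r n) x - f x) < (1 / 4) ^ n / 2"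
    using subsequence_fast[OF L2_truncation_tendsto[OF f], of "\<lambda>n. (1 / 4) ^ n / 2"] by auto
  define u where "u n = ?t (r n)" for n
  have u: "u n \<in> L2" "integrable lebesgue (u n)" for n
    using L2_truncation_integrable[OF f] by (auto simp: u_def)
  have lim: "(\<lambda>n. L2_norm (\<lambda>x. u n x - f x)) \<longlonglongrightarrow> 0"
    using LIMSEQ_subseq_LIMSEQ[OF L2_truncation_tendsto[OF f] r(1)] by (simp add: u_def o_def)
  have "L2_norm (\<lambda>x. fourier_L1 (u (Suc n)) x - fourier_L1 (u n) x) \<le> (1 / 4) ^ n" for n
  proof -
    have "L2_norm (\<lambda>x. fourier_L1 (u (Suc n)) x - fourier_L1 (u n) x) = L2_norm (\<lambda>x. u (Suc n) x - u n x)"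
      using Plancherel(2)[OF L2_diff[OF u(1) u(1)] Bochner_Integration.integrable_diff[OF u(2) u(2)]]
      by (simp add: fourier_L1_diff[OF u(2) u(2)])
    also have "\<dots> \<le> L2_norm (\<lambda>x. u (Suc n) x - f x) + L2_norm (\<lambda>x. f x - u n x)"
      by (rule L2_norm_triangle_diff[OF u(1) f u(1)])
    also have "\<dots> \<le> (1 / 4) ^ Suc n / 2 + (1 / 4) ^ n / 2"
      using r(2)[of n] r(2)[of "Suc n"] by (simp add: u_def L2_norm_minus_commute[of f])
    also have "\<dots> \<le> (1 / 4) ^ n" by (simp add: field_simps)
    finally show ?thesis .
  qed
  from Riesz_Fischer_subsequence[OF Plancherel(1)[OF u] this]
  obtain g where g: "g \<in> L2" "(\<lambda>n. L2_norm (\<lambda>x. fourier_L1 (u n) x - g x)) \<longlonglongrightarrow> 0" by blast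
  then show ?thesis
    using f u lim Plancherel(1)[OF u] by (auto simp: is_fourier_L2_def intro!: exI[of _ g] exI[of _ u])
qed

text \<open>The function \<open>w\<close> given by the inverse transform formula is square-integrable by Plancherel's
  theorem, but need not be integrable. Its Gaussian damping is integrable and has the Gaussian means
  of \<open>g\<close> as transforms.\<close>

theorem is_fourier_L2_inverse_exists:
  assumes g: "g \<in> L2" "integrable lebesgue g"
  shows "\<exists>f. is_fourier_L2 f g"
proof -
  obtain h where h: "h \<in> borel_measurable borel" "AE x in lebesgue. g x = h x"
    using complex_borel_representative L2_measurable g(1) by blast
  have hm: "h \<in> borel_measurable lebesgue" using h(1) by (simp add: measurable_completion)
  have hL2: "h \<in> L2" by (rule L2_cong_AE[OF g(1) hm h(2)])
  have "integrable lebesgue h"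
    by (rule integrable_cong_AE_imp[OF g(2) hm]) (use h(2) in \<open>auto elim: AE_mp\<close>)
  then have hint: "integrable lborel h" using h(1) by (simp add: integrable_completion)
  define w where "w t = fourier_L1 h (- t)" for t
  define e where "e n = inverse (real (Suc n))" for n
  have e0: "e n > 0" for n by (simp add: e_def)
  have e: "e \<longlonglongrightarrow> 0" unfolding e_def by (rule LIMSEQ_inverse_real_of_nat)
  have wL2: "w \<in> L2"
    using L2_affine[OF Plancherel_borel(1)[OF h(1) hint hL2], of "-1" 0] by (simp add: w_def[abs_def])
  have [measurable]: "w \<in> borel_measurable lebesgue" using wL2 by (rule L2_measurable)
  define u where "u n t = gauss_factor (e n) t * w t" for n t
  have gfm: "gauss_factor c \<in> borel_measurable lebesgue" for c by (simp add: measurable_completion)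
  have u: "u n \<in> L2" for n
    using L2_bounded_mult[OF wL2 gfm gauss_factor_bound] by (simp add: u_def[abs_def])
  have uint: "integrable lebesgue (u n)" for n
    using gauss_factor_fourier_integrable[OF h(1) e0, of n]
    by (simp add: u_def[abs_def] w_def[abs_def] integrable_completion borel_measurable_integrable)
  have fu: "fourier_L1 (u n) = gauss_mean (e n) h" for n
    using fourier_gauss_summation[OF hint e0] by (auto simp: u_def[abs_def] w_def[abs_def])
  have lim1: "(\<lambda>n. L2_norm (\<lambda>t. u n t - w t)) \<longlonglongrightarrow> 0"
  proof -
    have "(\<lambda>n. LINT t|lebesgue. (cmod (u n t - w t))\<^sup>2) \<longlonglongrightarrow> (LINT (t::real)|lebesgue. (0::real))"
    proof (rule integral_dominated_convergence[where w="\<lambda>t. (2 * cmod (w t))\<^sup>2"])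
      show "AE t in lebesgue. (\<lambda>n. (cmod (u n t - w t))\<^sup>2) \<longlonglongrightarrow> 0"
      proof (rule AE_I2)
        fix t
        have "(\<lambda>n. (cmod (u n t - w t))\<^sup>2) \<longlonglongrightarrow> (cmod (of_real (exp (- (0 * t)\<^sup>2 / 2)) * w t - w t))\<^sup>2"
          unfolding u_def gauss_factor_def by (intro tendsto_intros e) simp
        then show "(\<lambda>n. (cmod (u n t - w t))\<^sup>2) \<longlonglongrightarrow> 0" by simp
      qed
      show "AE t in lebesgue. norm ((cmod (u n t - w t))\<^sup>2) \<le> (2 * cmod (w t))\<^sup>2" for n
      proof (rule AE_I2)
        fix t
        have "cmod (u n t - w t) \<le> cmod (u n t) + cmod (w t)" by (rule norm_triangle_ineq4)
        also have "cmod (u n t) \<le> cmod (w t)"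
          using gauss_factor_bound[of "e n" t] by (auto simp: u_def norm_mult intro!: mult_left_le_one_le)
        finally show "norm ((cmod (u n t - w t))\<^sup>2) \<le> (2 * cmod (w t))\<^sup>2"
          unfolding real_norm_def abs_power2 by (intro power_mono) auto
      qed
      show "(\<lambda>t. (cmod (u n t - w t))\<^sup>2) \<in> borel_measurable lebesgue" for n
        using L2_square_integrable[OF L2_diff[OF u wL2]] by auto
    qed (use L2_square_integrable[OF wL2] in \<open>auto simp: power_mult_distrib\<close>)
    then show ?thesis unfolding L2_norm_def using tendsto_real_sqrt by fastforce
  qed
  have gmL2: "gauss_mean (e n) h \<in> L2" for n by (rule gauss_mean_L2_tendsto(1)[OF h(1) hL2 e e0])
  have "L2_norm (\<lambda>x. gauss_mean (e n) h x - g x) = L2_norm (\<lambda>x. gauss_mean (e n) h x - h x)" for n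
    by (rule L2_norm_cong_AE) (use h(2) gmL2 g hL2 in \<open>auto intro: L2_diff elim: AE_mp\<close>)
  then have lim2: "(\<lambda>n. L2_norm (\<lambda>x. gauss_mean (e n) h x - g x)) \<longlonglongrightarrow> 0"
    using gauss_mean_L2_tendsto(2)[OF h(1) hL2 e e0] by simp
  have "is_fourier_L2 w g"
    unfolding is_fourier_L2_def using wL2 g u uint gmL2 lim1 lim2
    by (intro conjI exI[of _ u]) (auto simp: fu)
  then show ?thesis by blast
qed

section \<open>Dyadic systems on the Fourier side\<close>

lemma L2_affine_modulated:
  assumes f: "f \<in> L2" and "a \<noteq> 0" and c: "c \<in> borel_measurable lebesgue" "\<And>x. (cmod (c x))\<^sup>2 = \<bar>a\<bar>"
  shows "(\<lambda>x. c x * f (t + a * x)) \<in> L2"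
    and "L2_norm (\<lambda>x. c x * f (t + a * x)) = L2_norm f"
proof -
  have "(\<lambda>x. f (t + a * x)) \<in> L2" using f \<open>a \<noteq> 0\<close> by (rule L2_affine)
  then have "integrable lebesgue (\<lambda>x. \<bar>a\<bar> * (cmod (f (t + a * x)))\<^sup>2)"
    "(\<lambda>x. f (t + a * x)) \<in> borel_measurable lebesgue"
    by (auto simp: L2_def)
  then show "(\<lambda>x. c x * f (t + a * x)) \<in> L2"
    using c by (auto simp: L2_def norm_mult power_mult_distrib)
  have "(LINT x|lebesgue. (cmod (c x * f (t + a * x)))\<^sup>2) = \<bar>a\<bar> * (LINT x|lebesgue. (cmod (f (t + a * x)))\<^sup>2)"
    by (simp add: norm_mult power_mult_distrib c)
  also have "\<dots> = (LINT x|lebesgue. (cmod (f x))\<^sup>2)"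
    using lebesgue_integral_real_affine[OF \<open>a \<noteq> 0\<close>, of "\<lambda>x. (cmod (f x))\<^sup>2" t] by simp
  finally show "L2_norm (\<lambda>x. c x * f (t + a * x)) = L2_norm f" by (simp add: L2_norm_def)
qed

text \<open>Translation and dilation of \<open>f\<close> turn into modulation and inverse dilation of the transform of \<open>f\<close>.\<close>

definition dyadic_transform :: "(real \<Rightarrow> complex) \<Rightarrow> int \<times> int \<Rightarrow> real \<Rightarrow> complex" where
  "dyadic_transform g = (\<lambda>(j, k) x.
     of_real (2 powr (- of_int j / 2)) * exp (- \<i> * of_real (of_int k * 2 powi (- j) * x)) * g (2 powi (- j) * x))"

lemma dyadic_transform_apply:
  "dyadic_transform g (j, k) x =
     of_real (2 powr (- of_int j / 2)) * exp (- \<i> * of_real (of_int k * 2 powi (- j) * x)) * g (2 powi (- j) * x)"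
  by (simp add: dyadic_transform_def)

lemma powr_half_square: "(2 powr (of_int j / 2))\<^sup>2 = (2 powi j :: real)"
  by (simp add: powr_power flip: powr_real_of_int')

lemma powr_minus_half_square: "(2 powr (- of_int j / 2))\<^sup>2 = (2 powi (- j) :: real)"
  using powr_half_square[of "- j"] by simp

lemma dyadic_system_L2:
  assumes "f \<in> L2"
  shows "dyadic_system f i \<in> L2" and "L2_norm (dyadic_system f i) = L2_norm f"
proof -
  obtain j k where i: "i = (j, k)" by force
  have eq: "dyadic_system f i = (\<lambda>t. of_real (2 powr (of_int j / 2)) * f (- of_int k + 2 powi j * t))"
    by (simp add: i dyadic_system_def add.commute[of "- of_int k"])
  have "(cmod (of_real (2 powr (of_int j / 2))))\<^sup>2 = \<bar>2 powi j :: real\<bar>"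
    by (simp add: powr_half_square)
  then show "dyadic_system f i \<in> L2" "L2_norm (dyadic_system f i) = L2_norm f"
    unfolding eq by (intro L2_affine_modulated assms; simp)+
qed

lemma dyadic_transform_L2:
  assumes "g \<in> L2"
  shows "dyadic_transform g i \<in> L2" and "L2_norm (dyadic_transform g i) = L2_norm g"
proof -
  obtain j k where i: "i = (j, k)" by force
  let ?c = "\<lambda>x. of_real (2 powr (- of_int j / 2)) * exp (- \<i> * of_real (of_int k * 2 powi (- j) * x)) :: complex"
  have eq: "dyadic_transform g i = (\<lambda>x. ?c x * g (0 + 2 powi (- j) * x))"
    by (simp add: i dyadic_transform_def)
  have c: "(cmod (?c x))\<^sup>2 = \<bar>2 powi (- j) :: real\<bar>" for x
  proof -
    have "cmod (exp (- \<i> * of_real y)) = 1" for y using norm_exp_i_times[of "- y"] by simp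
    then have "(cmod (?c x))\<^sup>2 = (2 powr (- of_int j / 2))\<^sup>2" by (simp only: norm_mult) simp
    then show ?thesis by (simp add: powr_minus_half_square[unfolded minus_divide_left[symmetric]])
  qed
  have cm: "?c \<in> borel_measurable lebesgue"
    by (rule measurable_completion) measurable
  have "2 powi (- j) \<noteq> (0 :: real)" by simp
  from L2_affine_modulated[OF assms this cm c, of 0]
  show "dyadic_transform g i \<in> L2" "L2_norm (dyadic_transform g i) = L2_norm g"
    unfolding eq .
qed

lemma dyadic_system_diff:
  "dyadic_system (\<lambda>x. f x - g x) i = (\<lambda>x. dyadic_system f i x - dyadic_system g i x)"
  by (auto simp: dyadic_system_def right_diff_distrib split: prod.splits)

lemma dyadic_transform_diff:
  "dyadic_transform (\<lambda>x. f x - g x) i = (\<lambda>x. dyadic_transform f i x - dyadic_transform g i x)"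
  by (auto simp: dyadic_transform_def right_diff_distrib split: prod.splits)

lemma fourier_L1_dyadic_system:
  "fourier_L1 (dyadic_system f i) = dyadic_transform (fourier_L1 f) i"
proof
  fix x
  obtain j k where i: "i = (j, k)" by force
  define a :: real where "a = 2 powi j"
  have a: "a > 0" "2 powi (- j) = 1 / a" by (auto simp: a_def power_int_minus field_simps)
  have scal: "2 powr (of_int j / 2) / a = 2 powr (- of_int j / 2)"
  proof -
    have "a = 2 powr of_int j" by (simp add: a_def powr_real_of_int')
    then show ?thesis by (simp flip: powr_diff)
  qed
  have "(LINT t|lebesgue. exp (- \<i> * of_real t * of_real x) * f (a * t - of_int k)) =
    of_real (1 / a) * (LINT s|lebesgue. exp (- \<i> * of_real (of_int k / a + 1 / a * s) * of_real x) * f s)"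
    using lebesgue_integral_real_affine[of "1 / a" "\<lambda>t. exp (- \<i> * of_real t * of_real x) * f (a * t - of_int k)" "of_int k / a"] a
    by (simp add: scaleR_conv_of_real distrib_left)
  also have "(LINT s|lebesgue. exp (- \<i> * of_real (of_int k / a + 1 / a * s) * of_real x) * f s) =
    (LINT s|lebesgue. exp (- \<i> * of_real (of_int k * (1 / a) * x)) * (exp (- \<i> * of_real s * of_real (1 / a * x)) * f s))"
  proof (rule Bochner_Integration.integral_cong[OF refl])
    fix s
    have "exp (- \<i> * of_real (of_int k / a + 1 / a * s) * of_real x) =
      exp (- \<i> * of_real (of_int k * (1 / a) * x) + - \<i> * of_real s * of_real (1 / a * x))"
      by (rule arg_cong[where f=exp]) (simp add: field_simps)
    then show "exp (- \<i> * of_real (of_int k / a + 1 / a * s) * of_real x) * f s =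
      exp (- \<i> * of_real (of_int k * (1 / a) * x)) * (exp (- \<i> * of_real s * of_real (1 / a * x)) * f s)"
      by (simp only: exp_add mult.assoc)
  qed
  also have "\<dots> = exp (- \<i> * of_real (of_int k * (1 / a) * x)) *
      (LINT s|lebesgue. exp (- \<i> * of_real s * of_real (1 / a * x)) * f s)"
    by (rule integral_mult_right_zero)
  finally have main: "(LINT t|lebesgue. exp (- \<i> * of_real t * of_real x) * f (a * t - of_int k)) =
    of_real (1 / a) * (exp (- \<i> * of_real (of_int k * (1 / a) * x)) *
      (LINT s|lebesgue. exp (- \<i> * of_real s * of_real (1 / a * x)) * f s))" .
  have "fourier_L1 (dyadic_system f i) x = of_real (1 / sqrt (2 * pi)) *
      (LINT t|lebesgue. of_real (2 powr (of_int j / 2)) * (exp (- \<i> * of_real t * of_real x) * f (a * t - of_int k)))"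
    unfolding fourier_L1_def i dyadic_system_def a_def by (simp only: prod.case mult.left_commute)
  also have "\<dots> = of_real (1 / sqrt (2 * pi)) * (of_real (2 powr (of_int j / 2)) *
      (of_real (1 / a) * (exp (- \<i> * of_real (of_int k * (1 / a) * x)) *
      (LINT s|lebesgue. exp (- \<i> * of_real s * of_real (1 / a * x)) * f s))))"
    by (simp only: integral_mult_right_zero main)
  also have "\<dots> = of_real (2 powr (of_int j / 2) / a) * exp (- \<i> * of_real (of_int k * (1 / a) * x)) * fourier_L1 f (1 / a * x)"
    by (simp add: fourier_L1_def mult_ac)
  finally show "fourier_L1 (dyadic_system f i) x = dyadic_transform (fourier_L1 f) i x"
    by (simp only: scal i dyadic_transform_apply a(2))
qed

lemma is_fourier_L2_dyadic:
  assumes "is_fourier_L2 f g"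
  shows "is_fourier_L2 (dyadic_system f i) (dyadic_transform g i)"
proof -
  from assms obtain u where L2: "f \<in> L2" "g \<in> L2"
    and u: "\<And>n::nat. u n \<in> L2" "\<And>n. integrable lebesgue (u n)" "\<And>n. fourier_L1 (u n) \<in> L2"
      "(\<lambda>n. L2_norm (\<lambda>t. u n t - f t)) \<longlonglongrightarrow> 0" "(\<lambda>n. L2_norm (\<lambda>x. fourier_L1 (u n) x - g x)) \<longlonglongrightarrow> 0"
    unfolding is_fourier_L2_def by blast
  obtain j k where i: "i = (j, k)" by force
  have "integrable lebesgue (dyadic_system (u n) i)" for n
    using lebesgue_integrable_real_affine[OF u(2)[of n], of "2 powi j" "- of_int k"]
    by (simp add: i dyadic_system_def add.commute[of "- of_int k"])
  moreover have "L2_norm (\<lambda>t. dyadic_system (u n) i t - dyadic_system f i t) = L2_norm (\<lambda>t. u n t - f t)" for n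
    using dyadic_system_L2(2)[OF L2_diff[OF u(1)[of n] L2(1)]] by (simp add: dyadic_system_diff)
  moreover have "L2_norm (\<lambda>t. dyadic_transform (fourier_L1 (u n)) i t - dyadic_transform g i t) =
      L2_norm (\<lambda>t. fourier_L1 (u n) t - g t)" for n
    using dyadic_transform_L2(2)[OF L2_diff[OF u(3)[of n] L2(2)]] by (simp add: dyadic_transform_diff)
  ultimately show ?thesis
    unfolding is_fourier_L2_def using u L2
    by (intro conjI exI[of _ "\<lambda>n. dyadic_system (u n) i"])
      (simp_all add: fourier_L1_dyadic_system dyadic_system_L2 dyadic_transform_L2)
qed

lemma is_fourier_L2_zero_iff:
  assumes "is_fourier_L2 f h"
  shows "(AE x in lebesgue. f x = 0) \<longleftrightarrow> (AE x in lebesgue. h x = 0)"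
  using assms is_fourier_L2_norm[OF assms] L2_norm_eq_0_iff[of f] L2_norm_eq_0_iff[of h]
  by (auto simp: is_fourier_L2_def)

text \<open>Inner products agree on both sides of the transform. Totality is pulled back along the transform
  of the function that is orthogonal to the dyadic system.\<close>

lemma orthonormal_wavelet_of_transform:
  assumes w: "is_fourier_L2 w g"
    and orth: "\<And>i i'. L2_inner (dyadic_transform g i) (dyadic_transform g i') = (if i = i' then 1 else 0)"
    and total: "\<And>h. h \<in> L2 \<Longrightarrow> (\<And>i. L2_inner h (dyadic_transform g i) = 0) \<Longrightarrow> AE x in lebesgue. h x = 0"
  shows "orthonormal_wavelet w"
  unfolding orthonormal_wavelet_def orthonormal_basis_L2_def
proof (intro conjI allI ballI impI)
  show wL2: "w \<in> L2" using w by (simp add: is_fourier_L2_def)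
  show "dyadic_system w i \<in> L2" for i using wL2 by (rule dyadic_system_L2)
  show "L2_inner (dyadic_system w i) (dyadic_system w i') = (if i = i' then 1 else 0)" for i i'
    unfolding orth[symmetric] by (intro is_fourier_L2_inner is_fourier_L2_dyadic w)
  fix f assume "f \<in> L2" and f: "\<forall>i. L2_inner f (dyadic_system w i) = 0"
  then obtain h where h: "is_fourier_L2 f h" using is_fourier_L2_exists by blast
  have "L2_inner h (dyadic_transform g i) = 0" for i
    using f[rule_format, of i] is_fourier_L2_inner[OF h is_fourier_L2_dyadic[OF w], of i] by simp
  then have "AE x in lebesgue. h x = 0"
    using h by (intro total) (auto simp: is_fourier_L2_def)
  then show "AE t in lebesgue. f t = 0" using is_fourier_L2_zero_iff[OF h] by simp
qed

lemma orthonormal_wavelet_transform_orthonormal: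
  assumes "is_fourier_L2 w g" "orthonormal_wavelet w"
  shows "L2_inner (dyadic_transform g i) (dyadic_transform g i') = (if i = i' then 1 else 0)"
proof -
  have "L2_inner (dyadic_system w i) (dyadic_system w i') = (if i = i' then 1 else 0)"
    using assms(2) unfolding orthonormal_wavelet_def orthonormal_basis_L2_def by blast
  then show ?thesis
    by (simp only: is_fourier_L2_inner[OF is_fourier_L2_dyadic is_fourier_L2_dyadic, OF assms(1,1)])
qed

text \<open>Integrability of \<open>h\<close> provides a function with transform \<open>h\<close>.\<close>

lemma orthonormal_wavelet_transform_total:
  assumes w: "is_fourier_L2 w g" "orthonormal_wavelet w"
    and h: "h \<in> L2" "integrable lebesgue h" "\<And>i. L2_inner h (dyadic_transform g i) = 0"
  shows "AE x in lebesgue. h x = 0"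
proof -
  obtain f where f: "is_fourier_L2 f h" using is_fourier_L2_inverse_exists[OF h(1,2)] by blast
  have "L2_inner f (dyadic_system w i) = 0" for i
    using h(3)[of i] is_fourier_L2_inner[OF f is_fourier_L2_dyadic[OF w(1)], of i] by simp
  then have "AE t in lebesgue. f t = 0"
    using w(2) f by (auto simp: orthonormal_wavelet_def orthonormal_basis_L2_def is_fourier_L2_def)
  then show ?thesis using is_fourier_L2_zero_iff[OF f] by simp
qed

section \<open>Uniqueness of Fourier coefficients\<close>

definition vanishing_coefficients :: "(real \<Rightarrow> complex) \<Rightarrow> bool" where
  "vanishing_coefficients K \<longleftrightarrow>
    integrable lebesgue K \<and> (\<forall>k::int. (LINT y|lebesgue. K y * cis (of_int k * y)) = 0)"

lemma cis_measurable [measurable]: "(\<lambda>y. cis (a * y)) \<in> borel_measurable lebesgue" "cis \<in> borel_measurable lebesgue"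
  unfolding cis_conv_exp by (rule measurable_completion; measurable)+

lemma integrable_mult_cis:
  assumes "integrable lebesgue (K :: real \<Rightarrow> complex)"
  shows "integrable lebesgue (\<lambda>y. K y * cis (a * y))"
  by (rule Bochner_Integration.integrable_bound[OF assms]) (use assms in \<open>auto simp: norm_mult\<close>)

lemma vanishing_coefficients_shift:
  assumes "vanishing_coefficients K"
  shows "vanishing_coefficients (\<lambda>y. cis (of_int m * y) * K y)"
proof -
  have "(LINT y|lebesgue. (cis (of_int m * y) * K y) * cis (of_int k * y)) =
      (LINT y|lebesgue. K y * cis (of_int (k + m) * y))" for k
    by (intro Bochner_Integration.integral_cong refl) (simp add: mult_ac cis_mult distrib_left)
  moreover have "integrable lebesgue (\<lambda>y. cis (of_int m * y) * K y)"
    using integrable_mult_cis[of K "of_int m"] assms by (simp add: vanishing_coefficients_def mult.commute)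
  ultimately show ?thesis using assms unfolding vanishing_coefficients_def by metis
qed

lemma vanishing_coefficients_add:
  assumes "vanishing_coefficients K" "vanishing_coefficients L"
  shows "vanishing_coefficients (\<lambda>y. K y + L y)"
  using assms by (auto simp: vanishing_coefficients_def distrib_right integrable_mult_cis)

lemma vanishing_coefficients_cmult:
  assumes "vanishing_coefficients K"
  shows "vanishing_coefficients (\<lambda>y. c * K y)"
  using assms by (auto simp: vanishing_coefficients_def mult.assoc)

text \<open>Multiplication by a linear function of \<open>cis y\<close> combines two shifts of the indices of the
  coefficients, and products are treated one factor at a time because \<open>K\<close> is arbitrary in the induction.\<close>

lemma vanishing_coefficients_polynomial:
  assumes "real_polynomial_function p" "vanishing_coefficients K"
  shows "vanishing_coefficients (\<lambda>y. of_real (p (cis y)) * K y)"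
  using assms
proof (induction arbitrary: K rule: real_polynomial_function.induct)
  case (linear f)
  interpret f: bounded_linear f by fact
  have "of_real (f (cis y)) * K y =
      (of_real (f 1) / 2 - \<i> * of_real (f \<i>) / 2) * (cis (of_int 1 * y) * K y) +
      (of_real (f 1) / 2 + \<i> * of_real (f \<i>) / 2) * (cis (of_int (- 1) * y) * K y)" for y
  proof -
    have "cis y = cos y *\<^sub>R 1 + sin y *\<^sub>R \<i>" by (simp add: complex_eq_iff)
    then have "f (cis y) = cos y * f 1 + sin y * f \<i>" by (simp only: f.add f.scaleR) simp
    then have "of_real (f (cis y)) =
      (of_real (f 1) / 2 - \<i> * of_real (f \<i>) / 2) * cis (of_int 1 * y) +
      (of_real (f 1) / 2 + \<i> * of_real (f \<i>) / 2) * cis (of_int (- 1) * y)"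
      by (simp add: complex_eq_iff algebra_simps)
    then show ?thesis by (simp only: distrib_right mult.assoc)
  qed
  then show ?case
    using linear(2) by (simp only:) (intro vanishing_coefficients_add vanishing_coefficients_cmult vanishing_coefficients_shift)
next
  case (const c)
  then show ?case by (simp add: vanishing_coefficients_cmult)
next
  case (add f g)
  then show ?case by (simp add: distrib_right vanishing_coefficients_add)
next
  case (mult f g)
  from mult(3)[OF mult(4)[OF mult(5)]] show ?case by (simp add: mult.assoc)
qed

text \<open>On the unit circle, polynomials approximate \<open>f\<close> uniformly.\<close>

lemma vanishing_coefficients_continuous:
  assumes f: "continuous_on UNIV (f :: complex \<Rightarrow> real)" and K: "vanishing_coefficients K"
  shows "(LINT y|lebesgue. of_real (f (cis y)) * K y) = 0"
proof -
  have Kint: "integrable lebesgue K" using K by (simp add: vanishing_coefficients_def)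
  have [measurable]: "f \<in> borel_measurable borel" using f by (rule borel_measurable_continuous_onI)
  have "compact (f ` sphere 0 1)"
    by (intro compact_continuous_image continuous_on_subset[OF f]) auto
  then obtain B where B: "\<And>z. z \<in> sphere 0 1 \<Longrightarrow> \<bar>f z\<bar> \<le> B"
    by (metis bounded_iff compact_imp_bounded image_eqI real_norm_def)
  have fint: "integrable lebesgue (\<lambda>y. of_real (f (cis y)) * K y)"
  proof (rule Bochner_Integration.integrable_bound)
    show "integrable lebesgue (\<lambda>y. B * cmod (K y))" using Kint by simp
    show "AE y in lebesgue. norm (of_real (f (cis y)) * K y) \<le> norm (B * cmod (K y))"
    proof (rule AE_I2)
      fix y
      have "\<bar>f (cis y)\<bar> \<le> \<bar>B\<bar>" using B[of "cis y"] by simp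
      then show "norm (of_real (f (cis y)) * K y) \<le> norm (B * cmod (K y))"
        by (simp add: norm_mult abs_mult mult_right_mono)
    qed
  qed (use Kint in measurable)
  have "cmod (LINT y|lebesgue. of_real (f (cis y)) * K y) \<le> e * (LINT y|lebesgue. cmod (K y))" if "e > 0" for e
  proof -
    obtain p where p: "real_polynomial_function p" "\<And>z. z \<in> sphere 0 1 \<Longrightarrow> \<bar>f z - p z\<bar> < e"
      using Stone_Weierstrass_real_polynomial_function[of "sphere (0::complex) 1" f e] f \<open>e > 0\<close>
        continuous_on_subset by (metis compact_sphere subset_UNIV)
    have pK: "vanishing_coefficients (\<lambda>y. of_real (p (cis y)) * K y)"
      by (rule vanishing_coefficients_polynomial[OF p(1) K])
    then have pint: "integrable lebesgue (\<lambda>y. of_real (p (cis y)) * K y)"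
      by (simp add: vanishing_coefficients_def)
    have "(LINT y|lebesgue. of_real (p (cis y)) * K y) = 0"
      using pK unfolding vanishing_coefficients_def by (elim conjE allE[of _ 0]) simp
    then have "(LINT y|lebesgue. of_real (f (cis y)) * K y) =
        (LINT y|lebesgue. of_real (f (cis y)) * K y - of_real (p (cis y)) * K y)"
      using fint pint by simp
    also have "cmod \<dots> \<le> (LINT y|lebesgue. cmod (of_real (f (cis y)) * K y - of_real (p (cis y)) * K y))"
      by (rule integral_norm_bound)
    also have "\<dots> \<le> (LINT y|lebesgue. e * cmod (K y))"
    proof (rule integral_mono)
      fix y
      have "cmod (of_real (f (cis y)) * K y - of_real (p (cis y)) * K y) = \<bar>f (cis y) - p (cis y)\<bar> * cmod (K y)"
        by (simp add: norm_mult flip: left_diff_distrib of_real_diff)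
      also have "\<dots> \<le> e * cmod (K y)"
        using p(2)[of "cis y"] by (intro mult_right_mono) auto
      finally show "cmod (of_real (f (cis y)) * K y - of_real (p (cis y)) * K y) \<le> e * cmod (K y)" .
    qed (use Kint fint pint in auto)
    finally show ?thesis by simp
  qed
  note bound = this
  define I where "I = (LINT y|lebesgue. cmod (K y))"
  have "I \<ge> 0" unfolding I_def by (rule Bochner_Integration.integral_nonneg) simp
  have "cmod (LINT y|lebesgue. of_real (f (cis y)) * K y) \<le> 0 + e" if "e > 0" for e
  proof -
    have "e / (I + 1) * I \<le> e" using \<open>I \<ge> 0\<close> \<open>e > 0\<close> by (simp add: field_simps)
    moreover have "e / (I + 1) > 0" using \<open>I \<ge> 0\<close> \<open>e > 0\<close> by simp
    ultimately show ?thesis using bound[of "e / (I + 1)"] unfolding I_def[symmetric] by linarith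
  qed
  then have "cmod (LINT y|lebesgue. of_real (f (cis y)) * K y) \<le> 0" by (rule field_le_epsilon)
  then show ?thesis by simp
qed

text \<open>The indicator of an open set is the limit of truncated multiples of the distance from its
  complement; the Borel sets are then reached by complements and disjoint unions.\<close>

lemma vanishing_coefficients_Borel:
  assumes K: "vanishing_coefficients K" and "C \<in> sets borel"
  shows "(LINT y|lebesgue. indicator C (cis y) * K y) = 0"
proof -
  have Kint [simp]: "integrable lebesgue K" using K by (simp add: vanishing_coefficients_def)
  have [measurable]: "K \<in> borel_measurable lebesgue" using Kint by (rule borel_measurable_integrable)
  have meas [measurable]: "(\<lambda>y. indicator C (cis y) * K y) \<in> borel_measurable lebesgue"
    if [measurable]: "C \<in> sets borel" for C :: "complex set" by measurable
  have int: "integrable lebesgue (\<lambda>y. indicator C (cis y) * K y)" if "C \<in> sets borel" for C :: "complex set"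
    by (rule Bochner_Integration.integrable_bound[OF Kint meas[OF that]]) (auto simp: indicator_def)
  have "Int_stable {S :: complex set. open S}" by (auto simp: Int_stable_def)
  moreover have "{S :: complex set. open S} \<subseteq> Pow UNIV" by simp
  moreover have "C \<in> sigma_sets UNIV {S :: complex set. open S}"
    using \<open>C \<in> sets borel\<close> by (simp add: borel_def)
  ultimately show ?thesis
  proof (induction rule: sigma_sets_induct_disjoint)
    case (basic C)
    then have oC: "open C" by simp
    define \<phi> where "\<phi> n z = (if C = UNIV then 1 else min 1 (real n * infdist z (- C)))" for n z
    have cont: "continuous_on UNIV (\<phi> n)" for n
      unfolding \<phi>_def by (cases "C = UNIV") (auto intro!: continuous_intros)
    have \<phi>01: "0 \<le> \<phi> n z" "\<phi> n z \<le> 1" for n z by (auto simp: \<phi>_def infdist_nonneg)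
    have lim: "(\<lambda>n. \<phi> n z) \<longlonglongrightarrow> indicator C z" for z
    proof (cases "C = UNIV")
      case False
      then have ne: "- C \<noteq> {}" by auto
      show ?thesis
      proof (cases "z \<in> C")
        case True
        have "infdist z (- C) > 0" using oC ne True by (intro infdist_pos_not_in_closed) auto
        then obtain N where N: "1 < real N * infdist z (- C)" using reals_Archimedean3 by blast
        have "\<phi> n z = 1" if "n \<ge> N" for n
        proof -
          have "real N * infdist z (- C) \<le> real n * infdist z (- C)"
            using that by (intro mult_right_mono infdist_nonneg) auto
          then show ?thesis using N False by (simp add: \<phi>_def)
        qed
        then show ?thesis using True by (intro tendsto_eventually eventually_sequentiallyI[of N]) auto
      qed (use False ne in \<open>auto simp: \<phi>_def\<close>)
    qed (simp add: \<phi>_def)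
    have "(\<lambda>n. LINT y|lebesgue. of_real (\<phi> n (cis y)) * K y) \<longlonglongrightarrow> (LINT y|lebesgue. indicator C (cis y) * K y)"
    proof (rule integral_dominated_convergence[where w="\<lambda>y. cmod (K y)"])
      show "AE y in lebesgue. (\<lambda>n. of_real (\<phi> n (cis y)) * K y) \<longlonglongrightarrow> indicator C (cis y) * K y"
      proof (rule AE_I2, rule tendsto_mult[OF _ tendsto_const])
        fix y
        have "(\<lambda>n. of_real (\<phi> n (cis y))) \<longlonglongrightarrow> complex_of_real (indicator C (cis y))"
          using lim by (rule tendsto_of_real)
        then show "(\<lambda>n. of_real (\<phi> n (cis y))) \<longlonglongrightarrow> (indicator C (cis y) :: complex)"
          by (cases "cis y \<in> C") simp_all
      qed
      show "AE y in lebesgue. norm (of_real (\<phi> n (cis y)) * K y) \<le> cmod (K y)" for n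
        using \<phi>01 by (auto simp: norm_mult abs_of_nonneg intro!: mult_left_le_one_le)
      have [measurable]: "\<phi> n \<in> borel_measurable borel" for n using cont by (rule borel_measurable_continuous_onI)
      show "(\<lambda>y. of_real (\<phi> n (cis y)) * K y) \<in> borel_measurable lebesgue" for n by measurable
      show "(\<lambda>y. indicator C (cis y) * K y) \<in> borel_measurable lebesgue" using oC by (intro meas) simp
    qed simp
    moreover have "(LINT y|lebesgue. of_real (\<phi> n (cis y)) * K y) = 0" for n
      by (rule vanishing_coefficients_continuous[OF cont K])
    ultimately show ?case by (simp add: LIMSEQ_const_iff)
  next
    case empty then show ?case by simp
  next
    case (compl C)
    then have "C \<in> sets borel" by (simp add: borel_def)
    have "(LINT y|lebesgue. K y) = 0"
      using K unfolding vanishing_coefficients_def by (elim conjE allE[of _ 0]) simp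
    moreover have "(LINT y|lebesgue. indicator (UNIV - C) (cis y) * K y) =
        (LINT y|lebesgue. K y - indicator C (cis y) * K y)"
      by (intro Bochner_Integration.integral_cong refl) (auto simp: indicator_def)
    ultimately show ?case using compl int[OF \<open>C \<in> sets borel\<close>] by simp
  next
    case (union C)
    then have CB: "C i \<in> sets borel" for i by (auto simp: borel_def)
    have "(\<lambda>n. LINT y|lebesgue. (\<Sum>i<n. indicator (C i) (cis y) * K y)) \<longlonglongrightarrow>
        (LINT y|lebesgue. indicator (\<Union>i. C i) (cis y) * K y)"
    proof (rule integral_dominated_convergence[where w="\<lambda>y. cmod (K y)"])
      have sum_eq: "(\<Sum>i<n. indicator (C i) z * c) = indicator (\<Union>i<n. C i) z * c" for n z and c :: complex
        unfolding sum_distrib_right[symmetric]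
        by (simp add: indicator_UN_disjoint disjoint_family_on_mono[OF subset_UNIV union(1)])
      show "AE y in lebesgue. (\<lambda>n. \<Sum>i<n. indicator (C i) (cis y) * K y) \<longlonglongrightarrow> indicator (\<Union>i. C i) (cis y) * K y"
        unfolding sum_eq
      proof (rule AE_I2, rule tendsto_eventually)
        fix y
        show "\<forall>\<^sub>F n in sequentially. indicator (\<Union>i<n. C i) (cis y) * K y = indicator (\<Union>i. C i) (cis y) * K y"
        proof (cases "cis y \<in> (\<Union>i. C i)")
          case True
          then obtain m where "cis y \<in> C m" by auto
          then show ?thesis using True by (intro eventually_sequentiallyI[of "Suc m"]) (auto simp: indicator_def)
        qed (auto simp: indicator_def)
      qed
      show "AE y in lebesgue. norm (\<Sum>i<n. indicator (C i) (cis y) * K y) \<le> cmod (K y)" for n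
        unfolding sum_eq by (auto simp: indicator_def)
      show "(\<lambda>y. indicator (\<Union>i. C i) (cis y) * K y) \<in> borel_measurable lebesgue" using CB by (intro meas) auto
      show "(\<lambda>y. \<Sum>i<n. indicator (C i) (cis y) * K y) \<in> borel_measurable lebesgue" for n
        using CB by (intro borel_measurable_sum meas)
    qed simp
    moreover have "(LINT y|lebesgue. (\<Sum>i<n. indicator (C i) (cis y) * K y)) = 0" for n
      using union(3) by (subst Bochner_Integration.integral_sum[OF int[OF CB]]) simp
    ultimately show ?case by (simp add: LIMSEQ_const_iff)
  qed
qed

lemma AE_lebesgue_affine:
  assumes "AE x in lebesgue. P x" "c \<noteq> 0"
  shows "AE x in lebesgue. P (t + c * x :: real)"
proof -
  have m: "(\<lambda>x. t + c * x) \<in> lebesgue \<rightarrow>\<^sub>M lebesgue"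
    using lebesgue_affine_measurable[where c= "\<lambda>x::real. c"] \<open>c \<noteq> 0\<close> by simp
  obtain N where N': "\<And>x. x \<in> space lebesgue - N \<Longrightarrow> P x" and N0: "N \<in> null_sets lebesgue"
    by (rule AE_E3[OF assms(1)]) blast
  have N: "N \<in> null_sets lebesgue" "{x. \<not> P x} \<subseteq> N" using N0 N' by auto
  have "AE x in density (distr lebesgue lebesgue (\<lambda>x. t + c * x)) (\<lambda>_. ennreal \<bar>c\<bar>). x \<notin> N"
    using AE_not_in[OF N(1)] by (subst lebesgue_real_affine[OF \<open>c \<noteq> 0\<close>, of t, symmetric])
  then have "AE x in distr lebesgue lebesgue (\<lambda>x. t + c * x). x \<notin> N"
    using \<open>c \<noteq> 0\<close> by (subst (asm) AE_density) auto
  moreover have "{x. x \<notin> N} \<in> sets lebesgue"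
    using null_setsD2[OF N(1)] Compl_in_sets_lebesgue[of N] by (simp add: Compl_eq)
  ultimately have "AE x in lebesgue. t + c * x \<notin> N"
    by (subst (asm) AE_distr_iff[OF m]) auto
  then show ?thesis by eventually_elim (use N(2) in auto)
qed

lemma AE_lebesgue_translates:
  assumes "AE x in lebesgue. P (x :: real)"
  shows "AE x in lebesgue. \<forall>k::int. P (x + 2 * pi * of_int k)"
  unfolding AE_all_countable
proof
  fix k :: int
  show "AE x in lebesgue. P (x + 2 * pi * of_int k)"
    using AE_lebesgue_affine[OF assms, of 1 "2 * pi * of_int k"] by (simp add: add.commute)
qed

text \<open>A \<open>2 * pi\<close>-periodic set agrees almost everywhere with the preimage under \<open>cis\<close> of a Borel set of
  the circle, which is cut out by the argument function away from its branch cut.\<close>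

lemma vanishing_coefficients_periodic_set:
  assumes K: "vanishing_coefficients K" and U: "U \<in> sets lebesgue"
    and periodic: "\<And>y k. y + 2 * pi * of_int k \<in> U \<longleftrightarrow> y \<in> U"
  shows "(LINT y|lebesgue. indicator U y * K y) = 0"
proof -
  have [measurable]: "K \<in> borel_measurable lebesgue" using K by (auto simp: vanishing_coefficients_def)
  obtain B N N' where "U = B \<union> N" "N \<subseteq> N'" and N': "N' \<in> null_sets lborel" and B: "B \<in> sets borel"
    using sets_completionE[OF U] by (metis sets_lborel)
  then have UB: "y \<in> U \<longleftrightarrow> y \<in> B" if "y \<notin> N'" for y using that by auto
  define A where "A = - (\<real>\<^sub>\<ge>\<^sub>0 :: complex set)"
  have A [measurable]: "A \<in> sets borel" unfolding A_def by (intro borel_open open_Compl closed_nonneg_Reals_complex)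
  have "continuous_on A Arg2pi"
    unfolding A_def by (intro continuous_at_imp_continuous_on ballI continuous_at_Arg2pi) simp
  then have "(\<lambda>z. indicator A z *\<^sub>R Arg2pi z) \<in> borel_measurable borel"
    by (rule borel_measurable_continuous_on_indicator[OF A])
  from measurable_sets[OF this B]
  have arg: "{z. indicator A z *\<^sub>R Arg2pi z \<in> B} \<in> sets borel" by (simp add: vimage_def)
  define C where "C = A \<inter> {z. indicator A z *\<^sub>R Arg2pi z \<in> B}"
  have C: "C \<in> sets borel" unfolding C_def using A arg by (rule sets.Int)
  have "AE y in lebesgue. \<forall>k::int. y + 2 * pi * of_int k \<notin> N' \<union> {0}"
  proof (rule AE_lebesgue_translates)
    have "N' \<union> {0} \<in> null_sets lebesgue"
      using N' by (intro null_sets.Un null_sets_completionI) auto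
    then show "AE y in lebesgue. y \<notin> N' \<union> {0}" by (rule AE_not_in)
  qed
  then have "AE y in lebesgue. indicator U y * K y = indicator C (cis y) * K y"
  proof eventually_elim
    case (elim y)
    define r where "r = y + 2 * pi * of_int (- \<lfloor>y / (2 * pi)\<rfloor>)"
    have r: "0 \<le> r" "r < 2 * pi"
    proof -
      show "0 \<le> r" "r < 2 * pi"
        using floor_divide_lower[of "2 * pi" y] floor_divide_upper[of "2 * pi" y] by (simp_all add: r_def algebra_simps)
    qed
    have rN: "r \<notin> N'" "r \<noteq> 0" using elim[rule_format, of "- \<lfloor>y / (2 * pi)\<rfloor>"] by (auto simp: r_def)
    have "cis r = cis y * cis (2 * pi * of_int (- \<lfloor>y / (2 * pi)\<rfloor>))" unfolding r_def by (rule cis_mult[symmetric])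
    also have "\<dots> = cis y" by (subst cis_multiple_2pi) auto
    finally have cis: "cis r = cis y" .
    have arg: "Arg2pi (cis y) = r"
      unfolding cis[symmetric] by (rule Arg2pi_unique[of 1]) (use r in \<open>auto simp: cis_conv_exp\<close>)
    have "cis y \<in> A"
      unfolding A_def using arg rN(2) Arg2pi_eq_0[of "cis y"]
      by (auto simp: complex_nonneg_Reals_iff complex_is_Real_iff)
    then have "cis y \<in> C \<longleftrightarrow> r \<in> B" by (simp add: C_def arg)
    also have "\<dots> \<longleftrightarrow> y \<in> U" using UB[OF rN(1)] periodic[of y "- \<lfloor>y / (2 * pi)\<rfloor>"] by (simp add: r_def)
    finally show ?case by (simp add: indicator_def)
  qed
  then have "(LINT y|lebesgue. indicator U y * K y) = (LINT y|lebesgue. indicator C (cis y) * K y)"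
  proof (rule integral_cong_AE[rotated 2])
    have "(indicator U :: real \<Rightarrow> complex) \<in> borel_measurable lebesgue"
      using U by (rule borel_measurable_indicator)
    then show "(\<lambda>y. indicator U y * K y) \<in> borel_measurable lebesgue" by simp
    have "(\<lambda>y. indicator C (cis y) :: complex) \<in> borel_measurable lebesgue"
      using measurable_compose[OF cis_measurable(2) borel_measurable_indicator[OF C]] by simp
    then show "(\<lambda>y. indicator C (cis y) * K y) \<in> borel_measurable lebesgue" by simp
  qed
  also have "\<dots> = 0" by (rule vanishing_coefficients_Borel[OF K C])
  finally show ?thesis .
qed

section \<open>Translations and dilations as measure-preserving actions\<close>

definition translate :: "int \<Rightarrow> real \<Rightarrow> real" where
  "translate k x = x + 2 * pi * of_int k"

definition dilate :: "int \<Rightarrow> real \<Rightarrow> real" where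
  "dilate k x = 2 powi k * x"

definition saturation :: "(int \<Rightarrow> real \<Rightarrow> real) \<Rightarrow> real set \<Rightarrow> real set" where
  "saturation \<phi> S = {x. \<exists>k. \<phi> k x \<in> S}"

definition packs :: "(int \<Rightarrow> real \<Rightarrow> real) \<Rightarrow> real set \<Rightarrow> bool" where
  "packs \<phi> S \<longleftrightarrow> (AE x in lebesgue. \<forall>k l. \<phi> k x \<in> S \<longrightarrow> \<phi> l x \<in> S \<longrightarrow> k = l)"

definition covers :: "(int \<Rightarrow> real \<Rightarrow> real) \<Rightarrow> real set \<Rightarrow> bool" where
  "covers \<phi> S \<longleftrightarrow> (AE x in lebesgue. x \<in> saturation \<phi> S)"

text \<open>A measurable action of the integers on the line that preserves the measure \<open>m\<close>. As \<open>m\<close> is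
  absolutely continuous with respect to Lebesgue measure, packing and covering, which are stated for
  Lebesgue measure, hold for \<open>m\<close> as well.\<close>

locale invariant_measure =
  fixes m :: "real measure" and \<phi> :: "int \<Rightarrow> real \<Rightarrow> real"
  assumes sets_m: "sets m = sets lebesgue"
    and AE_m: "\<And>P. AE x in lebesgue. P x \<Longrightarrow> AE x in m. P x"
    and act_0: "\<phi> 0 x = x"
    and act_add: "\<phi> (k + l) x = \<phi> k (\<phi> l x)"
    and act_measurable: "S \<in> sets lebesgue \<Longrightarrow> {x. \<phi> k x \<in> S} \<in> sets lebesgue"
    and act_invariant: "S \<in> sets lebesgue \<Longrightarrow> emeasure m {x. \<phi> k x \<in> S} = emeasure m S"
begin

lemma act_minus: "\<phi> k (\<phi> (- k) x) = x" "\<phi> (- k) (\<phi> k x) = x"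
  using act_add[of k "- k" x] act_add[of "- k" k x] by (simp_all add: act_0)

lemma saturation_measurable: "S \<in> sets lebesgue \<Longrightarrow> saturation \<phi> S \<in> sets lebesgue"
  unfolding saturation_def Collect_ex_eq by (intro sets.countable_UN'' act_measurable) auto

lemma saturation_invariant: "\<phi> k x \<in> saturation \<phi> S \<longleftrightarrow> x \<in> saturation \<phi> S"
proof
  assume "\<phi> k x \<in> saturation \<phi> S"
  then obtain l where "\<phi> l (\<phi> k x) \<in> S" by (auto simp: saturation_def)
  then have "\<phi> (l + k) x \<in> S" using act_add[of l k x] by simp
  then show "x \<in> saturation \<phi> S" unfolding saturation_def by blast
next
  assume "x \<in> saturation \<phi> S"
  then obtain l where "\<phi> l x \<in> S" by (auto simp: saturation_def)
  then have "\<phi> (l - k) (\<phi> k x) \<in> S" using act_add[of "l - k" k x] by simp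
  then show "\<phi> k x \<in> saturation \<phi> S" unfolding saturation_def by auto
qed

text \<open>Cut \<open>F \<inter> saturation \<phi> S\<close> into pieces, each of which one group element moves into \<open>S\<close>. The moved
  pieces have the same measure, and they overlap in a null set because \<open>F\<close> packs.\<close>

lemma emeasure_Int_saturation_le:
  assumes F: "F \<in> sets lebesgue" "packs \<phi> F" and S: "S \<in> sets lebesgue"
  shows "emeasure m (F \<inter> saturation \<phi> S) \<le> emeasure m S"
proof -
  define A where "A n = F \<inter> {x. \<phi> (int_decode n) x \<in> S}" for n
  define B where "B n = {x. \<phi> (- int_decode n) x \<in> F} \<inter> S" for n
  have meas: "A n \<in> sets m" "B n \<in> sets m" for n
    unfolding sets_m A_def B_def using F S act_measurable by auto
  have AB: "emeasure m (A n) = emeasure m (B n)" for n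
  proof -
    have "B n = {x. \<phi> (- int_decode n) x \<in> A n}" by (auto simp: A_def B_def act_minus)
    then show ?thesis using act_invariant[of "A n"] meas(1)[of n] by (simp add: sets_m)
  qed
  have "F \<inter> saturation \<phi> S = (\<Union>n. A n)"
  proof -
    have "\<exists>n. \<phi> (int_decode n) x \<in> S" if "\<phi> k x \<in> S" for k x
      using that by (intro exI[of _ "int_encode k"]) simp
    then show ?thesis by (auto simp: saturation_def A_def)
  qed
  also have "emeasure m \<dots> \<le> (\<Sum>n. emeasure m (A n))"
    by (rule emeasure_subadditive_countably) (use meas in auto)
  also have "\<dots> = (\<Sum>n. \<integral>\<^sup>+x. indicator (B n) x \<partial>m)" using meas AB by simp
  also have "\<dots> = (\<integral>\<^sup>+x. (\<Sum>n. indicator (B n) x) \<partial>m)"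
    by (rule nn_integral_suminf[symmetric]) (use meas in simp)
  also have "\<dots> \<le> (\<integral>\<^sup>+x. indicator S x \<partial>m)"
  proof (rule nn_integral_mono_AE)
    show "AE x in m. (\<Sum>n. indicator (B n) x) \<le> (indicator S x :: ennreal)"
      using AE_m[OF F(2)[unfolded packs_def]]
    proof eventually_elim
      case (elim x)
      show ?case
      proof (cases "\<exists>n. x \<in> B n")
        case True
        then obtain n where n: "x \<in> B n" ..
        have "i = n" if "x \<in> B i" for i
        proof -
          have "- int_decode i = - int_decode n"
            using elim[rule_format, of "- int_decode i" "- int_decode n"] that n by (auto simp: B_def)
          then show ?thesis by (metis int_decode_inverse minus_equation_iff)
        qed
        then have "(\<lambda>i. indicator (B i) x) = (\<lambda>i. if i = n then 1 else (0 :: ennreal))"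
          using n by (intro ext) (metis indicator_eq_1_iff indicator_eq_0_iff)
        moreover have "(\<Sum>i. if i = n then 1 else 0) = (1 :: ennreal)"
          by (rule sums_unique[symmetric, OF sums_single[of n "\<lambda>_. 1 :: ennreal"]])
        ultimately have "(\<Sum>i. indicator (B i) x) = (1 :: ennreal)" by (simp only:)
        moreover have "x \<in> S" using n by (simp add: B_def)
        ultimately show ?thesis by (simp only: indicator_simps order_refl)
      qed (simp add: indicator_def)
    qed
  qed
  also have "\<dots> = emeasure m S" using S by (simp add: sets_m)
  finally show ?thesis .
qed

lemma emeasure_le_of_packs_covers:
  assumes F: "F \<in> sets lebesgue" "packs \<phi> F" and S: "S \<in> sets lebesgue" "covers \<phi> S"
  shows "emeasure m F \<le> emeasure m S"
proof -
  have "emeasure m F = emeasure m (F \<inter> saturation \<phi> S)"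
  proof (rule emeasure_eq_AE)
    show "AE x in m. x \<in> F \<longleftrightarrow> x \<in> F \<inter> saturation \<phi> S"
      using AE_m[OF S(2)[unfolded covers_def]] by eventually_elim auto
  qed (use F S saturation_measurable in \<open>auto simp: sets_m\<close>)
  then show ?thesis using emeasure_Int_saturation_le[OF F S(1)] by simp
qed

end

lemma translate_measurable: "S \<in> sets lebesgue \<Longrightarrow> {x. translate k x \<in> S} \<in> sets lebesgue"
proof -
  assume S: "S \<in> sets lebesgue"
  have "(\<lambda>x. 2 * pi * of_int k + 1 * x) \<in> lebesgue \<rightarrow>\<^sub>M lebesgue"
    using lebesgue_affine_measurable[where c= "\<lambda>x::real. 1" and t = "2 * pi * of_int k"] by simp
  from measurable_sets[OF this S] show ?thesis
    by (simp add: vimage_def translate_def add.commute)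
qed

lemma dilate_measurable: "S \<in> sets lebesgue \<Longrightarrow> {x. dilate k x \<in> S} \<in> sets lebesgue"
proof -
  assume S: "S \<in> sets lebesgue"
  have "(\<lambda>x. 0 + (2 powi k :: real) * x) \<in> lebesgue \<rightarrow>\<^sub>M lebesgue"
    using lebesgue_affine_measurable[where c= "\<lambda>x::real. 2 powi k" and t = 0] by simp
  from measurable_sets[OF this S] show ?thesis by (simp add: vimage_def dilate_def)
qed

text \<open>Periodic densities are admitted so that the comparison of measures of tiles yields, at once, the
  comparison of integrals of periodic functions over tiles.\<close>

lemma translate_invariant_density:
  assumes [measurable]: "f \<in> borel_measurable lebesgue"
    and periodic: "\<And>k x. f (translate k x) = (f x :: ennreal)"
  shows "invariant_measure (density lebesgue f) translate"
proof
  show "AE x in density lebesgue f. P x" if "AE x in lebesgue. P x" for P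
    using that by (subst AE_density) auto
  fix S :: "real set" and k assume S: "S \<in> sets lebesgue"
  show "{x. translate k x \<in> S} \<in> sets lebesgue" using S by (rule translate_measurable)
  have Sm: "(\<lambda>x. f x * indicator S x) \<in> borel_measurable lebesgue" using S by simp
  have "(\<integral>\<^sup>+x. f x * indicator S x \<partial>lebesgue) = (\<integral>\<^sup>+x. f (translate k x) * indicator S (translate k x) \<partial>lebesgue)"
    using nn_integral_real_affine_lebesgue[OF Sm, of 1 "2 * pi * of_int k"]
    by (simp add: translate_def add.commute)
  also have "\<dots> = (\<integral>\<^sup>+x. f x * indicator {x. translate k x \<in> S} x \<partial>lebesgue)"
    by (intro nn_integral_cong) (simp add: periodic indicator_def)
  finally show "emeasure (density lebesgue f) {x. translate k x \<in> S} = emeasure (density lebesgue f) S"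
    using S translate_measurable[OF S] by (simp add: emeasure_density)
qed (auto simp: translate_def algebra_simps)

text \<open>The Haar measure of the multiplicative group of nonzero reals.\<close>

definition log_measure :: "real measure" where
  "log_measure = density lebesgue (\<lambda>x. ennreal (1 / \<bar>x\<bar>))"

lemma inverse_abs_measurable: "(\<lambda>x::real. 1 / \<bar>x\<bar>) \<in> borel_measurable lebesgue"
  by (rule measurable_completion) measurable

lemma sets_log_measure [simp]: "sets log_measure = sets lebesgue"
  by (simp add: log_measure_def)

lemma emeasure_log_measure:
  "S \<in> sets lebesgue \<Longrightarrow> emeasure log_measure S = (\<integral>\<^sup>+x. ennreal (1 / \<bar>x\<bar>) * indicator S x \<partial>lebesgue)"
  using inverse_abs_measurable by (simp add: log_measure_def emeasure_density)

global_interpretation dilation: invariant_measure log_measure dilate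
proof
  show "AE x in log_measure. P x" if "AE x in lebesgue. P x" for P
    unfolding log_measure_def using that inverse_abs_measurable by (subst AE_density) auto
  fix S :: "real set" and k assume S: "S \<in> sets lebesgue"
  show "{x. dilate k x \<in> S} \<in> sets lebesgue" using S by (rule dilate_measurable)
  have "(\<lambda>x. ennreal (1 / \<bar>x\<bar>) * indicator S x) \<in> borel_measurable lebesgue"
    using S inverse_abs_measurable by simp
  then have "(\<integral>\<^sup>+x. ennreal (1 / \<bar>x\<bar>) * indicator S x \<partial>lebesgue) =
      ennreal (2 powi k) * (\<integral>\<^sup>+x. ennreal (1 / \<bar>dilate k x\<bar>) * indicator S (dilate k x) \<partial>lebesgue)"
    using nn_integral_real_affine_lebesgue[of "\<lambda>x. ennreal (1 / \<bar>x\<bar>) * indicator S x" "2 powi k" 0]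
    by (simp add: dilate_def)
  also have "\<dots> = (\<integral>\<^sup>+x. ennreal (2 powi k) * (ennreal (1 / \<bar>dilate k x\<bar>) * indicator S (dilate k x)) \<partial>lebesgue)"
  proof (rule nn_integral_cmult[symmetric])
    have "(\<lambda>x. ennreal (1 / \<bar>dilate k x\<bar>)) \<in> borel_measurable lebesgue"
      unfolding dilate_def by (rule measurable_completion) measurable
    moreover have "indicator S (dilate k x) = (indicator {x. dilate k x \<in> S} x :: ennreal)" for x
      by (simp add: indicator_def)
    ultimately show "(\<lambda>x. ennreal (1 / \<bar>dilate k x\<bar>) * indicator S (dilate k x)) \<in> borel_measurable lebesgue"
      using dilate_measurable[OF S] by simp
  qed
  also have "\<dots> = (\<integral>\<^sup>+x. ennreal (1 / \<bar>x\<bar>) * indicator {x. dilate k x \<in> S} x \<partial>lebesgue)"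
  proof (rule nn_integral_cong)
    fix x
    have "ennreal (2 powi k) * ennreal (1 / \<bar>dilate k x\<bar>) = ennreal (2 powi k * (1 / \<bar>dilate k x\<bar>))"
      by (rule ennreal_mult'[symmetric]) simp
    also have "2 powi k * (1 / \<bar>dilate k x\<bar>) = 1 / \<bar>x\<bar>" by (simp add: dilate_def abs_mult)
    finally show "ennreal (2 powi k) * (ennreal (1 / \<bar>dilate k x\<bar>) * indicator S (dilate k x)) =
      ennreal (1 / \<bar>x\<bar>) * indicator {x. dilate k x \<in> S} x"
      by (simp add: mult.assoc[symmetric] indicator_def)
  qed
  finally show "emeasure log_measure {x. dilate k x \<in> S} = emeasure log_measure S"
    using S dilate_measurable[OF S] by (simp add: emeasure_log_measure)
qed (auto simp: dilate_def power_int_add)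

global_interpretation translation: invariant_measure lebesgue translate
proof -
  have "density lebesgue (\<lambda>_. 1) = (lebesgue :: real measure)" by (rule density_1)
  then show "invariant_measure lebesgue translate"
    using translate_invariant_density[of "\<lambda>_. 1"] by simp
qed

lemma AE_lebesgue_dilates:
  assumes "AE x in lebesgue. P x"
  shows "AE x in lebesgue. \<forall>k. P (dilate k x)"
  unfolding AE_all_countable
proof
  fix k
  show "AE x in lebesgue. P (dilate k x)"
    using AE_lebesgue_affine[OF assms, of "2 powi k" 0] by (simp add: dilate_def)
qed

lemma packs_translateI:
  assumes "\<And>j. j \<noteq> 0 \<Longrightarrow> AE x in lebesgue. \<not> (x \<in> S \<and> translate j x \<in> S)"
  shows "packs translate S"
proof -
  have "AE x in lebesgue. \<forall>j. j \<noteq> 0 \<longrightarrow> \<not> (x \<in> S \<and> translate j x \<in> S)"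
    unfolding AE_all_countable using assms by auto
  from AE_lebesgue_translates[OF this] show ?thesis
    unfolding packs_def
  proof eventually_elim
    case (elim x)
    show ?case
    proof (intro allI impI)
      fix k l assume kl: "translate k x \<in> S" "translate l x \<in> S"
      show "k = l"
      proof (rule ccontr)
        assume "k \<noteq> l"
        then have "\<not> (translate k x \<in> S \<and> translate (l - k) (translate k x) \<in> S)"
          using elim[rule_format, of "l - k" k] by (simp add: translate_def)
        then show False using kl by (simp add: translation.act_add[symmetric])
      qed
    qed
  qed
qed

lemma packs_dilateI:
  assumes "\<And>j. j \<noteq> 0 \<Longrightarrow> AE x in lebesgue. \<not> (x \<in> S \<and> dilate j x \<in> S)"
  shows "packs dilate S"
proof -
  have "AE x in lebesgue. \<forall>j. j \<noteq> 0 \<longrightarrow> \<not> (x \<in> S \<and> dilate j x \<in> S)"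
    unfolding AE_all_countable using assms by auto
  from AE_lebesgue_dilates[OF this] show ?thesis
    unfolding packs_def
  proof eventually_elim
    case (elim x)
    show ?case
    proof (intro allI impI)
      fix k l assume kl: "dilate k x \<in> S" "dilate l x \<in> S"
      show "k = l"
      proof (rule ccontr)
        assume "k \<noteq> l"
        then have "\<not> (dilate k x \<in> S \<and> dilate (l - k) (dilate k x) \<in> S)"
          using elim[rule_format, of "l - k" k] by simp
        then show False using kl by (simp add: dilation.act_add[symmetric])
      qed
    qed
  qed
qed

lemma half_open_period_representative:
  fixes a :: real
  shows "\<exists>!k. translate k x \<in> {a..<a + 2 * pi}"
proof -
  define k where "k = - \<lfloor>(x - a) / (2 * pi)\<rfloor>"
  have "translate k x \<in> {a..<a + 2 * pi}"
    using floor_divide_lower[of "2 * pi" "x - a"] floor_divide_upper[of "2 * pi" "x - a"]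
    by (simp add: k_def translate_def algebra_simps)
  moreover have "l = k" if "translate l x \<in> {a..<a + 2 * pi}" "translate k x \<in> {a..<a + 2 * pi}" for k l
  proof -
    have "2 * pi * of_int (l - k) < 2 * pi * 1" "2 * pi * (- 1) < 2 * pi * of_int (l - k)"
      using that by (auto simp: translate_def algebra_simps)
    then have "of_int (l - k) < (1 :: real)" "- 1 < (of_int (l - k) :: real)"
      by (auto simp only: mult_less_cancel_left_pos pi_gt_zero mult_pos_pos zero_less_numeral)
    then show ?thesis by linarith
  qed
  ultimately show ?thesis by blast
qed

lemma half_open_period_tiles:
  "packs translate {a..<a + 2 * pi}" "covers translate {a..<a + 2 * pi}"
proof -
  show "packs translate {a..<a + 2 * pi}"
    unfolding packs_def using half_open_period_representative[of _ a] by (intro AE_I2) blast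
  show "covers translate {a..<a + 2 * pi}"
    unfolding covers_def saturation_def using half_open_period_representative[of _ a] by (intro AE_I2) blast
qed

section \<open>Translation tiles\<close>

definition translation_tile :: "real set \<Rightarrow> bool" where
  "translation_tile W \<longleftrightarrow> W \<in> sets lebesgue \<and> packs translate W \<and> covers translate W"

definition dilation_tile :: "real set \<Rightarrow> bool" where
  "dilation_tile W \<longleftrightarrow> W \<in> sets lebesgue \<and> packs dilate W \<and> covers dilate W"

lemma half_open_period_tile: "translation_tile {a..<a + 2 * pi}"
  by (simp add: translation_tile_def half_open_period_tiles)

lemma translation_tile_nn_integral_eq:
  assumes V: "translation_tile V" and W: "translation_tile W"
    and f: "f \<in> borel_measurable lebesgue" "\<And>k x. f (translate k x) = (f x :: ennreal)"
  shows "(\<integral>\<^sup>+x. f x * indicator V x \<partial>lebesgue) = (\<integral>\<^sup>+x. f x * indicator W x \<partial>lebesgue)"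
proof -
  interpret invariant_measure "density lebesgue f" translate
    using f by (rule translate_invariant_density)
  have "emeasure (density lebesgue f) V = emeasure (density lebesgue f) W"
    using V W by (intro antisym emeasure_le_of_packs_covers) (auto simp: translation_tile_def)
  then show ?thesis using V W f by (simp add: emeasure_density translation_tile_def)
qed

lemma translation_tile_emeasure:
  assumes "translation_tile W"
  shows "emeasure lebesgue W = ennreal (2 * pi)"
proof -
  have "emeasure lebesgue W = (\<integral>\<^sup>+x. 1 * indicator W x \<partial>lebesgue)"
    using assms by (simp add: translation_tile_def)
  also have "\<dots> = (\<integral>\<^sup>+x. 1 * indicator {0..<0 + 2 * pi} x \<partial>lebesgue)"
    by (rule translation_tile_nn_integral_eq[OF assms half_open_period_tile]) auto
  finally show ?thesis by simp
qed

lemma integrable_indicator_mult_cis: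
  assumes "W \<in> lmeasurable"
  shows "integrable lebesgue (\<lambda>y. indicator W y * cis (a * y))"
proof -
  have "integrable lebesgue (\<lambda>y. complex_of_real (indicator W y))"
    using assms by (intro integrable_of_real) (simp add: lmeasurable_iff_integrable)
  then have "integrable lebesgue (indicator W :: real \<Rightarrow> complex)"
    by (simp add: of_real_indicator)
  then show ?thesis by (rule integrable_mult_cis)
qed

lemma translation_tile_lmeasurable: "translation_tile W \<Longrightarrow> W \<in> lmeasurable"
  using translation_tile_emeasure by (auto simp: translation_tile_def fmeasurable_def)

text \<open>Adding \<open>1\<close> to the cosine and to the sine makes them nonnegative, so that measures with periodic
  densities can be compared.\<close>

lemma translation_tile_integral_cis_eq:
  assumes V: "translation_tile V" and W: "translation_tile W"
  shows "(LINT y|lebesgue. indicator V y * cis (of_int n * y)) = (LINT y|lebesgue. indicator W y * cis (of_int n * y))"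
proof -
  have real: "(LINT y|lebesgue. indicator V y * (1 + f y)) = (LINT y|lebesgue. indicator W y * (1 + f y))"
    if [measurable]: "f \<in> borel_measurable borel" and "\<And>y. \<bar>f y\<bar> \<le> 1" and "\<And>k y. f (translate k y) = f y"
    for f :: "real \<Rightarrow> real"
  proof -
    have fm: "(\<lambda>y. 1 + f y) \<in> borel_measurable lebesgue" by (rule measurable_completion) measurable
    have nn: "0 \<le> 1 + f y" for y using that(2)[of y] by linarith
    have "(LINT y|lebesgue. indicator S y * (1 + f y)) = enn2real (\<integral>\<^sup>+y. ennreal (1 + f y) * indicator S y \<partial>lebesgue)"
      if "S \<in> sets lebesgue" for S
    proof -
      have "(\<lambda>y. indicator S y * (1 + f y)) \<in> borel_measurable lebesgue"
        using that fm by (intro borel_measurable_times) simp_all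
      then have "(LINT y|lebesgue. indicator S y * (1 + f y)) = enn2real (\<integral>\<^sup>+y. ennreal (indicator S y * (1 + f y)) \<partial>lebesgue)"
        using nn by (intro integral_eq_nn_integral) auto
      also have "(\<lambda>y. ennreal (indicator S y * (1 + f y))) = (\<lambda>y. ennreal (1 + f y) * indicator S y)"
        by (auto simp: indicator_def)
      finally show ?thesis .
    qed
    then show ?thesis
      using translation_tile_nn_integral_eq[OF V W, of "\<lambda>y. ennreal (1 + f y)"] fm that(3) V W
      by (simp add: translation_tile_def)
  qed
  have one: "measure lebesgue V = measure lebesgue W"
    using V W translation_tile_emeasure by (simp add: measure_def)
  have split: "(LINT y|lebesgue. indicator S y * (1 + f y)) = measure lebesgue S + (LINT y|lebesgue. indicator S y * f y)"
    if S: "S \<in> lmeasurable" and [measurable]: "f \<in> borel_measurable borel" and "\<And>y. \<bar>f y\<bar> \<le> 1"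
    for S and f :: "real \<Rightarrow> real"
  proof -
    have "integrable lebesgue (\<lambda>y. indicator S y * f y)"
    proof (rule Bochner_Integration.integrable_bound)
      show "integrable lebesgue (indicator S :: real \<Rightarrow> real)" using S by (simp add: lmeasurable_iff_integrable)
      show "(\<lambda>y. indicator S y * f y) \<in> borel_measurable lebesgue"
      proof (rule borel_measurable_times)
        show "(indicator S :: real \<Rightarrow> real) \<in> borel_measurable lebesgue"
          using S by (intro borel_measurable_indicator) (auto simp: fmeasurable_def)
        show "f \<in> borel_measurable lebesgue" by (rule measurable_completion) simp
      qed
    qed (use that(3) in \<open>auto simp: indicator_def\<close>)
    moreover have "integrable lebesgue (indicator S :: real \<Rightarrow> real)" using S by (simp add: lmeasurable_iff_integrable)
    ultimately show ?thesis by (simp add: distrib_left)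
  qed
  have eq: "(LINT y|lebesgue. indicator V y * f y) = (LINT y|lebesgue. indicator W y * f y)"
    if "f \<in> borel_measurable borel" "\<And>y. \<bar>f y\<bar> \<le> 1" "\<And>k y. f (translate k y) = f y"
    for f :: "real \<Rightarrow> real"
    using real[OF that] split[OF translation_tile_lmeasurable[OF V] that(1,2)]
      split[OF translation_tile_lmeasurable[OF W] that(1,2)] one by simp
  have per: "cis (of_int n * translate k y) = cis (of_int n * y)" for k y
  proof -
    have "cis (of_int n * translate k y) = cis (of_int n * y) * cis (2 * pi * of_int (n * k))"
      by (simp add: cis_mult translate_def algebra_simps)
    also have "cis (2 * pi * of_int (n * k)) = 1" by (rule cis_multiple_2pi) simp
    finally show ?thesis by simp
  qed
  have cos: "cos (of_int n * translate k y) = cos (of_int n * y)" for k y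
    using arg_cong[OF per[of k y], of Re] by simp
  have sin: "sin (of_int n * translate k y) = sin (of_int n * y)" for k y
    using arg_cong[OF per[of k y], of Im] by simp
  have parts: "(LINT y|lebesgue. indicator S y * cis (of_int n * y)) =
      Complex (LINT y|lebesgue. indicator S y * cos (of_int n * y)) (LINT y|lebesgue. indicator S y * sin (of_int n * y))"
    if "S \<in> lmeasurable" for S
  proof -
    have R: "Re (indicator S y * cis (of_int n * y)) = indicator S y * cos (of_int n * y)"
      and I: "Im (indicator S y * cis (of_int n * y)) = indicator S y * sin (of_int n * y)" for y
      by (auto simp: indicator_def)
    note int = integrable_indicator_mult_cis[OF that, of "of_int n"]
    have "(LINT y|lebesgue. indicator S y * cos (of_int n * y)) = Re (LINT y|lebesgue. indicator S y * cis (of_int n * y))"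
      by (subst integral_Re[symmetric, OF int]) (simp only: R)
    moreover have "(LINT y|lebesgue. indicator S y * sin (of_int n * y)) = Im (LINT y|lebesgue. indicator S y * cis (of_int n * y))"
      by (subst integral_Im[symmetric, OF int]) (simp only: I)
    ultimately show ?thesis by (simp add: complex_eq_iff)
  qed
  show ?thesis
    unfolding parts[OF translation_tile_lmeasurable[OF V]] parts[OF translation_tile_lmeasurable[OF W]]
    using eq[of "\<lambda>y. cos (of_int n * y)"] eq[of "\<lambda>y. sin (of_int n * y)"] cos sin by simp
qed

text \<open>All translation tiles give the same integral. Shifting a period by \<open>pi / n\<close> changes the sign of the
  integrand, so the integral vanishes for \<open>n \<noteq> 0\<close>.\<close>

lemma translation_tile_integral_cis:
  assumes "translation_tile W"
  shows "(LINT y|lebesgue. indicator W y * cis (of_int n * y)) = (if n = 0 then 2 * pi else 0)"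
proof (cases "n = 0")
  case True
  have "(LINT y|lebesgue. indicator W y * cis (of_int n * y)) = (LINT y|lebesgue. complex_of_real (indicator W y))"
    using True by (simp add: of_real_indicator)
  also have "\<dots> = of_real (measure lebesgue W)" by simp
  finally show ?thesis using True translation_tile_emeasure[OF assms] by (simp add: measure_def)
next
  case False
  define I where "I = (LINT y|lebesgue. indicator {0..<2 * pi} y * cis (of_int n * y))"
  define a where "a = pi / of_int n"
  have "I = (LINT y|lebesgue. indicator {a..<a + 2 * pi} y * cis (of_int n * y))"
    using translation_tile_integral_cis_eq[OF half_open_period_tile[of 0] half_open_period_tile[of a]] by (simp add: I_def)
  also have "\<dots> = (LINT y|lebesgue. indicator {a..<a + 2 * pi} (a + 1 * y) * cis (of_int n * (a + 1 * y)))"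
    using lebesgue_integral_real_affine[of 1 "\<lambda>y. indicator {a..<a + 2 * pi} y * cis (of_int n * y)" a] by simp
  also have "\<dots> = (LINT y|lebesgue. cis (of_int n * a) * (indicator {0..<2 * pi} y * cis (of_int n * y)))"
    by (intro Bochner_Integration.integral_cong) (auto simp: indicator_def distrib_left cis_mult)
  also have "\<dots> = cis (of_int n * a) * I" by (simp add: I_def)
  also have "cis (of_int n * a) = -1" using False by (simp add: a_def)
  finally have "I = 0" by simp
  then show ?thesis
    using translation_tile_integral_cis_eq[OF assms half_open_period_tile[of 0]] False by (simp add: I_def)
qed

text \<open>Integrate over the sets where the real or the imaginary part is positive or negative.\<close>

lemma AE_zero_of_set_integrals:
  fixes K :: "real \<Rightarrow> complex"
  assumes K: "integrable lebesgue K"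
    and zero: "\<And>B. B \<in> sets lebesgue \<Longrightarrow> (LINT y|lebesgue. indicator B y * K y) = 0"
  shows "AE y in lebesgue. K y = 0"
proof -
  have real: "AE y in lebesgue. r y = 0"
    if r: "integrable lebesgue r" "\<And>B. B \<in> sets lebesgue \<Longrightarrow> (LINT y|lebesgue. indicator B y * r y) = 0"
    for r :: "real \<Rightarrow> real"
  proof -
    have [measurable]: "r \<in> borel_measurable lebesgue" using r(1) by (rule borel_measurable_integrable)
    have B: "{y. 0 < r y} \<in> sets lebesgue" "{y. r y < 0} \<in> sets lebesgue"
      using borel_measurable_less[of "\<lambda>_. 0" lebesgue r] borel_measurable_less[of r lebesgue "\<lambda>_. 0"] by auto
    have int: "integrable lebesgue (\<lambda>y. indicator B y * r y)" if "B \<in> sets lebesgue" for B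
      using integrable_mult_indicator[OF that r(1)] by simp
    have "AE y in lebesgue. indicator {y. 0 < r y} y * r y = 0"
      using integral_nonneg_eq_0_iff_AE[OF int[OF B(1)]] r(2)[OF B(1)] by (auto simp: indicator_def)
    moreover have "AE y in lebesgue. - (indicator {y. r y < 0} y * r y) = 0"
    proof -
      have "integrable lebesgue (\<lambda>y. - (indicator {y. r y < 0} y * r y))" using int[OF B(2)] by simp
      from integral_nonneg_eq_0_iff_AE[OF this] show ?thesis using r(2)[OF B(2)] by (auto simp: indicator_def)
    qed
    ultimately show ?thesis by eventually_elim (auto simp: indicator_def split: if_splits)
  qed
  have int: "integrable lebesgue (\<lambda>y. indicator B y * K y)" if "B \<in> sets lebesgue" for B
  proof -
    have "indicator B y *\<^sub>R K y = indicator B y * K y" for y by (simp add: indicator_def)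
    then show ?thesis using integrable_mult_indicator[OF that K] by simp
  qed
  have "AE y in lebesgue. Re (K y) = 0"
  proof (rule real)
    show "integrable lebesgue (\<lambda>y. Re (K y))" using K by simp
    fix B :: "real set" assume B: "B \<in> sets lebesgue"
    have "indicator B y * Re (K y) = Re (indicator B y * K y)" for y by (simp add: indicator_def)
    then have "(LINT y|lebesgue. indicator B y * Re (K y)) = Re (LINT y|lebesgue. indicator B y * K y)"
      by (subst integral_Re[symmetric, OF int[OF B]]) (simp only:)
    then show "(LINT y|lebesgue. indicator B y * Re (K y)) = 0" using zero[OF B] by simp
  qed
  moreover have "AE y in lebesgue. Im (K y) = 0"
  proof (rule real)
    show "integrable lebesgue (\<lambda>y. Im (K y))" using K by simp
    fix B :: "real set" assume B: "B \<in> sets lebesgue"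
    have "indicator B y * Im (K y) = Im (indicator B y * K y)" for y by (simp add: indicator_def)
    then have "(LINT y|lebesgue. indicator B y * Im (K y)) = Im (LINT y|lebesgue. indicator B y * K y)"
      by (subst integral_Im[symmetric, OF int[OF B]]) (simp only:)
    then show "(LINT y|lebesgue. indicator B y * Im (K y)) = 0" using zero[OF B] by simp
  qed
  ultimately show ?thesis by eventually_elim (simp add: complex_eq_iff)
qed

text \<open>On a packing \<open>W\<close> every measurable subset \<open>B\<close> is, up to a null set, the trace of the periodic set
  \<open>saturation translate B\<close>; hence all integrals of \<open>K\<close> over subsets of \<open>W\<close> vanish.\<close>

lemma vanishing_coefficients_on_packing:
  assumes W: "W \<in> sets lebesgue" "packs translate W" and K: "vanishing_coefficients (\<lambda>y. K y * indicator W y)"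
  shows "AE y in lebesgue. y \<in> W \<longrightarrow> K y = 0"
proof -
  let ?K = "\<lambda>y. K y * indicator W y"
  have Kint: "integrable lebesgue ?K" using K by (simp add: vanishing_coefficients_def)
  have "AE y in lebesgue. ?K y = 0"
  proof (rule AE_zero_of_set_integrals[OF Kint])
    fix B :: "real set" assume B: "B \<in> sets lebesgue"
    define U where "U = saturation translate (B \<inter> W)"
    have U: "U \<in> sets lebesgue" unfolding U_def using B W by (intro translation.saturation_measurable) auto
    have "(LINT y|lebesgue. indicator B y * ?K y) = (LINT y|lebesgue. indicator U y * ?K y)"
    proof (rule integral_cong_AE)
      have m: "(indicator S :: real \<Rightarrow> complex) \<in> borel_measurable lebesgue" if "S \<in> sets lebesgue" for S
        using that by (rule borel_measurable_indicator)
      show "(\<lambda>y. indicator B y * ?K y) \<in> borel_measurable lebesgue" "(\<lambda>y. indicator U y * ?K y) \<in> borel_measurable lebesgue"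
        by (rule borel_measurable_times[OF m borel_measurable_integrable[OF Kint]], fact)+
      show "AE y in lebesgue. indicator B y * ?K y = indicator U y * ?K y"
        using W(2)[unfolded packs_def]
      proof eventually_elim
        case (elim y)
        show ?case
        proof (cases "y \<in> W")
          case True
          have "y \<in> B" if "translate k y \<in> B \<inter> W" for k
            using elim[rule_format, of k 0] that True by (simp add: translation.act_0)
          moreover have "y \<in> U" if "y \<in> B"
            unfolding U_def saturation_def using that True by (auto intro!: exI[of _ 0] simp: translation.act_0)
          ultimately have "y \<in> U \<longleftrightarrow> y \<in> B" by (auto simp: U_def saturation_def)
          then show ?thesis by (simp add: indicator_def)
        qed simp
      qed
    qed
    also have "\<dots> = 0"
    proof (rule vanishing_coefficients_periodic_set[OF K U])
      show "y + 2 * pi * of_int k \<in> U \<longleftrightarrow> y \<in> U" for y k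
        using translation.saturation_invariant[of k y "B \<inter> W"] by (simp add: U_def translate_def)
    qed
    finally show "(LINT y|lebesgue. indicator B y * ?K y) = 0" .
  qed
  then show ?thesis by eventually_elim (auto simp: indicator_def)
qed

section \<open>Wavelet sets are simultaneous tiles\<close>

lemma indicator_complex_L2:
  assumes "S \<in> lmeasurable"
  shows "(indicator S :: real \<Rightarrow> complex) \<in> L2" and "integrable lebesgue (indicator S :: real \<Rightarrow> complex)"
proof -
  have int: "integrable lebesgue (indicator S :: real \<Rightarrow> real)"
    using assms by (simp add: lmeasurable_iff_integrable)
  have eq: "(indicator S :: real \<Rightarrow> complex) = (\<lambda>x. complex_of_real (indicator S x))"
    by (auto simp: indicator_def)
  show "integrable lebesgue (indicator S :: real \<Rightarrow> complex)"
    unfolding eq using int by (rule integrable_of_real)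
  then have m: "(indicator S :: real \<Rightarrow> complex) \<in> borel_measurable lebesgue"
    by (rule borel_measurable_integrable)
  show "(indicator S :: real \<Rightarrow> complex) \<in> L2"
    by (rule L2_dominated[OF m int]) (simp add: indicator_def)
qed

lemma dyadic_transform_indicator:
  "dyadic_transform (\<lambda>x. of_real c * indicator W x) (j, k) x =
    of_real (2 powr (- of_int j / 2) * c) * cis (- (of_int k * dilate (- j) x)) * indicator W (dilate (- j) x)"
proof -
  have "exp (- \<i> * of_real (of_int k * 2 powi (- j) * x)) = cis (- (of_int k * dilate (- j) x))"
    unfolding cis_conv_exp dilate_def by (rule arg_cong[where f=exp]) simp
  then show ?thesis unfolding dyadic_transform_apply dilate_def
    by (simp only: of_real_mult mult_ac)
qed

text \<open>After rescaling by \<open>2 powi j\<close>, the inner products at scale \<open>j\<close> are the Fourier coefficients of the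
  rescaled \<open>h\<close> on \<open>W\<close>.\<close>

lemma L2_inner_dyadic_transform_indicator:
  "L2_inner h (dyadic_transform (\<lambda>x. of_real c * indicator W x) (j, k)) =
    of_real (2 powr (- of_int j / 2) * c * 2 powi j) *
      (LINT y|lebesgue. h (dilate j y) * indicator W y * cis (of_int k * y))"
proof -
  let ?a = "2 powr (- of_int j / 2) * c"
  have inv: "dilate (- j) (dilate j y) = y" for y
    unfolding dilate_def by (simp add: power_int_minus)
  have "L2_inner h (dyadic_transform (\<lambda>x. of_real c * indicator W x) (j, k)) =
      (LINT x|lebesgue. of_real ?a * (h x * indicator W (dilate (- j) x) * cis (of_int k * dilate (- j) x)))"
    unfolding L2_inner_def dyadic_transform_indicator
    by (intro Bochner_Integration.integral_cong refl) (auto simp: indicator_def cis_cnj)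
  also have "\<dots> = of_real ?a * (LINT x|lebesgue. h x * indicator W (dilate (- j) x) * cis (of_int k * dilate (- j) x))"
    by (rule integral_mult_right_zero)
  also have "(LINT x|lebesgue. h x * indicator W (dilate (- j) x) * cis (of_int k * dilate (- j) x)) =
      \<bar>2 powi j\<bar> *\<^sub>R (LINT y|lebesgue. h (dilate j y) * indicator W (dilate (- j) (dilate j y)) * cis (of_int k * dilate (- j) (dilate j y)))"
    using lebesgue_integral_real_affine[of "2 powi j" "\<lambda>x. h x * indicator W (dilate (- j) x) * cis (of_int k * dilate (- j) x)" 0]
    unfolding dilate_def[of j] by simp
  finally show ?thesis by (simp add: inv scaleR_conv_of_real)
qed

lemma indicator_dilate_disjoint_integral:
  assumes "packs dilate W" "j \<noteq> 0"
  shows "(LINT y|lebesgue. f y * indicator W (dilate j y) * indicator W y * g y :: complex) = 0"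
proof (rule integral_eq_zero_AE)
  show "AE y in lebesgue. f y * indicator W (dilate j y) * indicator W y * g y = 0"
    using assms(1)[unfolded packs_def]
  proof eventually_elim
    case (elim y)
    have "\<not> (y \<in> W \<and> dilate j y \<in> W)"
      using elim[rule_format, of 0 j] assms(2) by (auto simp: dilate_def)
    then show ?case by (auto simp: indicator_def)
  qed
qed

text \<open>Different scales are orthogonal because the dilates of \<open>W\<close> are disjoint, and equal scales because the
  exponentials integrate over \<open>W\<close> as over a period. A function orthogonal to the system vanishes on
  every dilate of \<open>W\<close> by uniqueness of Fourier coefficients, and the dilates cover the line.\<close>

theorem wavelet_set_of_tile:
  assumes T: "translation_tile W" and D: "dilation_tile W"
  shows "wavelet_set W"
proof -
  have W: "W \<in> sets lebesgue" using T by (simp add: translation_tile_def)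
  have lm: "W \<in> lmeasurable" using T by (rule translation_tile_lmeasurable)
  have M: "measure lebesgue W = 2 * pi" using translation_tile_emeasure[OF T] by (simp add: measure_def)
  define c where "c = 1 / sqrt (measure lebesgue W)"
  have cc: "c * c = 1 / (2 * pi)" by (simp add: c_def M)
  have geq: "(\<lambda>x. complex_of_real (c * indicator W x)) = (\<lambda>x. of_real c * indicator W x)"
    by (auto simp: indicator_def)
  have g: "(\<lambda>x. complex_of_real c * indicator W x) \<in> L2" "integrable lebesgue (\<lambda>x. complex_of_real c * indicator W x)"
    using L2_cmult[OF indicator_complex_L2(1)[OF lm]] indicator_complex_L2(2)[OF lm] by auto
  obtain w where w: "is_fourier_L2 w (\<lambda>x. complex_of_real c * indicator W x)"
    using is_fourier_L2_inverse_exists[OF g] by blast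
  have "orthonormal_wavelet w"
  proof (rule orthonormal_wavelet_of_transform[OF w])
    fix i i' :: "int \<times> int"
    obtain j k j' k' where i: "i = (j, k)" "i' = (j', k')" by (metis surj_pair)
    let ?g = "dyadic_transform (\<lambda>x. complex_of_real c * indicator W x)"
    show "L2_inner (?g i) (?g i') = (if i = i' then 1 else 0)"
    proof (cases "j = j'")
      case False
      have eq: "dilate (- j) (dilate j' y) = dilate (j' - j) y" for y
        by (simp add: dilate_def power_int_diff power_int_minus field_simps)
      have "(LINT y|lebesgue. ?g i (dilate j' y) * indicator W y * cis (of_int k' * y)) =
        (LINT y|lebesgue. of_real (2 powr (- of_int j / 2) * c) * cis (- (of_int k * dilate (j' - j) y)) *
          indicator W (dilate (j' - j) y) * indicator W y * cis (of_int k' * y))"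
        unfolding i dyadic_transform_indicator eq by (simp only:)
      also have "\<dots> = 0"
        by (rule indicator_dilate_disjoint_integral) (use D False in \<open>auto simp: dilation_tile_def\<close>)
      finally show ?thesis
        using False unfolding i(2) L2_inner_dyadic_transform_indicator i(1) by simp
    next
      case True
      have eq: "dilate (- j) (dilate j y) = y" for y
        by (simp add: dilate_def power_int_minus)
      have "(LINT y|lebesgue. ?g i (dilate j y) * indicator W y * cis (of_int k' * y)) =
        (LINT y|lebesgue. of_real (2 powr (- of_int j / 2) * c) * (indicator W y * cis (of_int (k' - k) * y)))"
        unfolding i dyadic_transform_indicator eq
        by (intro Bochner_Integration.integral_cong refl) (auto simp: indicator_def cis_mult left_diff_distrib)
      also have "\<dots> = complex_of_real (2 powr (- of_int j / 2) * c) * complex_of_real (if k = k' then 2 * pi else 0)"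
        using translation_tile_integral_cis[OF T, of "k' - k"] by simp
      finally have "L2_inner (?g i) (?g i') =
          complex_of_real (2 powr (- of_int j / 2) * c * 2 powi j) *
            (complex_of_real (2 powr (- of_int j / 2) * c) * complex_of_real (if k = k' then 2 * pi else 0))"
        unfolding i True[symmetric] L2_inner_dyadic_transform_indicator by (simp only:)
      also have "\<dots> = of_real ((2 powr (- of_int j / 2))\<^sup>2 * 2 powi j * (c * c) * (if k = k' then 2 * pi else 0))"
        by (simp add: power2_eq_square mult_ac)
      also have "(2 powr (- of_int j / 2))\<^sup>2 * 2 powi j = (1 :: real)"
        unfolding powr_minus_half_square by (simp add: power_int_minus)
      finally show ?thesis using True i by (simp add: cc)
    qed
  next
    fix h assume h: "h \<in> L2"
      and zero: "\<And>i. L2_inner h (dyadic_transform (\<lambda>x. complex_of_real c * indicator W x) i) = 0"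
    have "AE y in lebesgue. y \<in> W \<longrightarrow> h (dilate j y) = 0" for j
    proof (rule vanishing_coefficients_on_packing)
      show "W \<in> sets lebesgue" "packs translate W" using T by (auto simp: translation_tile_def)
      have "(\<lambda>y. h (dilate j y)) \<in> L2"
        using L2_affine[OF h, of "2 powi j" 0] by (simp add: dilate_def)
      then have "integrable lebesgue (\<lambda>y. h (dilate j y) * indicator W y)"
        by (rule L2_mult_integrable[OF _ indicator_complex_L2(1)[OF lm]])
      moreover have "(LINT y|lebesgue. h (dilate j y) * indicator W y * cis (of_int k * y)) = 0" for k
        using zero[of "(j, k)"] cc unfolding L2_inner_dyadic_transform_indicator by auto
      ultimately show "vanishing_coefficients (\<lambda>y. h (dilate j y) * indicator W y)"
        by (simp add: vanishing_coefficients_def)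
    qed
    then have "AE y in lebesgue. \<forall>j. y \<in> W \<longrightarrow> h (dilate j y) = 0"
      unfolding AE_all_countable by blast
    from AE_lebesgue_dilates[OF this]
    have all: "AE x in lebesgue. \<forall>k j. dilate k x \<in> W \<longrightarrow> h (dilate j (dilate k x)) = 0" .
    have "AE x in lebesgue. x \<in> saturation dilate W"
      using D by (simp add: dilation_tile_def covers_def)
    with all show "AE x in lebesgue. h x = 0"
    proof eventually_elim
      case (elim x)
      then obtain k where k: "dilate k x \<in> W" by (auto simp: saturation_def)
      have "dilate (- k) (dilate k x) = x" by (simp add: dilate_def power_int_minus)
      then show ?case using elim(1)[rule_format, of k "- k"] k by simp
    qed
  qed
  then show ?thesis
    unfolding wavelet_set_def c_def[symmetric] geq using W w by blast
qed

lemma lmeasurable_null_setsI: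
  assumes "S \<in> lmeasurable" "measure lebesgue S = 0"
  shows "S \<in> null_sets lebesgue"
  by (rule null_setsI) (use assms emeasure_eq_measure2[OF assms(1)] fmeasurableD[OF assms(1)] in \<open>simp_all only: ennreal_0\<close>)

text \<open>Orthogonality of different scales makes the dilates of \<open>W\<close> disjoint, and a bounded set missed by all
  of them is null by totality. If two translates of \<open>W\<close> overlapped, the difference of the indicators
  of a part of \<open>W\<close> and its translate inside \<open>W\<close> would be orthogonal to the system. Finally, orthogonality
  within one scale says that \<open>W\<close> and a multiple of a period have the same Fourier coefficients, so that
  \<open>W\<close> meets almost every translation class.\<close>

theorem tile_of_wavelet_set:
  assumes "wavelet_set W"
  shows "translation_tile W" and "dilation_tile W"
proof -
  have W: "W \<in> sets lebesgue" using assms by (simp add: wavelet_set_def)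
  define c where "c = 1 / sqrt (measure lebesgue W)"
  have geq: "(\<lambda>x. complex_of_real (c * indicator W x)) = (\<lambda>x. of_real c * indicator W x)"
    by (auto simp: indicator_def)
  let ?g = "dyadic_transform (\<lambda>x. complex_of_real c * indicator W x)"
  obtain w where w: "is_fourier_L2 w (\<lambda>x. complex_of_real c * indicator W x)" "orthonormal_wavelet w"
    using assms unfolding wavelet_set_def c_def[symmetric] geq by blast
  note orth = orthonormal_wavelet_transform_orthonormal[OF w]
  note total = orthonormal_wavelet_transform_total[OF w]
  note inner = L2_inner_dyadic_transform_indicator
  have c0: "c \<noteq> 0"
  proof
    assume "c = 0"
    then have "L2_inner (?g (0, 0)) (?g (0, 0)) = 0" by (simp add: L2_inner_def dyadic_transform_apply)
    then show False using orth[of "(0,0)" "(0,0)"] by simp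
  qed
  then have M: "measure lebesgue W > 0"
    using measure_nonneg[of lebesgue W] by (auto simp: c_def less_le)
  then have "emeasure lebesgue W \<noteq> \<infinity>" by (auto simp: measure_def)
  then have lm: "W \<in> lmeasurable" using W by (simp add: fmeasurable_def less_top)
  have base: "(LINT y|lebesgue. h (dilate j y) * indicator W y * cis (of_int k * y)) = 0"
    if "L2_inner h (?g (j, k)) = 0" for h j k
    using that c0 unfolding inner by auto
  have pd: "packs dilate W"
  proof (rule packs_dilateI)
    fix j :: int assume j: "j \<noteq> 0"
    have Wj: "{y. dilate j y \<in> W} \<in> sets lebesgue" using W by (rule dilate_measurable)
    have "L2_inner (?g (0, 0)) (?g (j, 0)) = 0" using orth j by simp
    from base[OF this]
    have prod: "(LINT y|lebesgue. complex_of_real c * (indicator W (dilate j y) * indicator W y)) = 0"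
      by (simp add: dyadic_transform_indicator dilate_def mult.assoc)
    have "(LINT y|lebesgue. of_real c * indicator ({y. dilate j y \<in> W} \<inter> W) y :: complex) = 0"
    proof -
      have "indicator ({y. dilate j y \<in> W} \<inter> W) y = (indicator W (dilate j y) * indicator W y :: complex)" for y
        by (simp add: indicator_def)
      then show ?thesis using prod by (simp only:)
    qed
    moreover have "(LINT y|lebesgue. of_real c * indicator ({y. dilate j y \<in> W} \<inter> W) y :: complex) =
        of_real (c * measure lebesgue ({y. dilate j y \<in> W} \<inter> W))"
    proof -
      have "(LINT y|lebesgue. of_real c * indicator ({y. dilate j y \<in> W} \<inter> W) y :: complex) =
        (LINT y|lebesgue. complex_of_real (c * indicator ({y. dilate j y \<in> W} \<inter> W) y))"
        by (intro Bochner_Integration.integral_cong refl) (auto simp: indicator_def)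
      also have "\<dots> = of_real (LINT y|lebesgue. c * indicator ({y. dilate j y \<in> W} \<inter> W) y)"
        by (rule integral_complex_of_real)
      finally show ?thesis by simp
    qed
    ultimately have "measure lebesgue ({y. dilate j y \<in> W} \<inter> W) = 0" using c0 by simp
    moreover have "{y. dilate j y \<in> W} \<inter> W \<in> lmeasurable"
      by (rule fmeasurable_Int_fmeasurable[OF lm Wj, unfolded Int_commute[of W]])
    ultimately have "{y. dilate j y \<in> W} \<inter> W \<in> null_sets lebesgue"
      by (intro lmeasurable_null_setsI)
    from AE_not_in[OF this] show "AE x in lebesgue. \<not> (x \<in> W \<and> dilate j x \<in> W)"
      by eventually_elim auto
  qed
  have cd: "covers dilate W"
  proof -
    define B where "B n = {- real n..real n} - saturation dilate W" for n
    have satm: "saturation dilate W \<in> sets lebesgue"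
      unfolding saturation_def Collect_ex_eq by (intro sets.countable_UN'' dilate_measurable W) auto
    have "AE x in lebesgue. x \<notin> B n" for n
    proof -
      have B: "B n \<in> lmeasurable"
        unfolding B_def using satm by (intro fmeasurable_Diff) auto
      have "AE x in lebesgue. (indicator (B n) x :: complex) = 0"
      proof (rule total[OF indicator_complex_L2[OF B]])
        fix i :: "int \<times> int"
        obtain j k where i: "i = (j, k)" by force
        have "indicator (B n) (dilate j y) * indicator W y = (0 :: complex)" for y
        proof -
          have "dilate (- j) (dilate j y) = y" by (simp add: dilate_def power_int_minus)
          then have "y \<in> W \<Longrightarrow> dilate j y \<in> saturation dilate W"
            unfolding saturation_def by (auto intro!: exI[of _ "- j"])
          then show ?thesis by (auto simp: B_def indicator_def)
        qed
        then show "L2_inner (indicator (B n)) (?g i) = 0"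
          unfolding i inner by (simp only: mult_zero_left mult_zero_right Bochner_Integration.integral_zero)
      qed
      then show ?thesis by eventually_elim (auto simp: indicator_def)
    qed
    then have "AE x in lebesgue. \<forall>n. x \<notin> B n" unfolding AE_all_countable by blast
    then show ?thesis unfolding covers_def
    proof eventually_elim
      case (elim x)
      obtain n where "\<bar>x\<bar> \<le> real n" using real_arch_simple by blast
      then show ?case using elim[rule_format, of n] by (auto simp: B_def)
    qed
  qed
  show "dilation_tile W" using W pd cd by (simp add: dilation_tile_def)
  have pt: "packs translate W"
  proof (rule packs_translateI)
    fix l :: int assume l: "l \<noteq> 0"
    \<comment> \<open>Confining the overlap to one period makes it disjoint from its translate.\<close>
    define B where "B m = {x \<in> W. translate l x \<in> W} \<inter> {2 * pi * of_int m..<2 * pi * of_int m + 2 * pi}" for m :: int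
    have "AE x in lebesgue. x \<notin> B m" for m
    proof -
      have tr: "translate l (translate (- l) x) = x" "translate (- l) (translate l x) = x" for x
        by (simp_all add: translate_def)
      have Bm: "B m \<in> lmeasurable"
      proof -
        have "B m = W \<inter> ({x. translate l x \<in> W} \<inter> {2 * pi * of_int m..<2 * pi * of_int m + 2 * pi})"
          by (auto simp: B_def)
        moreover have "{x. translate l x \<in> W} \<inter> {2 * pi * of_int m..<2 * pi * of_int m + 2 * pi} \<in> sets lebesgue"
          using translate_measurable[OF W] by (intro sets.Int) auto
        ultimately show ?thesis using fmeasurable_Int_fmeasurable[OF lm] by simp
      qed
      define B' where "B' = {x. translate (- l) x \<in> B m}"
      have sB': "B' \<in> sets lebesgue" unfolding B'_def using Bm by (intro translate_measurable) (auto simp: fmeasurable_def)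
      have B'W: "B' \<subseteq> W" unfolding B'_def B_def using tr(1) by auto
      have BW: "B m \<subseteq> W" by (auto simp: B_def)
      have B'm: "B' \<in> lmeasurable"
        using fmeasurable_Int_fmeasurable[OF lm sB'] B'W by (simp add: Int_absorb1)
      have disj: "B m \<inter> B' = {}"
      proof (rule ccontr)
        assume "B m \<inter> B' \<noteq> {}"
        then obtain x where "x \<in> B m" "translate (- l) x \<in> B m" by (auto simp: B'_def)
        then have "2 * pi * of_int m \<le> x" "x < 2 * pi * of_int m + 2 * pi"
            "2 * pi * of_int m \<le> x - 2 * pi * of_int l" "x - 2 * pi * of_int l < 2 * pi * of_int m + 2 * pi"
          by (auto simp: B_def translate_def)
        then have "2 * pi * of_int l < 2 * pi * 1" "2 * pi * (- 1) < 2 * pi * of_int l" by linarith+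
        then have "of_int l < (1 :: real)" "- 1 < (of_int l :: real)"
          by (auto simp only: mult_less_cancel_left_pos pi_gt_zero mult_pos_pos zero_less_numeral)
        then show False using l by linarith
      qed
      \<comment> \<open>The two pieces cancel in every Fourier coefficient because they differ by a period.\<close>
      define h where "h x = (indicator (B m) x - indicator B' x :: complex)" for x
      have hL2: "h \<in> L2" unfolding h_def[abs_def] by (intro L2_diff indicator_complex_L2 Bm B'm)
      have hint: "integrable lebesgue h"
        unfolding h_def[abs_def] by (intro Bochner_Integration.integrable_diff indicator_complex_L2 Bm B'm)
      have hW: "h x = h x * indicator W x" for x
        using BW B'W by (auto simp: h_def indicator_def)
      have "AE x in lebesgue. h x = 0"
      proof (rule total[OF hL2 hint])
        fix i :: "int \<times> int"
        obtain j k where i: "i = (j, k)" by force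
        have "(LINT y|lebesgue. h (dilate j y) * indicator W y * cis (of_int k * y)) = 0"
        proof (cases "j = 0")
          case False
          have "(LINT y|lebesgue. h (dilate j y) * indicator W (dilate j y) * indicator W y * cis (of_int k * y)) = 0"
            by (rule indicator_dilate_disjoint_integral[OF pd False])
          then show ?thesis by (simp only: hW[symmetric])
        next
          case True
          have shift: "(LINT y|lebesgue. indicator B' y * cis (of_int k * y)) =
              (LINT y|lebesgue. indicator (B m) y * cis (of_int k * y))"
          proof -
            have "(LINT y|lebesgue. indicator B' y * cis (of_int k * y)) =
              (LINT y|lebesgue. indicator B' (2 * pi * of_int l + 1 * y) * cis (of_int k * (2 * pi * of_int l + 1 * y)))"
              using lebesgue_integral_real_affine[of 1 "\<lambda>y. indicator B' y * cis (of_int k * y)" "2 * pi * of_int l"] by simp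
            also have "\<dots> = (LINT y|lebesgue. indicator (B m) y * cis (of_int k * y))"
            proof (rule Bochner_Integration.integral_cong[OF refl])
              fix y
              have "cis (of_int k * (2 * pi * of_int l + 1 * y)) = cis (2 * pi * of_int (k * l)) * cis (of_int k * y)"
                by (simp add: cis_mult algebra_simps)
              also have "cis (2 * pi * of_int (k * l)) = 1" by (rule cis_multiple_2pi) simp
              finally have "cis (of_int k * (2 * pi * of_int l + 1 * y)) = cis (of_int k * y)" by simp
              moreover have "2 * pi * of_int l + 1 * y \<in> B' \<longleftrightarrow> y \<in> B m"
                by (simp add: B'_def translate_def)
              ultimately show "indicator B' (2 * pi * of_int l + 1 * y) * cis (of_int k * (2 * pi * of_int l + 1 * y)) =
                indicator (B m) y * cis (of_int k * y)" by (simp add: indicator_def)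
            qed
            finally show ?thesis .
          qed
          have "dilate j y = y" for y using True by (simp add: dilate_def)
          then have "(LINT y|lebesgue. h (dilate j y) * indicator W y * cis (of_int k * y)) =
              (LINT y|lebesgue. h y * cis (of_int k * y))"
            by (simp only: hW[symmetric])
          also have "\<dots> = (LINT y|lebesgue. indicator (B m) y * cis (of_int k * y) - indicator B' y * cis (of_int k * y))"
            by (simp add: h_def left_diff_distrib)
          also have "\<dots> = 0"
            using integrable_indicator_mult_cis[OF Bm] integrable_indicator_mult_cis[OF B'm] shift by simp
          finally show ?thesis .
        qed
        then show "L2_inner h (?g i) = 0" unfolding i inner by simp
      qed
      then show ?thesis
      proof eventually_elim
        case (elim x)
        show ?case using elim disj by (auto simp: h_def indicator_def split: if_splits)
      qed
    qed
    then have "AE x in lebesgue. \<forall>m. x \<notin> B m" unfolding AE_all_countable by blast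
    then show "AE x in lebesgue. \<not> (x \<in> W \<and> translate l x \<in> W)"
    proof eventually_elim
      case (elim x)
      have "x \<in> {2 * pi * of_int \<lfloor>x / (2 * pi)\<rfloor>..<2 * pi * of_int \<lfloor>x / (2 * pi)\<rfloor> + 2 * pi}"
        using floor_divide_lower[of "2 * pi" x] floor_divide_upper[of "2 * pi" x] by (simp add: algebra_simps)
      then show ?case using elim[rule_format, of "\<lfloor>x / (2 * pi)\<rfloor>"] by (auto simp: B_def)
    qed
  qed
  have ct: "covers translate W"
  proof -
    let ?Q = "{0..<0 + 2 * pi} :: real set"
    have Qm: "?Q \<in> lmeasurable" by (rule translation_tile_lmeasurable[OF half_open_period_tile])
    define r where "r = measure lebesgue W / (2 * pi)"
    have "r > 0" using M by (simp add: r_def)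
    \<comment> \<open>The factor \<open>r\<close> makes the coefficient of index \<open>0\<close> vanish.\<close>
    define K where "K y = (indicator W y - of_real r * indicator ?Q y :: complex)" for y
    have K: "vanishing_coefficients K"
      unfolding vanishing_coefficients_def
    proof (intro conjI allI)
      show "integrable lebesgue K" unfolding K_def[abs_def]
        using indicator_complex_L2(2)[OF lm] indicator_complex_L2(2)[OF Qm] by simp
      fix k :: int
      have "(LINT y|lebesgue. K y * cis (of_int k * y)) =
        (LINT y|lebesgue. indicator W y * cis (of_int k * y) - of_real r * (indicator ?Q y * cis (of_int k * y)))"
        by (simp add: K_def left_diff_distrib mult.assoc)
      also have "\<dots> = (LINT y|lebesgue. indicator W y * cis (of_int k * y)) -
          of_real r * (LINT y|lebesgue. indicator ?Q y * cis (of_int k * y))"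
        using integrable_indicator_mult_cis[OF lm] integrable_indicator_mult_cis[OF Qm] by simp
      also have "(LINT y|lebesgue. indicator ?Q y * cis (of_int k * y)) = (if k = 0 then 2 * pi else 0)"
        by (rule translation_tile_integral_cis[OF half_open_period_tile])
      also have "(LINT y|lebesgue. indicator W y * cis (of_int k * y)) = (if k = 0 then of_real (measure lebesgue W) else 0)"
      proof (cases "k = 0")
        case True
        have "(LINT y|lebesgue. indicator W y * cis (of_int k * y)) = (LINT y|lebesgue. complex_of_real (indicator W y))"
          using True by (simp add: of_real_indicator)
        also have "\<dots> = of_real (measure lebesgue W)" by simp
        finally show ?thesis using True by simp
      next
        case False
        have "L2_inner (?g (0, 0)) (?g (0, k)) = 0" using orth False by simp
        from base[OF this]
        have int0: "(LINT y|lebesgue. ?g (0, 0) (dilate 0 y) * indicator W y * cis (of_int k * y)) = 0" .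
        have "?g (0, 0) (dilate 0 y) * indicator W y * cis (of_int k * y) =
            complex_of_real c * (indicator W y * cis (of_int k * y))" for y
          unfolding dyadic_transform_indicator by (auto simp: dilate_def indicator_def)
        with int0 have "(LINT y|lebesgue. complex_of_real c * (indicator W y * cis (of_int k * y))) = 0"
          by (simp only:)
        then show ?thesis using False c0 by simp
      qed
      finally show "(LINT y|lebesgue. K y * cis (of_int k * y)) = 0" by (simp add: r_def)
    qed
    define U where "U = - saturation translate W"
    have U: "U \<in> sets lebesgue"
      unfolding U_def by (intro Compl_in_sets_lebesgue[THEN iffD2] translation.saturation_measurable W)
    have "(LINT y|lebesgue. indicator U y * K y) = 0"
    proof (rule vanishing_coefficients_periodic_set[OF K U])
      show "y + 2 * pi * of_int k \<in> U \<longleftrightarrow> y \<in> U" for y k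
        using translation.saturation_invariant[of k y W] by (simp add: U_def translate_def)
    qed
    moreover have "indicator U y * K y = - of_real (r * indicator (?Q \<inter> U) y)" for y
    proof -
      have "y \<in> saturation translate W" if "y \<in> W"
        unfolding saturation_def using that by (auto intro!: exI[of _ 0] simp: translate_def)
      then show ?thesis by (auto simp: U_def K_def indicator_def)
    qed
    ultimately have "complex_of_real (LINT y|lebesgue. r * indicator (?Q \<inter> U) y) = 0"
      by (simp only: integral_complex_of_real[symmetric] Bochner_Integration.integral_minus neg_equal_0_iff_equal)
    then have "measure lebesgue (?Q \<inter> U) = 0" using \<open>r > 0\<close> by simp
    moreover have "?Q \<inter> U \<in> lmeasurable" by (rule fmeasurable_Int_fmeasurable[OF Qm U])
    ultimately have "?Q \<inter> U \<in> null_sets lebesgue"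
      by (intro lmeasurable_null_setsI)
    from AE_lebesgue_translates[OF AE_not_in[OF this]] show ?thesis
      unfolding covers_def
    proof eventually_elim
      case (elim x)
      obtain k where k: "translate k x \<in> ?Q" using half_open_period_representative[of x 0] by auto
      have "translate k x \<notin> ?Q \<inter> U" using elim[rule_format, of k] unfolding translate_def .
      then have "translate k x \<in> saturation translate W" using k by (auto simp: U_def)
      then show ?case by (simp only: translation.saturation_invariant)
    qed
  qed
  show "translation_tile W" using W pt ct by (simp add: translation_tile_def)
qed

section \<open>Completing a partial tile\<close>

lemma saturation_Un: "saturation \<phi> (A \<union> B) = saturation \<phi> A \<union> saturation \<phi> B"
  by (auto simp: saturation_def)

lemma saturation_mono: "A \<subseteq> B \<Longrightarrow> saturation \<phi> A \<subseteq> saturation \<phi> B"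
  by (auto simp: saturation_def)

lemma packs_subset: "packs \<phi> S \<Longrightarrow> A \<subseteq> S \<Longrightarrow> packs \<phi> A"
  unfolding packs_def by (erule eventually_mono) blast

context invariant_measure
begin

lemma subset_saturation: "A \<subseteq> saturation \<phi> A"
  unfolding saturation_def by (auto intro!: exI[of _ 0] simp: act_0)

lemma packs_Un:
  assumes "packs \<phi> A" "packs \<phi> B" and disj: "\<And>x. x \<in> B \<Longrightarrow> x \<notin> saturation \<phi> A"
  shows "packs \<phi> (A \<union> B)"
  using assms(1,2) unfolding packs_def
proof eventually_elim
  case (elim x)
  have no: "\<not> (\<phi> k x \<in> A \<and> \<phi> l x \<in> B)" for k l
  proof
    assume kl: "\<phi> k x \<in> A \<and> \<phi> l x \<in> B"
    then have "x \<in> saturation \<phi> A" by (auto simp: saturation_def)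
    then show False using disj[of "\<phi> l x"] kl by (simp add: saturation_invariant)
  qed
  show ?case using elim no by blast
qed

lemma covers_trans:
  assumes "covers \<phi> S" and "\<And>x. x \<in> S \<Longrightarrow> x \<in> saturation \<phi> W"
  shows "covers \<phi> W"
  using assms(1) unfolding covers_def
proof eventually_elim
  case (elim x)
  then obtain k where "\<phi> k x \<in> S" by (auto simp: saturation_def)
  then show ?case using assms(2)[of "\<phi> k x"] by (simp add: saturation_invariant)
qed

end

text \<open>If \<open>S\<close> is the chosen part of \<open>F\<close>, then \<open>G\<close> has to serve the dilation classes that neither \<open>A\<close> nor
  \<open>S\<close> meets, and \<open>F\<close> has to serve the remaining translation classes. A consistent choice is a fixed
  point of this monotone map.\<close>

definition far_step :: "real set \<Rightarrow> real set \<Rightarrow> real set \<Rightarrow> real set \<Rightarrow> real set" where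
  "far_step A F G S = F - saturation translate A - saturation translate (G - saturation dilate A - saturation dilate S)"

definition far_part :: "real set \<Rightarrow> real set \<Rightarrow> real set \<Rightarrow> real set" where
  "far_part A F G = (\<Union>n. (far_step A F G ^^ n) {})"

definition near_part :: "real set \<Rightarrow> real set \<Rightarrow> real set \<Rightarrow> real set" where
  "near_part A F G = G - saturation dilate A - saturation dilate (far_part A F G)"

definition completion_set :: "real set \<Rightarrow> real set \<Rightarrow> real set \<Rightarrow> real set" where
  "completion_set A F G = A \<union> far_part A F G \<union> near_part A F G"

text \<open>Each translation class meets \<open>G\<close> at most once, so whether a point of \<open>F\<close> is selected depends on a
  single point of \<open>G\<close>, hence on one dilation class; a point that is selected at all is selected after finitely many
  steps.\<close>

lemma far_part_fixpoint:
  assumes G: "\<And>x k l. translate k x \<in> G \<Longrightarrow> translate l x \<in> G \<Longrightarrow> k = l"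
  shows "far_part A F G = F - saturation translate A - saturation translate (near_part A F G)"
proof
  let ?S = "\<lambda>n. (far_step A F G ^^ n) {}"
  have mono: "?S n \<subseteq> far_part A F G" for n by (auto simp: far_part_def)
  show "far_part A F G \<subseteq> F - saturation translate A - saturation translate (near_part A F G)"
  proof
    fix x assume "x \<in> far_part A F G"
    then obtain n where n: "x \<in> ?S n" by (auto simp: far_part_def)
    then obtain m where "n = Suc m" by (cases n) auto
    then have "x \<in> far_step A F G (?S m)" using n by simp
    moreover have "near_part A F G \<subseteq> G - saturation dilate A - saturation dilate (?S m)"
      using saturation_mono[OF mono[of m], of dilate] by (auto simp: near_part_def)
    from saturation_mono[OF this, of translate]
    have "saturation translate (near_part A F G) \<subseteq> saturation translate (G - saturation dilate A - saturation dilate (?S m))" .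
    ultimately show "x \<in> F - saturation translate A - saturation translate (near_part A F G)"
      by (auto simp: far_step_def)
  qed
  show "F - saturation translate A - saturation translate (near_part A F G) \<subseteq> far_part A F G"
  proof
    fix x assume x: "x \<in> F - saturation translate A - saturation translate (near_part A F G)"
    have "\<exists>n. x \<in> far_step A F G (?S n)"
    proof (cases "\<exists>k. translate k x \<in> G - saturation dilate A")
      case True
      then obtain k where k: "translate k x \<in> G - saturation dilate A" by blast
      then have "translate k x \<in> saturation dilate (far_part A F G)"
        using x by (auto simp: saturation_def[of translate] near_part_def)
      then obtain j n where n: "dilate j (translate k x) \<in> ?S n" by (auto simp: saturation_def far_part_def)
      have "x \<notin> saturation translate (G - saturation dilate A - saturation dilate (?S n))"
      proof
        assume "x \<in> saturation translate (G - saturation dilate A - saturation dilate (?S n))"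
        then obtain l where l: "translate l x \<in> G" "translate l x \<notin> saturation dilate (?S n)"
          by (auto simp: saturation_def[of translate])
        then have "l = k" using G k by blast
        then show False using l(2) n by (auto simp: saturation_def)
      qed
      then show ?thesis using x by (auto simp: far_step_def)
    next
      case False
      then show ?thesis using x by (auto simp: far_step_def saturation_def[of translate])
    qed
    then obtain n where "x \<in> ?S (Suc n)" by auto
    then show "x \<in> far_part A F G" using mono by blast
  qed
qed

text \<open>The two comparisons between the measures, away from \<open>0\<close> here and on bounded sets in the next lemma,
  carry all transfers between the translation and the dilation side.\<close>

lemma emeasure_log_measure_le:
  assumes S: "S \<in> sets lebesgue" and C: "\<And>x. x \<in> S \<Longrightarrow> 1 / \<bar>x\<bar> \<le> C"
  shows "emeasure log_measure S \<le> ennreal C * emeasure lebesgue S"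
proof -
  have "emeasure log_measure S \<le> (\<integral>\<^sup>+x. ennreal C * indicator S x \<partial>lebesgue)"
    unfolding emeasure_log_measure[OF S]
    by (intro nn_integral_mono) (auto simp: indicator_def intro!: ennreal_leI C)
  also have "\<dots> = ennreal C * emeasure lebesgue S" using S by (simp add: nn_integral_cmult_indicator)
  finally show ?thesis .
qed

lemma emeasure_lebesgue_le:
  assumes S: "S \<in> sets lebesgue" and C: "\<And>x. x \<in> S \<Longrightarrow> \<bar>x\<bar> \<le> C"
  shows "emeasure lebesgue S \<le> ennreal C * emeasure log_measure S"
proof -
  have "AE x in lebesgue. x \<notin> {0 :: real}"
    by (intro AE_not_in null_sets_completionI) (simp add: null_sets_def)
  have "emeasure lebesgue S = (\<integral>\<^sup>+x. indicator S x \<partial>lebesgue)" using S by simp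
  also have "\<dots> \<le> (\<integral>\<^sup>+x. ennreal C * (ennreal (1 / \<bar>x\<bar>) * indicator S x) \<partial>lebesgue)"
  proof (rule nn_integral_mono_AE, use \<open>AE x in lebesgue. x \<notin> {0}\<close> in eventually_elim)
    case (elim x)
    show ?case
    proof (cases "x \<in> S")
      case True
      then have "1 \<le> C * (1 / \<bar>x\<bar>)" using C[OF True] elim by (simp add: field_simps)
      moreover have "0 \<le> C" using C[OF True] by linarith
      ultimately have "1 \<le> ennreal C * ennreal (1 / \<bar>x\<bar>)" by (simp flip: ennreal_mult)
      then show ?thesis using True by simp
    qed simp
  qed
  also have "\<dots> = ennreal C * emeasure log_measure S"
    unfolding emeasure_log_measure[OF S]
    using S inverse_abs_measurable by (intro nn_integral_cmult) simp
  finally show ?thesis .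
qed

text \<open>A partial tile \<open>A\<close> together with a reservoir \<open>F\<close> far from \<open>0\<close> that can serve every translation class
  and a reservoir \<open>G\<close> near \<open>0\<close> that can serve every dilation class. The classes used by \<open>F\<close> on the
  dilation side and by \<open>G\<close> on the translation side are not used by \<open>A\<close>.\<close>

locale completion_data =
  fixes A F G :: "real set"
  assumes A: "A \<in> sets lebesgue" "packs translate A" "packs dilate A"
    and F: "translation_tile F" "packs dilate F"
    and G: "dilation_tile G"
    and G_packs: "\<And>x k l. translate k x \<in> G \<Longrightarrow> translate l x \<in> G \<Longrightarrow> k = l"
    and AG: "\<And>x. x \<in> G \<Longrightarrow> x \<notin> saturation translate A"
    and AF: "\<And>x. x \<in> F \<Longrightarrow> x \<notin> saturation dilate A"
    and F_far: "\<And>x. x \<in> F \<Longrightarrow> 2 \<le> \<bar>x\<bar>"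
    and G_near: "\<And>x. x \<in> G \<Longrightarrow> \<bar>x\<bar> \<le> 1"
begin

abbreviation "F' \<equiv> far_part A F G"
abbreviation "G' \<equiv> near_part A F G"

lemma measurable_data: "F \<in> sets lebesgue" "G \<in> sets lebesgue" "F' \<in> sets lebesgue" "G' \<in> sets lebesgue"
proof -
  show F0: "F \<in> sets lebesgue" using F by (simp add: translation_tile_def)
  show G0: "G \<in> sets lebesgue" using G by (simp add: dilation_tile_def)
  have "(far_step A F G ^^ n) {} \<in> sets lebesgue" for n
  proof (induction n)
    case (Suc n)
    then show ?case
      unfolding funpow.simps comp_def far_step_def[of A F G "(far_step A F G ^^ n) {}"]
      by (intro sets.Diff F0 G0 A(1) translation.saturation_measurable dilation.saturation_measurable)
  qed simp
  then show F'0: "F' \<in> sets lebesgue" unfolding far_part_def by (intro sets.countable_UN) auto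
  show "G' \<in> sets lebesgue" unfolding near_part_def
    by (intro sets.Diff G0 A(1) F'0 dilation.saturation_measurable)
qed

lemma far_eq: "F' = F - saturation translate A - saturation translate G'"
  by (rule far_part_fixpoint[OF G_packs])

lemma near_eq: "G' = G - saturation dilate A - saturation dilate F'"
  by (rule near_part_def)

lemma completion_tile:
  "translation_tile (completion_set A F G)" "dilation_tile (completion_set A F G)"
proof -
  have W: "completion_set A F G \<in> sets lebesgue"
    unfolding completion_set_def using A measurable_data by auto
  have sub: "F' \<subseteq> F" "G' \<subseteq> G" using far_eq near_eq by auto
  have "packs translate G" unfolding packs_def using G_packs by (intro AE_I2) blast
  then have "packs translate (A \<union> G')"
    using sub(2) AG by (intro translation.packs_Un[OF A(2) packs_subset]) blast+
  moreover have "packs translate F'"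
    by (rule packs_subset[OF _ sub(1)]) (use F in \<open>simp add: translation_tile_def\<close>)
  ultimately have "packs translate ((A \<union> G') \<union> F')"
  proof (rule translation.packs_Un)
    show "x \<notin> saturation translate (A \<union> G')" if "x \<in> F'" for x
      using that unfolding saturation_Un by (subst (asm) far_eq) blast
  qed
  moreover have "covers translate (completion_set A F G)"
  proof (rule translation.covers_trans)
    show "covers translate F" using F by (simp add: translation_tile_def)
    show "x \<in> saturation translate (completion_set A F G)" if "x \<in> F" for x
      using that far_eq translation.subset_saturation[of F'] unfolding completion_set_def saturation_Un by blast
  qed
  ultimately show "translation_tile (completion_set A F G)"
    using W by (simp add: translation_tile_def completion_set_def Un_ac)
  have "packs dilate (A \<union> F')"
    using sub(1) AF by (intro dilation.packs_Un[OF A(3) packs_subset[OF F(2)]]) blast+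
  moreover have "packs dilate G'"
    by (rule packs_subset[OF _ sub(2)]) (use G in \<open>simp add: dilation_tile_def\<close>)
  ultimately have "packs dilate ((A \<union> F') \<union> G')"
  proof (rule dilation.packs_Un)
    show "x \<notin> saturation dilate (A \<union> F')" if "x \<in> G'" for x
      using that unfolding saturation_Un by (subst (asm) near_eq) blast
  qed
  moreover have "covers dilate (completion_set A F G)"
  proof (rule dilation.covers_trans)
    show "covers dilate G" using G by (simp add: dilation_tile_def)
    show "x \<in> saturation dilate (completion_set A F G)" if "x \<in> G" for x
      using that near_eq dilation.subset_saturation[of G'] unfolding completion_set_def saturation_Un by blast
  qed
  ultimately show "dilation_tile (completion_set A F G)"
    using W by (simp add: dilation_tile_def completion_set_def Un_ac)
qed

end

lemma log_measure_far:
  assumes "S \<in> sets lebesgue" "\<And>x. x \<in> S \<Longrightarrow> 2 \<le> \<bar>x\<bar>"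
  shows "emeasure log_measure S \<le> ennreal (1 / 2) * emeasure lebesgue S"
proof (rule emeasure_log_measure_le)
  show "1 / \<bar>x\<bar> \<le> 1 / 2" if "x \<in> S" for x
    using assms(2)[OF that] by (intro divide_left_mono) auto
qed fact

lemma log_measure_near:
  assumes "S \<in> sets lebesgue" "\<And>x. x \<in> S \<Longrightarrow> \<bar>x\<bar> \<le> 1"
  shows "emeasure lebesgue S \<le> emeasure log_measure S"
  using emeasure_lebesgue_le[OF assms] by simp

lemma emeasure_le_of_subset_Un:
  assumes "S \<subseteq> X \<union> Y" "X \<in> sets m" "Y \<in> sets m"
  shows "emeasure m S \<le> emeasure m X + emeasure m Y"
proof -
  have "emeasure m S \<le> emeasure m (X \<union> Y)" using assms by (intro emeasure_mono) auto
  also have "\<dots> \<le> emeasure m X + emeasure m Y" using assms by (intro emeasure_subadditive)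
  finally show ?thesis .
qed

text \<open>The second inequality feeds back only half of \<open>\<alpha>\<close>. Finiteness of \<open>\<alpha>\<close> excludes the solution \<open>\<infinity>\<close>.\<close>

lemma ennreal_contraction:
  fixes \<alpha> \<beta> a b :: ennreal
  assumes "\<alpha> < \<infinity>" "\<alpha> \<le> a + \<beta>" "\<beta> \<le> b + ennreal (1 / 2) * \<alpha>"
  shows "\<alpha> \<le> 2 * (a + b)" and "\<beta> \<le> 2 * (a + b)"
proof -
  have "\<alpha> \<le> 2 * (a + b) \<and> \<beta> \<le> 2 * (a + b)"
  proof (cases "a = \<infinity> \<or> b = \<infinity>")
    case True
    then have "2 * (a + b) = \<infinity>" by (auto simp: ennreal_mult_eq_top_iff)
    then show ?thesis unfolding infinity_ennreal_def by (simp only: top_greatest)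
  next
    case False
    then obtain x y z where xyz: "a = ennreal x" "0 \<le> x" "b = ennreal y" "0 \<le> y" "\<alpha> = ennreal z" "0 \<le> z"
      using assms(1) by (metis ennreal_cases infinity_ennreal_def less_irrefl)
    have bz: "\<beta> \<le> ennreal (y + z / 2)"
    proof -
      have "ennreal (1 / 2) * ennreal z = ennreal (1 / 2 * z)"
        by (rule ennreal_mult[symmetric]) (use xyz in auto)
      moreover have "ennreal y + ennreal (1 / 2 * z) = ennreal (y + 1 / 2 * z)"
        by (rule ennreal_plus[symmetric]) (use xyz in auto)
      ultimately have "b + ennreal (1 / 2) * \<alpha> = ennreal (y + 1 / 2 * z)" by (simp only: xyz)
      then show ?thesis using assms(3) by simp
    qed
    have "ennreal z \<le> ennreal x + ennreal (y + z / 2)"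
      using order_trans[OF assms(2) add_left_mono[OF bz]] xyz by simp
    also have "\<dots> = ennreal (x + (y + z / 2))" by (rule ennreal_plus[symmetric]) (use xyz in auto)
    finally have "z \<le> x + (y + z / 2)" using xyz by (subst (asm) ennreal_le_iff) auto
    then have "z \<le> 2 * (x + y)" "y + z / 2 \<le> 2 * (x + y)" using xyz by auto
    moreover have "2 * (a + b) = ennreal (2 * (x + y))"
      using xyz by (simp add: ennreal_mult ennreal_plus)
    ultimately show ?thesis
      unfolding xyz(5) by (simp only:) (intro conjI order_trans[OF bz] ennreal_leI)
  qed
  then show "\<alpha> \<le> 2 * (a + b)" "\<beta> \<le> 2 * (a + b)" by auto
qed

section \<open>Continuity of the completion\<close>

lemma ennreal_half_mult_le: "ennreal (1 / 2) * a \<le> a"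
proof -
  have "(1 / 2 :: real) \<le> 1" by simp
  from ennreal_leI[OF this] have "ennreal (1 / 2) \<le> 1" unfolding ennreal_1 .
  from mult_right_mono[OF this zero_le, of a] show ?thesis by (simp only: mult_1_left)
qed

text \<open>Write \<open>\<alpha>\<close> for the Lebesgue measure of the change of the far parts and \<open>\<beta>\<close> for the
  dilation-invariant measure of the change of the near parts. A point of \<open>F \<inter> F2\<close> is selected
  differently only if its translation class meets the change of \<open>A\<close> or of the near part, and
  similarly on the dilation side. With \<open>F\<close> far from \<open>0\<close> and \<open>G\<close> near \<open>0\<close> this gives
  \<open>\<alpha> \<le> a + \<beta>\<close> and \<open>\<beta> \<le> b + \<alpha> / 2\<close>.\<close>

lemma completion_set_sym_diff_le:
  assumes D1: "completion_data A F G" and D2: "completion_data A2 F2 G2"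
  defines "E \<equiv> emeasure lebesgue (sym_diff F F2) + emeasure lebesgue (sym_diff A A2) +
    (emeasure log_measure (sym_diff G G2) + emeasure log_measure (sym_diff A A2))"
  shows "emeasure lebesgue (sym_diff (completion_set A F G) (completion_set A2 F2 G2)) \<le> 5 * E"
    and "emeasure log_measure (sym_diff (completion_set A F G) (completion_set A2 F2 G2)) \<le> 5 * E"
proof -
  interpret D1: completion_data A F G by fact
  interpret D2: completion_data A2 F2 G2 by fact
  note meas = D1.A(1) D2.A(1) D1.measurable_data D2.measurable_data
  let ?F = "sym_diff D1.F' D2.F'" and ?G = "sym_diff D1.G' D2.G'"
  have Fm: "?F \<in> sets lebesgue" and Gm: "?G \<in> sets lebesgue" and Am: "sym_diff A A2 \<in> sets lebesgue"
    and F0m: "sym_diff F F2 \<in> sets lebesgue" and G0m: "sym_diff G G2 \<in> sets lebesgue"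
    using meas by auto
  define \<alpha> where "\<alpha> = emeasure lebesgue ?F"
  define \<beta> where "\<beta> = emeasure log_measure ?G"
  have F_far: "2 \<le> \<bar>x\<bar>" if "x \<in> ?F" for x
    using that D1.F_far[of x] D2.F_far[of x] D1.far_eq D2.far_eq by blast
  have G_near: "\<bar>x\<bar> \<le> 1" if "x \<in> ?G" for x
    using that D1.G_near[of x] D2.G_near[of x] D1.near_eq D2.near_eq by blast
  have \<nu>F: "emeasure log_measure ?F \<le> ennreal (1 / 2) * \<alpha>"
    unfolding \<alpha>_def by (rule log_measure_far[OF Fm F_far])
  have \<mu>G: "emeasure lebesgue ?G \<le> \<beta>"
    unfolding \<beta>_def by (rule log_measure_near[OF Gm G_near])
  have subF: "?F \<subseteq> sym_diff F F2 \<union> (F \<inter> saturation translate (sym_diff A A2 \<union> ?G))"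
  proof
    fix x assume x: "x \<in> ?F"
    show "x \<in> sym_diff F F2 \<union> (F \<inter> saturation translate (sym_diff A A2 \<union> ?G))"
      using x D1.far_eq D2.far_eq unfolding saturation_def by blast
  qed
  have subG: "?G \<subseteq> sym_diff G G2 \<union> (G \<inter> saturation dilate (sym_diff A A2 \<union> ?F))"
  proof
    fix x assume x: "x \<in> ?G"
    show "x \<in> sym_diff G G2 \<union> (G \<inter> saturation dilate (sym_diff A A2 \<union> ?F))"
      using x D1.near_eq D2.near_eq unfolding saturation_def by blast
  qed
  have pF: "packs translate F" using D1.F by (simp add: translation_tile_def)
  have pG: "packs dilate G" using D1.G by (simp add: dilation_tile_def)
  define a where "a = emeasure lebesgue (sym_diff F F2) + emeasure lebesgue (sym_diff A A2)"
  define b where "b = emeasure log_measure (sym_diff G G2) + emeasure log_measure (sym_diff A A2)"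
  have sT: "saturation translate (sym_diff A A2 \<union> ?G) \<in> sets lebesgue"
    and sD: "saturation dilate (sym_diff A A2 \<union> ?F) \<in> sets lebesgue"
    using Am Fm Gm by (auto intro!: translation.saturation_measurable dilation.saturation_measurable)
  have "\<alpha> \<le> emeasure lebesgue (sym_diff F F2) + emeasure lebesgue (F \<inter> saturation translate (sym_diff A A2 \<union> ?G))"
    unfolding \<alpha>_def using subF F0m sT meas by (intro emeasure_le_of_subset_Un) auto
  also have "emeasure lebesgue (F \<inter> saturation translate (sym_diff A A2 \<union> ?G)) \<le> emeasure lebesgue (sym_diff A A2 \<union> ?G)"
    using Am Gm by (intro translation.emeasure_Int_saturation_le[OF meas(3) pF]) auto
  also have "emeasure lebesgue (sym_diff A A2 \<union> ?G) \<le> emeasure lebesgue (sym_diff A A2) + emeasure lebesgue ?G"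
    using Am Gm by (rule emeasure_subadditive)
  finally have "\<alpha> \<le> emeasure lebesgue (sym_diff F F2) + (emeasure lebesgue (sym_diff A A2) + emeasure lebesgue ?G)"
    by (simp add: add_left_mono)
  from order_trans[OF this add_left_mono[OF add_left_mono[OF \<mu>G]]]
  have \<alpha>: "\<alpha> \<le> a + \<beta>" by (simp only: a_def add.assoc)
  have "\<beta> \<le> emeasure log_measure (sym_diff G G2) + emeasure log_measure (G \<inter> saturation dilate (sym_diff A A2 \<union> ?F))"
    unfolding \<beta>_def using subG G0m sD meas by (intro emeasure_le_of_subset_Un) auto
  also have "emeasure log_measure (G \<inter> saturation dilate (sym_diff A A2 \<union> ?F)) \<le> emeasure log_measure (sym_diff A A2 \<union> ?F)"
    using Am Fm by (intro dilation.emeasure_Int_saturation_le[OF meas(4) pG]) auto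
  also have "emeasure log_measure (sym_diff A A2 \<union> ?F) \<le> emeasure log_measure (sym_diff A A2) + emeasure log_measure ?F"
    using Am Fm by (intro emeasure_subadditive) auto
  finally have "\<beta> \<le> emeasure log_measure (sym_diff G G2) + (emeasure log_measure (sym_diff A A2) + emeasure log_measure ?F)"
    by (simp add: add_left_mono)
  from order_trans[OF this add_left_mono[OF add_left_mono[OF \<nu>F]]]
  have \<beta>: "\<beta> \<le> b + ennreal (1 / 2) * \<alpha>" by (simp only: b_def add.assoc)
  have fin: "\<alpha> < \<infinity>"
  proof -
    have "\<alpha> \<le> emeasure lebesgue F + emeasure lebesgue F2"
      unfolding \<alpha>_def using D1.far_eq D2.far_eq meas by (intro emeasure_le_of_subset_Un) auto
    also have "\<dots> < \<infinity>" using D1.F(1) D2.F(1) by (simp add: translation_tile_emeasure)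
    finally show ?thesis .
  qed
  note bound = ennreal_contraction[OF fin \<alpha> \<beta>]
  have E: "E = a + b" by (simp add: E_def a_def b_def)
  have sub: "sym_diff (completion_set A F G) (completion_set A2 F2 G2) \<subseteq> sym_diff A A2 \<union> (?F \<union> ?G)"
    unfolding completion_set_def by blast
  have five: "x \<le> 5 * E" if "x \<le> c + (\<alpha>' + \<beta>')" "c \<le> E" "\<alpha>' \<le> 2 * E" "\<beta>' \<le> 2 * E" for x c \<alpha>' \<beta>' :: ennreal
  proof -
    have "x \<le> E + (2 * E + 2 * E)" using that by (meson add_mono order_trans)
    also have "\<dots> = (1 + (2 + 2)) * E" by (simp only: distrib_right mult_1_left)
    also have "(1 + (2 + 2)) * E = 5 * E" by simp
    finally show ?thesis .
  qed
  have split: "emeasure m (sym_diff (completion_set A F G) (completion_set A2 F2 G2)) \<le>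
      emeasure m (sym_diff A A2) + (emeasure m ?F + emeasure m ?G)" if "sets m = sets lebesgue" for m
    using sub Am Fm Gm that
    by (intro order_trans[OF emeasure_le_of_subset_Un[OF sub] add_left_mono[OF emeasure_subadditive]]) auto
  show "emeasure lebesgue (sym_diff (completion_set A F G) (completion_set A2 F2 G2)) \<le> 5 * E"
  proof (rule five[OF split[OF refl]])
    show "emeasure lebesgue (sym_diff A A2) \<le> E" unfolding E_def by (simp add: add_increasing add_increasing2)
    show "emeasure lebesgue ?F \<le> 2 * E" using bound(1) unfolding E \<alpha>_def .
    show "emeasure lebesgue ?G \<le> 2 * E" using order_trans[OF \<mu>G bound(2)] unfolding E .
  qed
  have half: "ennreal (1 / 2) * \<alpha> \<le> \<alpha>"
    by (rule ennreal_half_mult_le)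
  show "emeasure log_measure (sym_diff (completion_set A F G) (completion_set A2 F2 G2)) \<le> 5 * E"
  proof (rule five[OF split[OF sets_log_measure]])
    show "emeasure log_measure (sym_diff A A2) \<le> E" unfolding E_def by (simp add: add_increasing add_increasing2)
    show "emeasure log_measure ?F \<le> 2 * E" using order_trans[OF order_trans[OF \<nu>F half] bound(1)] unfolding E .
    show "emeasure log_measure ?G \<le> 2 * E" using bound(2) unfolding E \<beta>_def .
  qed
qed

text \<open>The translation classes served by the far part, and the dilation classes served by the near part,
  are those that \<open>W - A\<close> served before.\<close>

lemma completion_set_sym_diff_base_le:
  assumes D: "completion_data A F G" and T: "translation_tile W" and Dl: "dilation_tile W" and AW: "A \<subseteq> W"
  defines "E \<equiv> emeasure lebesgue (W - A) + emeasure log_measure (W - A)"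
  shows "emeasure lebesgue (sym_diff (completion_set A F G) W) \<le> 2 * E"
    and "emeasure log_measure (sym_diff (completion_set A F G) W) \<le> 2 * E"
proof -
  interpret D: completion_data A F G by fact
  have W: "W \<in> sets lebesgue" using T by (simp add: translation_tile_def)
  note meas = D.A(1) D.measurable_data W
  have WA: "W - A \<in> sets lebesgue" using meas by auto
  have pF: "packs translate F" using D.F by (simp add: translation_tile_def)
  have pG: "packs dilate G" using D.G by (simp add: dilation_tile_def)
  have satW: "saturation \<phi> W = saturation \<phi> A \<union> saturation \<phi> (W - A)" for \<phi>
    using AW unfolding saturation_Un[symmetric] by (simp add: Un_absorb1)
  have \<mu>F: "emeasure lebesgue D.F' \<le> emeasure lebesgue (W - A)"
  proof -
    have "emeasure lebesgue D.F' \<le> emeasure lebesgue (F \<inter> saturation translate (W - A))"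
    proof (rule emeasure_mono_AE)
      have "AE x in lebesgue. x \<in> saturation translate W" using T by (simp add: translation_tile_def covers_def)
      then show "AE x in lebesgue. x \<in> D.F' \<longrightarrow> x \<in> F \<inter> saturation translate (W - A)"
        by eventually_elim (use D.far_eq satW[of translate] in blast)
      show "F \<inter> saturation translate (W - A) \<in> sets lebesgue"
        using meas WA by (intro sets.Int translation.saturation_measurable) auto
    qed
    also have "\<dots> \<le> emeasure lebesgue (W - A)"
      by (rule translation.emeasure_Int_saturation_le[OF meas(2) pF WA])
    finally show ?thesis .
  qed
  have \<nu>G: "emeasure log_measure D.G' \<le> emeasure log_measure (W - A)"
  proof -
    have "emeasure log_measure D.G' \<le> emeasure log_measure (G \<inter> saturation dilate (W - A))"
    proof (rule emeasure_mono_AE)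
      have "AE x in log_measure. x \<in> saturation dilate W"
        using Dl by (intro dilation.AE_m) (simp add: dilation_tile_def covers_def)
      then show "AE x in log_measure. x \<in> D.G' \<longrightarrow> x \<in> G \<inter> saturation dilate (W - A)"
        by eventually_elim (use D.near_eq satW[of dilate] in blast)
      show "G \<inter> saturation dilate (W - A) \<in> sets log_measure"
        using meas WA by (simp add: sets.Int dilation.saturation_measurable)
    qed
    also have "\<dots> \<le> emeasure log_measure (W - A)"
      by (rule dilation.emeasure_Int_saturation_le[OF meas(3) pG WA])
    finally show ?thesis .
  qed
  have sub: "D.F' \<subseteq> F" "D.G' \<subseteq> G" using D.far_eq D.near_eq by auto
  have \<nu>F: "emeasure log_measure D.F' \<le> emeasure lebesgue (W - A)"
  proof -
    have "emeasure log_measure D.F' \<le> ennreal (1 / 2) * emeasure lebesgue D.F'"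
      using sub D.F_far by (intro log_measure_far meas) auto
    also have "\<dots> \<le> emeasure lebesgue D.F'" by (rule ennreal_half_mult_le)
    finally show ?thesis using \<mu>F by simp
  qed
  have \<mu>G: "emeasure lebesgue D.G' \<le> emeasure log_measure (W - A)"
    using sub D.G_near by (intro order_trans[OF log_measure_near \<nu>G] meas) auto
  have subd: "sym_diff (completion_set A F G) W \<subseteq> (W - A) \<union> (D.F' \<union> D.G')"
    using AW unfolding completion_set_def by blast
  have split: "emeasure m (sym_diff (completion_set A F G) W) \<le>
      emeasure m (W - A) + (emeasure m D.F' + emeasure m D.G')" if "sets m = sets lebesgue" for m
    using WA meas that
    by (intro order_trans[OF emeasure_le_of_subset_Un[OF subd] add_left_mono[OF emeasure_subadditive]]) auto
  have two: "x \<le> 2 * E" if "x \<le> c + (emeasure lebesgue (W - A) + emeasure log_measure (W - A))" "c \<le> E" for x c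
    using order_trans[OF that(1) add_right_mono[OF that(2)]] by (simp only: E_def mult_2)
  show "emeasure lebesgue (sym_diff (completion_set A F G) W) \<le> 2 * E"
    by (rule two[OF order_trans[OF split[OF refl] add_left_mono[OF add_mono[OF \<mu>F \<mu>G]]]]) (simp add: E_def)
  show "emeasure log_measure (sym_diff (completion_set A F G) W) \<le> 2 * E"
    by (rule two[OF order_trans[OF split[OF sets_log_measure] add_left_mono[OF add_mono[OF \<nu>F \<nu>G]]]]) (simp add: E_def)
qed

text \<open>The constants in this and the next definitions make, for \<open>0 < u \<le> 4\<close>, the window lie in
  \<open>x \<ge> 8 \<ge> 2 * pi\<close>, so that it is shorter than the distance of its left end from \<open>0\<close>, and the shell lie
  in \<open>\<bar>x\<bar> < 1\<close> and in \<open>(- u, u)\<close>.\<close>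

definition far_window :: "real \<Rightarrow> real set" where
  "far_window u = {32 / u..<32 / u + 2 * pi}"

definition symmetric_interval :: "real \<Rightarrow> real set" where
  "symmetric_interval r = {x. \<bar>x\<bar> < r}"

definition near_shell :: "real \<Rightarrow> real set" where
  "near_shell u = {x. u / 8 \<le> \<bar>x\<bar> \<and> \<bar>x\<bar> < u / 4}"

definition trimmed :: "real set \<Rightarrow> real \<Rightarrow> real set" where
  "trimmed W u = W - saturation translate (symmetric_interval u) - saturation dilate (far_window u)"

text \<open>A further doubling leaves the shell.\<close>

lemma dilate_dyadic_unique:
  assumes "b > 0" "b \<le> \<bar>dilate k x\<bar>" "\<bar>dilate k x\<bar> < 2 * b" "b \<le> \<bar>dilate l x\<bar>" "\<bar>dilate l x\<bar> < 2 * b"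
  shows "k = l"
proof -
  have "\<not> i < j" if "b \<le> \<bar>dilate i x\<bar>" "\<bar>dilate j x\<bar> < 2 * b" for i j
  proof
    assume "i < j"
    then have "(2 :: real) powi (i + 1) \<le> 2 powi j" by (intro power_int_increasing) auto
    then have "2 * (2 powi i * \<bar>x\<bar>) \<le> 2 powi j * \<bar>x\<bar>"
      using mult_right_mono[of "2 powi (i + 1)" "2 powi j" "\<bar>x\<bar>"] by (simp add: power_int_add mult_ac)
    then show False using that by (simp add: dilate_def abs_mult)
  qed
  then show ?thesis using assms by (meson linorder_neqE)
qed

lemma dilate_dyadic_exists:
  assumes "b > 0" "x \<noteq> 0"
  shows "\<exists>k. b \<le> \<bar>dilate k x\<bar> \<and> \<bar>dilate k x\<bar> < 2 * b"
proof -
  define k where "k = \<lceil>log 2 (b / \<bar>x\<bar>)\<rceil>"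
  have k: "log 2 (b / \<bar>x\<bar>) \<le> of_int k" "of_int k < log 2 (b / \<bar>x\<bar>) + 1" unfolding k_def by linarith+
  have pos: "b / \<bar>x\<bar> > 0" using assms by simp
  have "b / \<bar>x\<bar> \<le> 2 powr of_int k" using k(1) pos by (simp add: log_le_iff)
  moreover have "2 powr of_int k < 2 * (b / \<bar>x\<bar>)"
  proof -
    have "2 powr of_int k < 2 powr (log 2 (b / \<bar>x\<bar>) + 1)" using k(2) by simp
    also have "\<dots> = 2 * (b / \<bar>x\<bar>)" using pos by (simp add: powr_add)
    finally show ?thesis .
  qed
  ultimately have "b / \<bar>x\<bar> \<le> 2 powi k" "2 powi k < 2 * (b / \<bar>x\<bar>)" by (simp_all add: powr_real_of_int')
  then have "b \<le> 2 powi k * \<bar>x\<bar>" "2 powi k * \<bar>x\<bar> < 2 * b" using assms by (simp_all add: field_simps)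
  then show ?thesis by (intro exI[of _ k]) (simp add: dilate_def abs_mult)
qed

lemma far_window_tile: "translation_tile (far_window u)"
  unfolding far_window_def by (rule half_open_period_tile)

lemma far_window_bounds:
  assumes u: "0 < u" "u \<le> 4" and x: "x \<in> far_window u"
  shows "8 \<le> x" "32 / u \<le> x" "x < 2 * (32 / u)"
proof -
  have "8 \<le> 32 / u" using u by (simp add: field_simps)
  then show "8 \<le> x" "32 / u \<le> x" "x < 2 * (32 / u)"
    using x pi_less_4 by (auto simp: far_window_def)
qed

lemma near_shell_tile:
  assumes "u > 0"
  shows "dilation_tile (near_shell u)"
  unfolding dilation_tile_def
proof (intro conjI)
  show "near_shell u \<in> sets lebesgue"
  proof (rule sets_completionI_sets)
    show "near_shell u \<in> sets lborel" unfolding near_shell_def by measurable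
  qed
  show "packs dilate (near_shell u)"
    unfolding packs_def using dilate_dyadic_unique[of "u / 8"] assms by (intro AE_I2) (auto simp: near_shell_def)
  have "AE x in lebesgue. x \<notin> {0 :: real}"
    by (intro AE_not_in null_sets_completionI) (simp add: null_sets_def)
  then show "covers dilate (near_shell u)"
    unfolding covers_def
  proof eventually_elim
    case (elim x)
    then show ?case using dilate_dyadic_exists[of "u / 8" x] assms by (auto simp: near_shell_def saturation_def)
  qed
qed

lemma symmetric_interval_measurable: "symmetric_interval r \<in> sets lebesgue"
proof (rule sets_completionI_sets)
  show "symmetric_interval r \<in> sets lborel" unfolding symmetric_interval_def by measurable
qed

text \<open>The window fits between \<open>32 / u\<close> and its double, so it meets no dilation class twice; the shell has
  diameter less than \<open>2 * pi\<close>, so it meets no translation class twice.\<close>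

lemma trimmed_completion_data:
  assumes u: "0 < u" "u \<le> 4" and T: "translation_tile W" and D: "dilation_tile W"
  shows "completion_data (trimmed W u) (far_window u) (near_shell u)"
proof
  have W: "W \<in> sets lebesgue" using T by (simp add: translation_tile_def)
  have Fm: "far_window u \<in> sets lebesgue" using far_window_tile[of u] by (simp add: translation_tile_def)
  have sub: "trimmed W u \<subseteq> W" by (auto simp: trimmed_def)
  show "trimmed W u \<in> sets lebesgue" unfolding trimmed_def
    by (intro sets.Diff W translation.saturation_measurable dilation.saturation_measurable symmetric_interval_measurable Fm)
  show "packs translate (trimmed W u)" "packs dilate (trimmed W u)"
    using T D packs_subset[OF _ sub] by (auto simp: translation_tile_def dilation_tile_def)
  show "translation_tile (far_window u)" by (rule far_window_tile)
  show "dilation_tile (near_shell u)" using u by (intro near_shell_tile)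
  show "packs dilate (far_window u)"
    unfolding packs_def
  proof (intro AE_I2 allI impI)
    fix x k l assume "dilate k x \<in> far_window u" "dilate l x \<in> far_window u"
    then show "k = l"
      using dilate_dyadic_unique[of "32 / u" k x l] u far_window_bounds[OF u] by fastforce
  qed
  show "k = l" if "translate k x \<in> near_shell u" "translate l x \<in> near_shell u" for x k l
  proof -
    have "\<bar>translate k x\<bar> < 1" "\<bar>translate l x\<bar> < 1" using that u by (auto simp: near_shell_def)
    then have "\<bar>2 * pi * of_int (k - l)\<bar> < 2" by (auto simp: translate_def algebra_simps)
    also have "\<bar>2 * pi * of_int (k - l)\<bar> = 2 * (pi * \<bar>of_int (k - l)\<bar>)" by (simp add: abs_mult)
    finally have "pi * \<bar>of_int (k - l)\<bar> < 1" by simp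
    moreover have "1 * \<bar>of_int (k - l)\<bar> \<le> pi * \<bar>of_int (k - l) :: real\<bar>"
      using pi_gt3 by (intro mult_right_mono) auto
    ultimately have "\<bar>of_int (k - l)\<bar> < (1 :: real)" by simp
    then show ?thesis by linarith
  qed
  show "x \<notin> saturation translate (trimmed W u)" if "x \<in> near_shell u" for x
  proof
    assume "x \<in> saturation translate (trimmed W u)"
    then obtain k where "translate k x \<in> trimmed W u" by (auto simp: saturation_def)
    then have "x \<notin> saturation translate (symmetric_interval u)"
      using translation.saturation_invariant by (auto simp: trimmed_def)
    moreover have "x \<in> symmetric_interval u" using that u by (auto simp: near_shell_def symmetric_interval_def)
    ultimately show False using translation.subset_saturation by blast
  qed
  show "x \<notin> saturation dilate (trimmed W u)" if "x \<in> far_window u" for x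
  proof
    assume "x \<in> saturation dilate (trimmed W u)"
    then obtain k where "dilate k x \<in> trimmed W u" by (auto simp: saturation_def)
    then have "x \<notin> saturation dilate (far_window u)"
      using dilation.saturation_invariant by (auto simp: trimmed_def)
    then show False using that dilation.subset_saturation by blast
  qed
  show "2 \<le> \<bar>x\<bar>" if "x \<in> far_window u" for x using far_window_bounds(1)[OF u that] by simp
  show "\<bar>x\<bar> \<le> 1" if "x \<in> near_shell u" for x using that u by (auto simp: near_shell_def)
qed

section \<open>Null limits for Lebesgue measure and for the dilation-invariant measure\<close>

lemma ennreal_tendsto_0I:
  fixes f :: "'a \<Rightarrow> ennreal"
  assumes "\<And>e. e > 0 \<Longrightarrow> \<forall>\<^sub>F x in Fl. f x \<le> ennreal e"
  shows "(f \<longlongrightarrow> 0) Fl"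
proof (rule order_tendstoI)
  fix a :: ennreal assume "0 < a"
  then obtain r where r: "0 < r" "r < a" using dense by blast
  then have "r \<noteq> \<top>" by (auto simp: top_unique)
  then obtain e where "r = ennreal e" "0 \<le> e" by (cases r) auto
  then show "\<forall>\<^sub>F x in Fl. f x < a"
    using assms[of e] r by (auto elim!: eventually_mono)
qed simp

lemma ennreal_tendsto_0D:
  fixes f :: "'a \<Rightarrow> ennreal"
  assumes "(f \<longlongrightarrow> 0) Fl" "e > 0"
  shows "\<forall>\<^sub>F x in Fl. f x \<le> ennreal e"
  using order_tendstoD(2)[OF assms(1), of "ennreal e"] assms(2) by (auto elim!: eventually_mono)

lemma ennreal_tendsto_0_mono:
  fixes f g :: "'a \<Rightarrow> ennreal"
  assumes "(g \<longlongrightarrow> 0) Fl" "\<forall>\<^sub>F x in Fl. f x \<le> g x"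
  shows "(f \<longlongrightarrow> 0) Fl"
  by (rule tendsto_sandwich[OF _ assms(2) tendsto_const assms(1)]) simp

lemma ennreal_tendsto_0_add:
  fixes f g :: "'a \<Rightarrow> ennreal"
  assumes "(f \<longlongrightarrow> 0) Fl" "(g \<longlongrightarrow> 0) Fl"
  shows "((\<lambda>x. f x + g x) \<longlongrightarrow> 0) Fl"
  using tendsto_add[OF assms] by simp

lemma ennreal_tendsto_0_cmult:
  fixes f :: "'a \<Rightarrow> ennreal"
  assumes "(f \<longlongrightarrow> 0) Fl" "c \<noteq> \<top>"
  shows "((\<lambda>x. c * f x) \<longlongrightarrow> 0) Fl"
  using ennreal_tendsto_cmult[OF _ assms(1), of c] assms(2) by (simp add: less_top)

lemma singleton_0_null: "emeasure lebesgue {0 :: real} = 0" "emeasure log_measure {0 :: real} = 0"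
proof -
  show "emeasure lebesgue {0 :: real} = 0" by simp
  then show "emeasure log_measure {0 :: real} = 0"
    using emeasure_log_measure_le[of "{0}" 0] by simp
qed

text \<open>Outside the small part \<open>W \<inter> T n\<close> of \<open>W\<close> the measure \<open>m\<close> is bounded by a multiple of \<open>m'\<close>.\<close>

lemma emeasure_tendsto_0_transfer:
  fixes T :: "nat \<Rightarrow> real set"
  assumes m: "sets m = sets lebesgue" "sets m' = sets lebesgue" "emeasure m {0} = 0"
    and W: "W \<in> sets lebesgue" "emeasure m W < \<infinity>"
    and T: "\<And>n. T n \<in> sets lebesgue" "decseq T" "(\<Inter>n. T n) \<subseteq> {0}"
    and le: "\<And>n S. S \<in> sets lebesgue \<Longrightarrow> S \<inter> T n = {} \<Longrightarrow> emeasure m S \<le> ennreal (c n) * emeasure m' S"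
    and S: "\<And>t. S t \<in> sets lebesgue" "\<And>t. S t \<subseteq> W"
    and lim: "((\<lambda>t. emeasure m' (S t)) \<longlongrightarrow> 0) Fl"
  shows "((\<lambda>t. emeasure m (S t)) \<longlongrightarrow> 0) Fl"
proof (rule ennreal_tendsto_0I)
  fix e :: real assume "e > 0"
  have "(\<lambda>n. emeasure m (W \<inter> T n)) \<longlonglongrightarrow> emeasure m (\<Inter>n. W \<inter> T n)"
  proof (rule Lim_emeasure_decseq)
    show "range (\<lambda>n. W \<inter> T n) \<subseteq> sets m" using m W T by auto
    show "decseq (\<lambda>n. W \<inter> T n)" using T(2) by (auto simp: decseq_def)
    show "emeasure m (W \<inter> T i) \<noteq> \<infinity>" for i
      using W m T order.strict_trans1[OF emeasure_mono[of "W \<inter> T i" W m] W(2)] by auto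
  qed
  also have "emeasure m (\<Inter>n. W \<inter> T n) = 0"
  proof -
    have "emeasure m (\<Inter>n. W \<inter> T n) \<le> emeasure m {0}"
      using T(3) m by (intro emeasure_mono) auto
    then show ?thesis using m(3) by simp
  qed
  finally have "\<forall>\<^sub>F n in sequentially. emeasure m (W \<inter> T n) \<le> ennreal (e / 2)"
    using \<open>e > 0\<close> by (intro ennreal_tendsto_0D) auto
  then obtain n where n: "emeasure m (W \<inter> T n) \<le> ennreal (e / 2)" by (auto simp: eventually_sequentially)
  have bound: "emeasure m (S t) \<le> ennreal (e / 2) + ennreal (c n) * emeasure m' (S t)" for t
  proof -
    have b1: "emeasure m (S t) \<le> emeasure m (W \<inter> T n) + emeasure m (S t - T n)"
      using S[of t] W T(1)[of n] m by (intro emeasure_le_of_subset_Un) auto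
    have b2: "emeasure m (S t - T n) \<le> ennreal (c n) * emeasure m' (S t - T n)"
      using S T(1)[of n] by (intro le[of _ n]) auto
    have b3: "emeasure m' (S t - T n) \<le> emeasure m' (S t)"
      using S m by (intro emeasure_mono) auto
    show ?thesis by (rule order_trans[OF b1 add_mono[OF n order_trans[OF b2 mult_left_mono[OF b3 zero_le]]]])
  qed
  have "((\<lambda>t. ennreal (c n) * emeasure m' (S t)) \<longlongrightarrow> 0) Fl"
    by (rule ennreal_tendsto_0_cmult[OF lim ennreal_neq_top])
  from ennreal_tendsto_0D[OF this, of "e / 2"]
  show "\<forall>\<^sub>F t in Fl. emeasure m (S t) \<le> ennreal e"
  proof (rule eventually_mono)
    fix t assume t: "ennreal (c n) * emeasure m' (S t) \<le> ennreal (e / 2)"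
    have "emeasure m (S t) \<le> ennreal (e / 2) + ennreal (e / 2)"
      by (rule order_trans[OF bound add_left_mono[OF t]])
    also have "\<dots> = ennreal e" using \<open>e > 0\<close> by (subst ennreal_plus[symmetric]) auto
    finally show "emeasure m (S t) \<le> ennreal e" .
  qed (use \<open>e > 0\<close> in simp)
qed

text \<open>The density of \<open>dx / \<bar>x\<bar>\<close> is unbounded only near \<open>0\<close>.\<close>

lemma log_measure_tendsto_0:
  assumes "W \<in> sets lebesgue" "emeasure log_measure W < \<infinity>"
    and "\<And>t. S t \<in> sets lebesgue" "\<And>t. S t \<subseteq> W"
    and "((\<lambda>t. emeasure lebesgue (S t)) \<longlongrightarrow> 0) Fl"
  shows "((\<lambda>t. emeasure log_measure (S t)) \<longlongrightarrow> 0) Fl"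
proof (rule emeasure_tendsto_0_transfer[OF sets_log_measure refl singleton_0_null(2) assms(1,2) _ _ _ _ assms(3-5)])
  let ?T = "\<lambda>n. symmetric_interval (1 / real (Suc n))"
  show "?T n \<in> sets lebesgue" for n by (rule symmetric_interval_measurable)
  show "decseq ?T"
  proof (rule decseq_SucI)
    fix n have "1 / real (Suc (Suc n)) \<le> 1 / real (Suc n)" by (simp add: frac_le)
    then show "?T (Suc n) \<subseteq> ?T n" unfolding symmetric_interval_def by auto
  qed
  show "(\<Inter>n. ?T n) \<subseteq> {0}"
  proof
    fix x assume x: "x \<in> (\<Inter>n. ?T n)"
    show "x \<in> {0}"
    proof (rule ccontr)
      assume "x \<notin> {0}"
      then obtain n where "inverse (real (Suc n)) < \<bar>x\<bar>" using reals_Archimedean[of "\<bar>x\<bar>"] by auto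
      then show False using x by (auto simp: symmetric_interval_def inverse_eq_divide dest!: spec[of _ n])
    qed
  qed
  fix n and S :: "real set" assume S: "S \<in> sets lebesgue" "S \<inter> ?T n = {}"
  show "emeasure log_measure S \<le> ennreal (real (Suc n)) * emeasure lebesgue S"
  proof (rule emeasure_log_measure_le[OF S(1)])
    fix x assume "x \<in> S"
    then have "1 / real (Suc n) \<le> \<bar>x\<bar>" using S(2) by (auto simp: symmetric_interval_def)
    moreover have "0 < 1 / real (Suc n)" by simp
    ultimately have "1 / \<bar>x\<bar> \<le> 1 / (1 / real (Suc n))"
      by (intro divide_left_mono mult_pos_pos) (auto simp del: of_nat_Suc)
    then show "1 / \<bar>x\<bar> \<le> real (Suc n)" by simp
  qed
qed

text \<open>The density of Lebesgue measure with respect to \<open>dx / \<bar>x\<bar>\<close> is unbounded only near infinity.\<close>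

lemma lebesgue_tendsto_0:
  assumes "W \<in> sets lebesgue" "emeasure lebesgue W < \<infinity>"
    and "\<And>t. S t \<in> sets lebesgue" "\<And>t. S t \<subseteq> W"
    and "((\<lambda>t. emeasure log_measure (S t)) \<longlongrightarrow> 0) Fl"
  shows "((\<lambda>t. emeasure lebesgue (S t)) \<longlongrightarrow> 0) Fl"
proof (rule emeasure_tendsto_0_transfer[OF refl sets_log_measure singleton_0_null(1) assms(1,2) _ _ _ _ assms(3-5)])
  let ?T = "\<lambda>n. - symmetric_interval (real n)"
  show "?T n \<in> sets lebesgue" for n
    by (intro Compl_in_sets_lebesgue[THEN iffD2] symmetric_interval_measurable)
  show "decseq ?T" by (auto simp: decseq_def symmetric_interval_def)
  show "(\<Inter>n. ?T n) \<subseteq> {0}"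
  proof
    fix x assume x: "x \<in> (\<Inter>n. ?T n)"
    obtain n where "\<bar>x\<bar> < real n" using reals_Archimedean2 by blast
    moreover have "x \<in> ?T n" using x by blast
    ultimately show "x \<in> {0}" by (simp add: symmetric_interval_def)
  qed
  show "emeasure lebesgue S \<le> ennreal (real n) * emeasure log_measure S"
    if "S \<in> sets lebesgue" "S \<inter> ?T n = {}" for n S
    by (rule emeasure_lebesgue_le) (use that in \<open>auto simp: symmetric_interval_def less_imp_le\<close>)
qed

text \<open>The integral in the distance is a Bochner integral, which equals \<open>enn2real\<close> of the measure even if
  the latter is infinite.\<close>

lemma wavelet_set_dist_tendsto_0:
  assumes m: "\<And>t. V t \<in> sets lebesgue" "X \<in> sets lebesgue"
    and l1: "((\<lambda>t. emeasure lebesgue (sym_diff (V t) X)) \<longlongrightarrow> 0) Fl"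
    and l2: "((\<lambda>t. emeasure log_measure (sym_diff (V t) X)) \<longlongrightarrow> 0) Fl"
  shows "((\<lambda>t. wavelet_set_dist (V t) X) \<longlongrightarrow> 0) Fl"
proof -
  have sd: "sym_diff (V t) X \<in> sets lebesgue" for t using m by auto
  have eq: "(LINT x:S|lebesgue. 1 / \<bar>x\<bar>) = enn2real (emeasure log_measure S)" if S: "S \<in> sets lebesgue" for S
  proof -
    have "(\<lambda>x. indicator S x *\<^sub>R (1 / \<bar>x\<bar>)) \<in> borel_measurable lebesgue"
      using S inverse_abs_measurable by (intro borel_measurable_scaleR borel_measurable_indicator)
    then have "(LINT x:S|lebesgue. 1 / \<bar>x\<bar>) = enn2real (\<integral>\<^sup>+x. ennreal (indicator S x *\<^sub>R (1 / \<bar>x\<bar>)) \<partial>lebesgue)"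
      unfolding set_lebesgue_integral_def by (rule integral_eq_nn_integral) simp
    also have "(\<lambda>x. ennreal (indicator S x *\<^sub>R (1 / \<bar>x\<bar>))) = (\<lambda>x. ennreal (1 / \<bar>x\<bar>) * indicator S x)"
      by (auto simp: indicator_def)
    finally show ?thesis by (simp add: emeasure_log_measure[OF S])
  qed
  have "((\<lambda>t. enn2real (emeasure lebesgue (sym_diff (V t) X))) \<longlongrightarrow> 0) Fl"
    "((\<lambda>t. enn2real (emeasure log_measure (sym_diff (V t) X))) \<longlongrightarrow> 0) Fl"
    using tendsto_enn2real[of _ 0] l1 l2 by auto
  from tendsto_add[OF tendsto_real_sqrt[OF this(1)] tendsto_real_sqrt[OF this(2)]]
  show ?thesis unfolding wavelet_set_dist_def measure_def eq[OF sd] by simp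
qed

section \<open>Paths of wavelet sets\<close>

text \<open>A set that packs under dilations is no larger than a dilation tile, and a dyadic shell is a bounded
  dilation tile away from \<open>0\<close>.\<close>

lemma dilation_tile_log_measure_finite:
  assumes "dilation_tile W"
  shows "emeasure log_measure W < \<infinity>"
proof -
  have N: "near_shell 1 \<in> sets lebesgue" "covers dilate (near_shell 1)"
    using near_shell_tile[of 1] by (auto simp: dilation_tile_def)
  have "emeasure log_measure W \<le> emeasure log_measure (near_shell 1)"
    using assms N by (intro dilation.emeasure_le_of_packs_covers) (auto simp: dilation_tile_def)
  also have "\<dots> \<le> ennreal 8 * emeasure lebesgue (near_shell 1)"
  proof (rule emeasure_log_measure_le[OF N(1)])
    show "1 / \<bar>x\<bar> \<le> 8" if "x \<in> near_shell 1" for x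
      using that by (auto simp: near_shell_def field_simps)
  qed
  also have "\<dots> \<le> ennreal 8 * emeasure lebesgue {-1..1 :: real}"
    by (intro mult_left_mono emeasure_mono) (auto simp: near_shell_def)
  also have "\<dots> < \<infinity>" by (simp add: ennreal_mult_less_top)
  finally show ?thesis .
qed

lemma symmetric_interval_sym_diff:
  "emeasure lebesgue (sym_diff (symmetric_interval a) (symmetric_interval b)) \<le> ennreal (2 * \<bar>a - b\<bar>)"
proof -
  define l h where "l = min a b" and "h = max a b"
  have lh: "l \<le> h" "h - l = \<bar>a - b\<bar>" by (auto simp: l_def h_def)
  have "sym_diff (symmetric_interval a) (symmetric_interval b) \<subseteq> {l..h} \<union> {- h..- l}"
    by (auto simp: symmetric_interval_def l_def h_def min_def max_def abs_if split: if_splits)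
  then have "emeasure lebesgue (sym_diff (symmetric_interval a) (symmetric_interval b)) \<le>
      emeasure lebesgue {l..h} + emeasure lebesgue {- h..- l}"
    by (rule emeasure_le_of_subset_Un) auto
  also have "\<dots> = ennreal (h - l + (h - l))"
    using lh by (subst ennreal_plus) auto
  finally show ?thesis using lh by simp
qed

lemma period_window_sym_diff:
  fixes a b p :: real
  shows "emeasure lebesgue (sym_diff {a..<a + p} {b..<b + p}) \<le> ennreal (2 * \<bar>a - b\<bar>)"
proof -
  define l h where "l = min a b" and "h = max a b"
  have lh: "l \<le> h" "h - l = \<bar>a - b\<bar>" by (auto simp: l_def h_def)
  have "sym_diff {a..<a + p} {b..<b + p} \<subseteq> {l..h} \<union> {l + p..h + p}"
    by (auto simp: l_def h_def min_def max_def split: if_splits)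
  then have "emeasure lebesgue (sym_diff {a..<a + p} {b..<b + p}) \<le>
      emeasure lebesgue {l..h} + emeasure lebesgue {l + p..h + p}"
    by (rule emeasure_le_of_subset_Un) auto
  also have "\<dots> = ennreal (h - l + (h - l))"
    using lh by (subst ennreal_plus) auto
  finally show ?thesis using lh by simp
qed

lemma near_shell_eq: "near_shell u = symmetric_interval (u / 4) - symmetric_interval (u / 8)"
  by (auto simp: near_shell_def symmetric_interval_def)

lemma far_window_measurable: "far_window u \<in> sets lebesgue"
  using far_window_tile[of u] by (simp add: translation_tile_def)

lemma near_shell_measurable: "near_shell u \<in> sets lebesgue"
  unfolding near_shell_eq by (intro sets.Diff symmetric_interval_measurable)

text \<open>The value at \<open>0\<close> is \<open>W\<close> itself rather than a set that agrees with it almost everywhere, because the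
  path has to start at the given set.\<close>

definition path_set :: "real set \<Rightarrow> real \<Rightarrow> real set" where
  "path_set W u = (if u = 0 then W else completion_set (trimmed W u) (far_window u) (near_shell u))"

lemma ennreal_real_tendsto_0:
  "(f \<longlongrightarrow> 0) Fl \<Longrightarrow> ((\<lambda>x. ennreal (f x)) \<longlongrightarrow> 0) Fl"
  using tendsto_ennrealI[of f 0 Fl] by simp

context
  fixes W :: "real set"
  assumes T: "translation_tile W" and D: "dilation_tile W"
begin

lemma path_set_tile:
  assumes "0 \<le> u" "u \<le> 4"
  shows "translation_tile (path_set W u)" "dilation_tile (path_set W u)"
  using assms T D completion_data.completion_tile[OF trimmed_completion_data[OF _ _ T D, of u]]
  by (auto simp: path_set_def)

lemma tile_measurable: "W \<in> sets lebesgue" using T by (simp add: translation_tile_def)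

lemma tile_finite: "emeasure lebesgue W < \<infinity>" "emeasure log_measure W < \<infinity>"
  using translation_tile_emeasure[OF T] dilation_tile_log_measure_finite[OF D] by auto

text \<open>A tile meets each translation class once, so the part of \<open>W\<close> in the classes of \<open>J t\<close> has at most the
  Lebesgue measure of \<open>J t\<close>; dually for \<open>F t\<close>. Smallness in one measure entails smallness in the other
  on \<open>W\<close>, where both are finite.\<close>

lemma saturated_pieces_tendsto_0:
  assumes meas: "\<And>t. J t \<in> sets lebesgue" "\<And>t. F t \<in> sets lebesgue"
    and J: "((\<lambda>t. emeasure lebesgue (J t)) \<longlongrightarrow> 0) Fl"
    and F: "((\<lambda>t. emeasure log_measure (F t)) \<longlongrightarrow> 0) Fl"
    and S: "\<And>t. S t \<in> sets lebesgue" "\<And>t. S t \<subseteq> W \<inter> (saturation translate (J t) \<union> saturation dilate (F t))"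
  shows "((\<lambda>t. emeasure lebesgue (S t)) \<longlongrightarrow> 0) Fl" and "((\<lambda>t. emeasure log_measure (S t)) \<longlongrightarrow> 0) Fl"
proof -
  define P where "P t = W \<inter> saturation translate (J t)" for t
  define R where "R t = W \<inter> saturation dilate (F t)" for t
  have m: "P t \<in> sets lebesgue" "R t \<in> sets lebesgue" "P t \<subseteq> W" "R t \<subseteq> W" for t
    unfolding P_def R_def using tile_measurable meas translation.saturation_measurable dilation.saturation_measurable by auto
  have P: "((\<lambda>t. emeasure lebesgue (P t)) \<longlongrightarrow> 0) Fl"
    by (rule ennreal_tendsto_0_mono[OF J], unfold P_def)
      (use T meas tile_measurable translation.emeasure_Int_saturation_le in \<open>simp add: translation_tile_def\<close>)
  have R: "((\<lambda>t. emeasure log_measure (R t)) \<longlongrightarrow> 0) Fl"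
    by (rule ennreal_tendsto_0_mono[OF F], unfold R_def)
      (use D meas tile_measurable dilation.emeasure_Int_saturation_le in \<open>simp add: dilation_tile_def\<close>)
  have P': "((\<lambda>t. emeasure log_measure (P t)) \<longlongrightarrow> 0) Fl"
    by (rule log_measure_tendsto_0[OF tile_measurable tile_finite(2) m(1) m(3) P])
  have R': "((\<lambda>t. emeasure lebesgue (R t)) \<longlongrightarrow> 0) Fl"
    by (rule lebesgue_tendsto_0[OF tile_measurable tile_finite(1) m(2) m(4) R])
  have sub: "S t \<subseteq> P t \<union> R t" for t using S(2)[of t] by (auto simp: P_def R_def)
  have "emeasure lebesgue (S t) \<le> emeasure lebesgue (P t) + emeasure lebesgue (R t)" for t
    by (rule emeasure_le_of_subset_Un[OF sub m(1) m(2)])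
  then show "((\<lambda>t. emeasure lebesgue (S t)) \<longlongrightarrow> 0) Fl"
    by (intro ennreal_tendsto_0_mono[OF ennreal_tendsto_0_add[OF P R']]) simp
  have "emeasure log_measure (S t) \<le> emeasure log_measure (P t) + emeasure log_measure (R t)" for t
    by (rule emeasure_le_of_subset_Un[OF sub]) (use m in auto)
  then show "((\<lambda>t. emeasure log_measure (S t)) \<longlongrightarrow> 0) Fl"
    by (intro ennreal_tendsto_0_mono[OF ennreal_tendsto_0_add[OF P' R]]) simp
qed

lemma trimmed_measurable: "trimmed W u \<in> sets lebesgue"
  unfolding trimmed_def
  by (intro sets.Diff tile_measurable translation.saturation_measurable dilation.saturation_measurable
      symmetric_interval_measurable far_window_measurable)

lemma path_set_measurable: "0 \<le> u \<Longrightarrow> u \<le> 4 \<Longrightarrow> path_set W u \<in> sets lebesgue"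
  using path_set_tile(1) by (simp add: translation_tile_def)

lemma sym_diff_tendsto_imp_dist_tendsto:
  assumes s: "0 \<le> s" "s \<le> 4"
    and E: "(E \<longlongrightarrow> 0) (at s within {0..4})"
    and le: "\<And>m. m \<in> {lebesgue, log_measure} \<Longrightarrow>
      \<forall>\<^sub>F u in at s within {0..4}. emeasure m (sym_diff (path_set W u) (path_set W s)) \<le> E u"
  shows "((\<lambda>u. wavelet_set_dist (path_set W u) (path_set W s)) \<longlongrightarrow> 0) (at s within {0..4})"
proof -
  \<comment> \<open>Inside the parameter range the path sets are tiles, hence measurable.\<close>
  define V where "V u = (if u \<in> {0..4} then path_set W u else {})" for u
  have ev: "\<forall>\<^sub>F u in at s within {0..4}. V u = path_set W u"
    by (auto simp: V_def eventually_at_filter)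
  have "((\<lambda>u. emeasure m (sym_diff (V u) (path_set W s))) \<longlongrightarrow> 0) (at s within {0..4})"
    if "m \<in> {lebesgue, log_measure}" for m
  proof (rule ennreal_tendsto_0_mono[OF E])
    show "\<forall>\<^sub>F u in at s within {0..4}. emeasure m (sym_diff (V u) (path_set W s)) \<le> E u"
      using le[OF that] ev by eventually_elim simp
  qed
  then have "((\<lambda>u. wavelet_set_dist (V u) (path_set W s)) \<longlongrightarrow> 0) (at s within {0..4})"
    using s by (intro wavelet_set_dist_tendsto_0) (auto simp: V_def path_set_measurable)
  then show ?thesis
    by (rule Lim_transform_eventually) (use ev in eventually_elim, simp)
qed

text \<open>The window, the interval and the shell move continuously with \<open>u\<close>, and the trimmed set changes only
  in the classes that they gain or lose.\<close>

lemma path_set_continuous_pos: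
  assumes s: "0 < s" "s \<le> 4"
  shows "((\<lambda>u. wavelet_set_dist (path_set W u) (path_set W s)) \<longlongrightarrow> 0) (at s within {0..4})"
proof -
  let ?Fl = "at s within {0..4}"
  have id: "((\<lambda>u. u) \<longlongrightarrow> s) ?Fl" by (rule tendsto_ident_at)
  have ev: "\<forall>\<^sub>F u in ?Fl. s / 2 < u \<and> u \<le> 4"
  proof -
    have "\<forall>\<^sub>F u in ?Fl. s / 2 < u" using order_tendstoD(1)[OF id, of "s / 2"] s by simp
    moreover have "\<forall>\<^sub>F u in ?Fl. u \<le> 4" by (auto simp: eventually_at_filter)
    ultimately show ?thesis by eventually_elim simp
  qed
  define fF where "fF u = sym_diff (far_window u) (far_window s)" for u
  define fG where "fG u = sym_diff (near_shell u) (near_shell s)" for u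
  define fA where "fA u = sym_diff (trimmed W u) (trimmed W s)" for u
  define fJ where "fJ u = sym_diff (symmetric_interval u) (symmetric_interval s)" for u
  have Fm: "fF u \<in> sets lebesgue" and Gm: "fG u \<in> sets lebesgue" and Am: "fA u \<in> sets lebesgue"
    and Jm: "fJ u \<in> sets lebesgue" for u
    unfolding fF_def fG_def fA_def fJ_def
    using far_window_measurable near_shell_measurable trimmed_measurable symmetric_interval_measurable by auto
  have Jlim: "((\<lambda>u. emeasure lebesgue (fJ u)) \<longlongrightarrow> 0) ?Fl"
  proof (rule ennreal_tendsto_0_mono)
    have "((\<lambda>u. 2 * \<bar>u - s\<bar>) \<longlongrightarrow> 2 * \<bar>s - s\<bar>) ?Fl" by (intro tendsto_intros)
    then show "((\<lambda>u. ennreal (2 * \<bar>u - s\<bar>)) \<longlongrightarrow> 0) ?Fl" by (intro ennreal_real_tendsto_0) simp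
  qed (simp add: fJ_def symmetric_interval_sym_diff)
  have Flim: "((\<lambda>u. emeasure lebesgue (fF u)) \<longlongrightarrow> 0) ?Fl"
  proof (rule ennreal_tendsto_0_mono)
    have "((\<lambda>u. 2 * \<bar>32 / u - 32 / s\<bar>) \<longlongrightarrow> 2 * \<bar>32 / s - 32 / s\<bar>) ?Fl"
      using s by (intro tendsto_intros) auto
    then show "((\<lambda>u. ennreal (2 * \<bar>32 / u - 32 / s\<bar>)) \<longlongrightarrow> 0) ?Fl" by (intro ennreal_real_tendsto_0) simp
    show "\<forall>\<^sub>F u in ?Fl. emeasure lebesgue (fF u) \<le> ennreal (2 * \<bar>32 / u - 32 / s\<bar>)"
      unfolding fF_def far_window_def by (intro always_eventually allI period_window_sym_diff)
  qed
  have Flim': "((\<lambda>u. emeasure log_measure (fF u)) \<longlongrightarrow> 0) ?Fl"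
  proof (rule ennreal_tendsto_0_mono[OF Flim], use ev in eventually_elim)
    case (elim u)
    then have u: "0 < u" "u \<le> 4" using s by auto
    have "2 \<le> \<bar>x\<bar>" if "x \<in> fF u" for x
      using that far_window_bounds(1)[OF u, of x] far_window_bounds(1)[OF s, of x] by (auto simp: fF_def)
    from order_trans[OF log_measure_far[OF Fm this] ennreal_half_mult_le] show ?case .
  qed
  have Glim: "((\<lambda>u. emeasure log_measure (fG u)) \<longlongrightarrow> 0) ?Fl"
  proof (rule ennreal_tendsto_0_mono)
    have "((\<lambda>u. 2 * \<bar>u / 4 - s / 4\<bar> + 2 * \<bar>u / 8 - s / 8\<bar>) \<longlongrightarrow> 2 * \<bar>s / 4 - s / 4\<bar> + 2 * \<bar>s / 8 - s / 8\<bar>) ?Fl"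
      by (intro tendsto_intros) auto
    then have "((\<lambda>u. ennreal (2 * \<bar>u / 4 - s / 4\<bar> + 2 * \<bar>u / 8 - s / 8\<bar>)) \<longlongrightarrow> 0) ?Fl"
      by (intro ennreal_real_tendsto_0) simp
    then show "((\<lambda>u. ennreal (16 / s) * ennreal (2 * \<bar>u / 4 - s / 4\<bar> + 2 * \<bar>u / 8 - s / 8\<bar>)) \<longlongrightarrow> 0) ?Fl"
      by (rule ennreal_tendsto_0_cmult) simp
    show "\<forall>\<^sub>F u in ?Fl. emeasure log_measure (fG u) \<le>
        ennreal (16 / s) * ennreal (2 * \<bar>u / 4 - s / 4\<bar> + 2 * \<bar>u / 8 - s / 8\<bar>)"
      using ev
    proof eventually_elim
      case (elim u)
      have "emeasure log_measure (fG u) \<le> ennreal (16 / s) * emeasure lebesgue (fG u)"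
      proof (rule emeasure_log_measure_le[OF Gm])
        fix x assume "x \<in> fG u"
        then have "s / 16 \<le> \<bar>x\<bar>" using elim s by (auto simp: fG_def near_shell_def)
        then have "1 / \<bar>x\<bar> \<le> 1 / (s / 16)" using s by (intro divide_left_mono mult_pos_pos) auto
        then show "1 / \<bar>x\<bar> \<le> 16 / s" by simp
      qed
      also have "emeasure lebesgue (fG u) \<le> emeasure lebesgue (sym_diff (symmetric_interval (u / 4)) (symmetric_interval (s / 4))) +
          emeasure lebesgue (sym_diff (symmetric_interval (u / 8)) (symmetric_interval (s / 8)))"
        unfolding fG_def near_shell_eq using symmetric_interval_measurable by (intro emeasure_le_of_subset_Un) auto
      also have "\<dots> \<le> ennreal (2 * \<bar>u / 4 - s / 4\<bar>) + ennreal (2 * \<bar>u / 8 - s / 8\<bar>)"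
        by (intro add_mono symmetric_interval_sym_diff)
      also have "\<dots> = ennreal (2 * \<bar>u / 4 - s / 4\<bar> + 2 * \<bar>u / 8 - s / 8\<bar>)"
        by (rule ennreal_plus[symmetric]) auto
      finally show ?case by (simp add: mult_left_mono)
    qed
  qed
  have Asub: "fA u \<subseteq> W \<inter> (saturation translate (fJ u) \<union> saturation dilate (fF u))" for u
    unfolding fA_def fJ_def fF_def trimmed_def saturation_def by blast
  note Alim = saturated_pieces_tendsto_0[OF Jm Fm Jlim Flim' Am Asub]
  define E where "E u = emeasure lebesgue (fF u) + emeasure lebesgue (fA u) +
    (emeasure log_measure (fG u) + emeasure log_measure (fA u))" for u
  show ?thesis
  proof (rule sym_diff_tendsto_imp_dist_tendsto)
    show "0 \<le> s" "s \<le> 4" using s by auto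
    have "(E \<longlongrightarrow> 0) ?Fl" unfolding E_def
      by (intro ennreal_tendsto_0_add Flim Alim Glim)
    then show "((\<lambda>u. 5 * E u) \<longlongrightarrow> 0) ?Fl" by (rule ennreal_tendsto_0_cmult) simp
    fix m :: "real measure" assume m: "m \<in> {lebesgue, log_measure}"
    show "\<forall>\<^sub>F u in ?Fl. emeasure m (sym_diff (path_set W u) (path_set W s)) \<le> 5 * E u"
      using ev
    proof eventually_elim
      case (elim u)
      then have u: "0 < u" "u \<le> 4" using s by auto
      show ?case
        using completion_set_sym_diff_le[OF trimmed_completion_data[OF u T D] trimmed_completion_data[OF s T D]] m u s
        by (auto simp: path_set_def E_def fF_def fG_def fA_def)
    qed
  qed
qed

text \<open>As \<open>u\<close> tends to \<open>0\<close>, the interval shrinks in Lebesgue measure, while the window keeps its length but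
  escapes to infinity, where the dilation-invariant measure of an interval of fixed length tends to \<open>0\<close>.\<close>

lemma path_set_continuous_0:
  "((\<lambda>u. wavelet_set_dist (path_set W u) (path_set W 0)) \<longlongrightarrow> 0) (at 0 within {0..4})"
proof -
  let ?Fl = "at 0 within {0..4 :: real}"
  have id: "((\<lambda>u. u) \<longlongrightarrow> 0) ?Fl" by (rule tendsto_ident_at)
  have ev: "\<forall>\<^sub>F u in ?Fl. 0 < u \<and> u \<le> 4" by (auto simp: eventually_at_filter)
  define fR where "fR u = W - trimmed W u" for u
  have Rm: "fR u \<in> sets lebesgue" for u using tile_measurable trimmed_measurable by (auto simp: fR_def)
  have Jlim: "((\<lambda>u. emeasure lebesgue (symmetric_interval u)) \<longlongrightarrow> 0) ?Fl"
  proof (rule ennreal_tendsto_0_mono)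
    have "((\<lambda>u. 2 * \<bar>u\<bar>) \<longlongrightarrow> 2 * \<bar>0\<bar>) ?Fl" by (intro tendsto_intros)
    then show "((\<lambda>u. ennreal (2 * \<bar>u\<bar>)) \<longlongrightarrow> 0) ?Fl" by (intro ennreal_real_tendsto_0) simp
    have "symmetric_interval 0 = {}" by (auto simp: symmetric_interval_def)
    then show "\<forall>\<^sub>F u in ?Fl. emeasure lebesgue (symmetric_interval u) \<le> ennreal (2 * \<bar>u\<bar>)"
      using symmetric_interval_sym_diff[of _ 0] by simp
  qed
  have Flim: "((\<lambda>u. emeasure log_measure (far_window u)) \<longlongrightarrow> 0) ?Fl"
  proof (rule ennreal_tendsto_0_mono)
    have "((\<lambda>u. u / 32 * (2 * pi)) \<longlongrightarrow> 0 / 32 * (2 * pi)) ?Fl" by (intro tendsto_intros) auto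
    then show "((\<lambda>u. ennreal (u / 32 * (2 * pi))) \<longlongrightarrow> 0) ?Fl" by (intro ennreal_real_tendsto_0) simp
    show "\<forall>\<^sub>F u in ?Fl. emeasure log_measure (far_window u) \<le> ennreal (u / 32 * (2 * pi))"
      using ev
    proof eventually_elim
      case (elim u)
      then have u: "0 < u" "u \<le> 4" by auto
      have "emeasure log_measure (far_window u) \<le> ennreal (u / 32) * emeasure lebesgue (far_window u)"
      proof (rule emeasure_log_measure_le[OF far_window_measurable])
        fix x assume "x \<in> far_window u"
        then have "1 / \<bar>x\<bar> \<le> 1 / (32 / u)"
          using far_window_bounds[OF u, of x] u by (intro divide_left_mono mult_pos_pos) auto
        then show "1 / \<bar>x\<bar> \<le> u / 32" by simp
      qed
      also have "\<dots> = ennreal (u / 32) * ennreal (2 * pi)"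
        by (simp only: translation_tile_emeasure[OF far_window_tile])
      also have "\<dots> = ennreal (u / 32 * (2 * pi))" using u by (intro ennreal_mult[symmetric]) auto
      finally show ?case .
    qed
  qed
  have Rsub: "fR u \<subseteq> W \<inter> (saturation translate (symmetric_interval u) \<union> saturation dilate (far_window u))" for u
    unfolding fR_def trimmed_def by blast
  note Rlim = saturated_pieces_tendsto_0[OF symmetric_interval_measurable far_window_measurable Jlim Flim Rm Rsub]
  define E where "E u = emeasure lebesgue (fR u) + emeasure log_measure (fR u)" for u
  show ?thesis
  proof (rule sym_diff_tendsto_imp_dist_tendsto)
    have "(E \<longlongrightarrow> 0) ?Fl" unfolding E_def by (intro ennreal_tendsto_0_add Rlim)
    then show "((\<lambda>u. 2 * E u) \<longlongrightarrow> 0) ?Fl" by (rule ennreal_tendsto_0_cmult) simp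
    fix m :: "real measure" assume m: "m \<in> {lebesgue, log_measure}"
    show "\<forall>\<^sub>F u in ?Fl. emeasure m (sym_diff (path_set W u) (path_set W 0)) \<le> 2 * E u"
      using ev
    proof eventually_elim
      case (elim u)
      then have u: "0 < u" "u \<le> 4" by auto
      have "trimmed W u \<subseteq> W" by (auto simp: trimmed_def)
      from completion_set_sym_diff_base_le[OF trimmed_completion_data[OF u T D] T D this] m u
      show ?case by (auto simp: path_set_def E_def fR_def)
    qed
  qed auto
qed

lemma path_set_continuous:
  assumes "s \<in> {0..4}"
  shows "((\<lambda>u. wavelet_set_dist (path_set W u) (path_set W s)) \<longlongrightarrow> 0) (at s within {0..4})"
  using assms path_set_continuous_0 path_set_continuous_pos[of s] by (cases "s = 0") auto

text \<open>Every translation class has a representative in \<open>[- pi, pi]\<close>, which lies in \<open>(- 4, 4)\<close>, so nothing of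
  \<open>W\<close> is left after trimming.\<close>

lemma path_set_4: "path_set W 4 = completion_set {} (far_window 4) (near_shell 4)"
proof -
  have "x \<in> saturation translate (symmetric_interval 4)" for x
  proof -
    obtain k where "translate k x \<in> {- pi..<- pi + 2 * pi}"
      using half_open_period_representative[of x "- pi"] by blast
    then have "\<bar>translate k x\<bar> \<le> pi" by auto
    then show ?thesis using pi_less_4 by (auto simp: saturation_def symmetric_interval_def intro!: exI[of _ k])
  qed
  then have "trimmed W 4 = {}" by (auto simp: trimmed_def)
  then show ?thesis by (simp add: path_set_def)
qed

lemma path_set_wavelet_set: "0 \<le> u \<Longrightarrow> u \<le> 4 \<Longrightarrow> wavelet_set (path_set W u)"
  using path_set_tile by (intro wavelet_set_of_tile)

end

theorem theorem3p5:
  fixes W0 W1 :: "real set"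
  assumes "wavelet_set W0" and "wavelet_set W1"
  shows "\<exists>W :: real \<Rightarrow> real set.
           (\<forall>t\<in>{0..1}. wavelet_set (W t)) \<and> W 0 = W0 \<and> W 1 = W1 \<and>
           (\<forall>s\<in>{0..1}. ((\<lambda>t. wavelet_set_dist (W t) (W s)) \<longlongrightarrow> 0) (at s within {0..1}))"
proof -
  note tile0 = tile_of_wavelet_set[OF assms(1)] and tile1 = tile_of_wavelet_set[OF assms(2)]
  \<comment> \<open>Both branches run over the parameters from \<open>0\<close> to \<open>4\<close> and meet at \<open>4\<close>.\<close>
  define W where "W t = (if t \<le> 1 / 2 then path_set W0 (8 * t) else path_set W1 (8 * (1 - t)))" for t
  have left: "W t = path_set W0 (8 * t)" if "t \<le> 1 / 2" for t using that by (simp add: W_def)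
  have right: "W t = path_set W1 (8 * (1 - t))" if "1 / 2 \<le> t" for t
  proof (cases "t = 1 / 2")
    case True
    then have "8 * t = 4" "8 * (1 - t) = 4" by simp_all
    then show ?thesis using True path_set_4[OF tile0] path_set_4[OF tile1] by (simp only: left)
  qed (use that in \<open>simp add: W_def\<close>)
  have lim: "((\<lambda>t. wavelet_set_dist (W t) (W s)) \<longlongrightarrow> 0) (at s within I)"
    if X: "translation_tile X" "dilation_tile X" and W: "\<And>t. t \<in> I \<Longrightarrow> W t = path_set X (c t)"
      and c: "\<And>t. t \<in> I \<Longrightarrow> c t \<in> {0..4}" "\<And>t t'. dist (c t) (c t') = 8 * dist t t'"
      and I: "closed I" for s X I and c :: "real \<Rightarrow> real"
  proof (cases "s \<in> I")
    case True
    show ?thesis unfolding Lim_within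
    proof (intro allI impI)
      fix e :: real assume "e > 0"
      then obtain d where d: "d > 0" "\<And>u. u \<in> {0..4} \<Longrightarrow> 0 < dist u (c s) \<Longrightarrow> dist u (c s) < d \<Longrightarrow>
          dist (wavelet_set_dist (path_set X u) (path_set X (c s))) 0 < e"
        using path_set_continuous[OF X c(1)[OF True]] unfolding Lim_within by blast
      have "dist (wavelet_set_dist (W t) (W s)) 0 < e" if "t \<in> I" "0 < dist t s" "dist t s < d / 8" for t
        using d(2)[OF c(1)[OF that(1)]] that by (simp add: W True c(2))
      then show "\<exists>d>0. \<forall>t\<in>I. 0 < dist t s \<and> dist t s < d \<longrightarrow> dist (wavelet_set_dist (W t) (W s)) 0 < e"
        using \<open>d > 0\<close> by (intro exI[of _ "d / 8"]) auto
    qed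
  next
    case False
    then have "at s within I = bot"
      using I by (metis closed_limpt trivial_limit_within)
    then show ?thesis by simp
  qed
  have Un: "{0..1 :: real} = {0..1 / 2} \<union> {1 / 2..1}" by auto
  show ?thesis
  proof (intro exI[of _ W] conjI ballI)
    fix t :: real assume t: "t \<in> {0..1}"
    show "wavelet_set (W t)"
    proof (cases "t \<le> 1 / 2")
      case True
      then show ?thesis using t unfolding left[OF True] by (intro path_set_wavelet_set tile0) auto
    next
      case False
      then show ?thesis using t unfolding right[OF less_imp_le[OF False[unfolded not_le]]]
        by (intro path_set_wavelet_set tile1) auto
    qed
  next
    show "W 0 = W0" "W 1 = W1" by (simp_all add: W_def path_set_def)
  next
    fix s :: real assume s: "s \<in> {0..1}"
    show "((\<lambda>t. wavelet_set_dist (W t) (W s)) \<longlongrightarrow> 0) (at s within {0..1})"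
      unfolding Un
    proof (rule Lim_Un)
      show "((\<lambda>t. wavelet_set_dist (W t) (W s)) \<longlongrightarrow> 0) (at s within {0..1 / 2})"
      proof (rule lim[OF tile0, where c = "\<lambda>t. 8 * t"])
        show "W t = path_set W0 (8 * t)" if "t \<in> {0..1 / 2}" for t using that by (intro left) simp
        show "dist (8 * t) (8 * t') = 8 * dist t t'" for t t' :: real
          by (simp add: dist_real_def abs_if)
      qed auto
      show "((\<lambda>t. wavelet_set_dist (W t) (W s)) \<longlongrightarrow> 0) (at s within {1 / 2..1})"
      proof (rule lim[OF tile1, where c = "\<lambda>t. 8 * (1 - t)"])
        show "W t = path_set W1 (8 * (1 - t))" if "t \<in> {1 / 2..1}" for t using that by (intro right) simp
        show "dist (8 * (1 - t)) (8 * (1 - t')) = 8 * dist t t'" for t t' :: real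
          by (simp add: dist_real_def abs_if)
      qed auto
    qed
  qed
qed

end
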